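(* Let $A=A_S$ be an irreducible Artin-Tits group of spherical type with rank at least 3. Then $X_{abs}^A\preccurlyeq X_{NP}^A\preccurlyeq X_P^A$.
   Context: Let $S$ be a finite set and $M=(m_{s,t})_{s,t\in S}$ a symmetric matrix with $m_{s,s}=1$ and $m_{s,t}\in\{2,3,\dots\}\cup\{\infty\}$ for $s\neq t$. The Artin-Tits group $A_S$ is generated by $S$ subject to the relations $\Pi(s,t;m_{s,t})=\Pi(t,s;m_{s,t})$ for all $s\ne t$ with $m_{s,t}<\infty$, where $\Pi(a,b;m)=aba\cdots$ is the alternating word of length $m$ starting with $a$. The Coxeter graph $\Gamma_S$ has vertex set $S$ and an edge between distinct $s,t$ whenever $m_{s,t}\geqslant3$. The rank of $A_S$ is $|S|$. $A_S$ is irreducible if $\Gamma_S$ is connected (and nonempty), and of spherical type if the Coxeter group obtained from $A_S$ by adding the relations $s^2=1$, $s\in S$, is finite. For $T\subset S$, the subgroup $A_T$ generated by $T$ is called a standard parabolic subgroup; it is proper if $T\neq S$, and irreducible if $T$ is nonempty and the subgraph of $\Gamma_S$ induced by $T$ is connected. Let $A^+$ be the submonoid of $A$ generated by $S$, and let the Garside element $\Delta=\Delta_S$ be the least common multiple of $S$ in $A^+$. For $x\in A$, $\inf(x)=\max\{k\in\mathbb Z: \Delta^{-k}x\in A^+\}$ and $\sup(x)=\min\{k\in\mathbb Z: x^{-1}\Delta^k\in A^+\}$. An element $y\in A$ is absorbable if $\inf(y)=0$ or $\sup(y)=0$, and there exists $x\in A$ such that $\inf(xy)=\inf(x)$ and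 $\sup(xy)=\sup(x)$. Define (for rank at least 3): - $X_P^A$: the union of all proper irreducible standard parabolic subgroups of $A$ and of $\langle\Delta^2\rangle$; - $X_{NP}^A$: the union of the normalizers in $A$ of all proper irreducible standard parabolic subgroups of $A$; - $X_{abs}^A$: the set of absorbable elements of $A$. All three sets generate $A$. For a generating set $X$ of a group $G$, $d_X$ is the word metric. For generating sets $X,Y$ of $G$, write $X\preccurlyeq Y$ if the identity map $(G,d_Y)\to(G,d_X)$ is Lipschitz, equivalently $\sup_{y\in Y}d_X(1_G,y)<\infty$. *)

theory Defs
  imports
    "HOL-Library.Extended_Nat"
    "HOL-Algebra.Generated_Groups"
    "HOL-Algebra.Group_Action"
    "HOL-Algebra.Divisibility"
begin

section \<open>Groups given by generators and relations\<close>

text \<open>A word over \<open>S\<close> is a list of letters; \<open>(s, True)\<close> stands for \<open>s\<close> and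
  \<open>(s, False)\<close> for the formal inverse of \<open>s\<close>.\<close>

type_synonym 's word = "('s \<times> bool) list"

abbreviation words :: "'s set \<Rightarrow> 's word set" where
  "words S \<equiv> lists (S \<times> UNIV)"

inductive_set pres_cong :: "'s set \<Rightarrow> ('s word \<times> 's word) set \<Rightarrow> ('s word \<times> 's word) set"
  for S :: "'s set" and R :: "('s word \<times> 's word) set" where
  refl: "w \<in> words S \<Longrightarrow> (w, w) \<in> pres_cong S R"
| sym: "(v, w) \<in> pres_cong S R \<Longrightarrow> (w, v) \<in> pres_cong S R"
| trans: "(u, v) \<in> pres_cong S R \<Longrightarrow> (v, w) \<in> pres_cong S R \<Longrightarrow> (u, w) \<in> pres_cong S R"
| cancel: "p \<in> words S \<Longrightarrow> q \<in> words S \<Longrightarrow> s \<in> S \<Longrightarrow>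
    (p @ [(s, b), (s, \<not> b)] @ q, p @ q) \<in> pres_cong S R"
| rel: "p \<in> words S \<Longrightarrow> q \<in> words S \<Longrightarrow> u \<in> words S \<Longrightarrow> v \<in> words S \<Longrightarrow> (u, v) \<in> R \<Longrightarrow>
    (p @ u @ q, p @ v @ q) \<in> pres_cong S R"

definition presented_group :: "'s set \<Rightarrow> ('s word \<times> 's word) set \<Rightarrow> 's word set monoid" where
  "presented_group S R =
     \<lparr> carrier = words S // pres_cong S R,
       monoid.mult = (\<lambda>X Y. \<Union>x\<in>X. \<Union>y\<in>Y. pres_cong S R `` {x @ y}),
       one = pres_cong S R `` {[]} \<rparr>"

lemma pres_cong_words:
  assumes "(u, v) \<in> pres_cong S R"
  shows "u \<in> words S \<and> v \<in> words S"
  using assms by induction auto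

lemma equiv_pres_cong: "equiv (words S) (pres_cong S R)"
proof (rule equivI)
  show "pres_cong S R \<subseteq> words S \<times> words S" using pres_cong_words by fast
  show "refl_on (words S) (pres_cong S R)" by (auto simp: refl_on_def intro: pres_cong.refl)
  show "sym (pres_cong S R)" by (auto simp: sym_def intro: pres_cong.sym)
  show "trans (pres_cong S R)" by (auto simp: trans_def intro: pres_cong.trans)
qed

lemma pres_cong_ctxt:
  assumes "(u, v) \<in> pres_cong S R" "p \<in> words S" "q \<in> words S"
  shows "(p @ u @ q, p @ v @ q) \<in> pres_cong S R"
  using assms
proof induction
  case (refl w)
  then show ?case by (intro pres_cong.refl) auto
next
  case (cancel p' q' s b)
  then have "((p @ p') @ [(s, b), (s, \<not> b)] @ (q' @ q), (p @ p') @ (q' @ q)) \<in> pres_cong S R"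
    by (intro pres_cong.cancel) auto
  then show ?case by simp
next
  case (rel p' q' u v)
  then have "((p @ p') @ u @ (q' @ q), (p @ p') @ v @ (q' @ q)) \<in> pres_cong S R"
    by (intro pres_cong.rel) auto
  then show ?case by simp
next
  case (sym v w)
  then show ?case by (simp add: pres_cong.sym)
next
  case (trans u v w)
  show ?case
    by (rule pres_cong.trans[OF trans.IH(1)[OF trans.prems] trans.IH(2)[OF trans.prems]])
qed

lemma pres_cong_append:
  assumes "(u, u') \<in> pres_cong S R" "(v, v') \<in> pres_cong S R"
  shows "(u @ v, u' @ v') \<in> pres_cong S R"
proof -
  have 1: "([] @ u @ v, [] @ u' @ v) \<in> pres_cong S R"
    by (intro pres_cong_ctxt assms) (simp_all add: pres_cong_words[OF assms(2), THEN conjunct1])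
  have 2: "(u' @ v @ [], u' @ v' @ []) \<in> pres_cong S R"
    by (intro pres_cong_ctxt assms) (simp_all add: pres_cong_words[OF assms(1), THEN conjunct2])
  from pres_cong.trans[OF 1[simplified] 2[simplified]] show ?thesis .
qed

lemma presented_group_mult:
  assumes "u \<in> words S" "v \<in> words S"
  shows "pres_cong S R `` {u} \<otimes>\<^bsub>presented_group S R\<^esub> pres_cong S R `` {v}
           = pres_cong S R `` {u @ v}"
proof -
  have "congruent2 (pres_cong S R) (pres_cong S R) (\<lambda>x y. pres_cong S R `` {x @ y})"
    by (rule congruent2I') (rule equiv_class_eq[OF equiv_pres_cong], rule pres_cong_append)
  from UN_equiv_class2[OF equiv_pres_cong equiv_pres_cong this assms] show ?thesis
    by (simp add: presented_group_def)
qed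

lemma words_inverse:
  assumes "w \<in> words S"
  shows "map (\<lambda>(s, b). (s, \<not> b)) (rev w) \<in> words S"
  using assms by (induction w) (auto split: prod.splits)

lemma pres_cong_inverse:
  assumes "w \<in> words S"
  shows "(map (\<lambda>(s, b). (s, \<not> b)) (rev w) @ w, []) \<in> pres_cong S R"
  using assms
proof (induction w)
  case Nil
  show ?case by (simp add: pres_cong.refl)
next
  case (Cons x w)
  obtain s b where x: "x = (s, b)" by fastforce
  let ?i = "map (\<lambda>(s, b). (s, \<not> b)) (rev w)"
  have "w \<in> words S" "s \<in> S" using Cons.hyps x by auto
  then have 1: "(?i @ [(s, \<not> b), (s, \<not> \<not> b)] @ w, ?i @ w) \<in> pres_cong S R"
    by (intro pres_cong.cancel words_inverse)
  have 2: "(?i @ w, []) \<in> pres_cong S R" by (rule Cons.IH)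
  from pres_cong.trans[OF 1 2] show ?case by (simp add: x)
qed

lemma group_presented_group: "group (presented_group S R)"
proof -
  let ?G = "presented_group S R"
  let ?c = "\<lambda>w. pres_cong S R `` {w}"
  let ?i = "\<lambda>w. map (\<lambda>(s, b). (s, \<not> b)) (rev w)"
  have carr: "carrier ?G = ?c ` words S"
    by (auto simp: presented_group_def quotient_def)
  have one: "\<one>\<^bsub>?G\<^esub> = ?c []" by (simp add: presented_group_def)
  have inverse: "?c (?i w) \<otimes>\<^bsub>?G\<^esub> ?c w = ?c []" if "w \<in> words S" for w
    unfolding presented_group_mult[OF words_inverse[OF that] that]
    by (rule equiv_class_eq[OF equiv_pres_cong pres_cong_inverse[OF that]])
  have mult_in: "?c v \<otimes>\<^bsub>?G\<^esub> ?c w \<in> ?c ` words S" if "v \<in> words S" "w \<in> words S" for v w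
    unfolding presented_group_mult[OF that] using that by (intro imageI) simp
  have inverse_ex: "\<exists>y\<in>?c ` words S. y \<otimes>\<^bsub>?G\<^esub> ?c w = ?c []" if "w \<in> words S" for w
    by (rule bexI, rule inverse[OF that], rule imageI[OF words_inverse[OF that]])
  show ?thesis
  proof (rule groupI, unfold carr one, goal_cases)
    case (1 x y)
    then show ?case by (elim imageE) (simp only: mult_in)
  next
    case 2
    show ?case by (rule imageI) simp
  next
    case (3 x y z)
    then show ?case by (elim imageE) (simp add: presented_group_mult)
  next
    case (4 x)
    then show ?case by (elim imageE) (simp add: presented_group_mult)
  next
    case (5 x)
    then show ?case by (elim imageE) (simp only: inverse_ex)
  qed
qed

section \<open>Artin-Tits groups and Coxeter groups\<close>

definition coxeter_matrix :: "'s set \<Rightarrow> ('s \<Rightarrow> 's \<Rightarrow> enat) \<Rightarrow> bool" where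
  "coxeter_matrix S m \<longleftrightarrow>
     (\<forall>s\<in>S. \<forall>t\<in>S. m s t = m t s) \<and> (\<forall>s\<in>S. m s s = 1) \<and>
     (\<forall>s\<in>S. \<forall>t\<in>S. s \<noteq> t \<longrightarrow> 2 \<le> m s t)"

fun alt_word :: "'s \<Rightarrow> 's \<Rightarrow> nat \<Rightarrow> 's word" where
  "alt_word a b 0 = []"
| "alt_word a b (Suc n) = (a, True) # alt_word b a n"

definition braid_relations :: "'s set \<Rightarrow> ('s \<Rightarrow> 's \<Rightarrow> enat) \<Rightarrow> ('s word \<times> 's word) set" where
  "braid_relations S m =
     {(alt_word s t n, alt_word t s n) | s t n. s \<in> S \<and> t \<in> S \<and> s \<noteq> t \<and> m s t = enat n}"

definition square_relations :: "'s set \<Rightarrow> ('s word \<times> 's word) set" where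
  "square_relations S = {([(s, True), (s, True)], []) | s. s \<in> S}"

definition artin_group :: "'s set \<Rightarrow> ('s \<Rightarrow> 's \<Rightarrow> enat) \<Rightarrow> 's word set monoid" where
  "artin_group S m = presented_group S (braid_relations S m)"

definition coxeter_group :: "'s set \<Rightarrow> ('s \<Rightarrow> 's \<Rightarrow> enat) \<Rightarrow> 's word set monoid" where
  "coxeter_group S m = presented_group S (braid_relations S m \<union> square_relations S)"

definition spherical_type :: "'s set \<Rightarrow> ('s \<Rightarrow> 's \<Rightarrow> enat) \<Rightarrow> bool" where
  "spherical_type S m \<longleftrightarrow> finite (carrier (coxeter_group S m))"

text \<open>The edges of the subgraph of the Coxeter graph induced by \<open>T\<close>.\<close>

definition coxeter_edges :: "('s \<Rightarrow> 's \<Rightarrow> enat) \<Rightarrow> 's set \<Rightarrow> ('s \<times> 's) set" where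
  "coxeter_edges m T = {(s, t). s \<in> T \<and> t \<in> T \<and> s \<noteq> t \<and> 3 \<le> m s t}"

definition irreducible_type :: "'s set \<Rightarrow> ('s \<Rightarrow> 's \<Rightarrow> enat) \<Rightarrow> bool" where
  "irreducible_type T m \<longleftrightarrow> T \<noteq> {} \<and> (\<forall>s\<in>T. \<forall>t\<in>T. (s, t) \<in> (coxeter_edges m T)\<^sup>*)"

definition artin_gen :: "'s set \<Rightarrow> ('s \<Rightarrow> 's \<Rightarrow> enat) \<Rightarrow> 's \<Rightarrow> 's word set" where
  "artin_gen S m s = pres_cong S (braid_relations S m) `` {[(s, True)]}"

definition std_parabolic :: "'s set \<Rightarrow> ('s \<Rightarrow> 's \<Rightarrow> enat) \<Rightarrow> 's set \<Rightarrow> 's word set set" where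
  "std_parabolic S m T = generate (artin_group S m) (artin_gen S m ` T)"

definition proper_irred_parabolics :: "'s set \<Rightarrow> ('s \<Rightarrow> 's \<Rightarrow> enat) \<Rightarrow> 's word set set set" where
  "proper_irred_parabolics S m = {std_parabolic S m T | T. T \<subset> S \<and> irreducible_type T m}"

section \<open>Garside structure\<close>

inductive_set artin_pos :: "'s set \<Rightarrow> ('s \<Rightarrow> 's \<Rightarrow> enat) \<Rightarrow> 's word set set"
  for S :: "'s set" and m :: "'s \<Rightarrow> 's \<Rightarrow> enat" where
  one: "\<one>\<^bsub>artin_group S m\<^esub> \<in> artin_pos S m"
| gen: "s \<in> S \<Longrightarrow> artin_gen S m s \<in> artin_pos S m"
| mult: "x \<in> artin_pos S m \<Longrightarrow> y \<in> artin_pos S m \<Longrightarrow> x \<otimes>\<^bsub>artin_group S m\<^esub> y \<in> artin_pos S m"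

definition artin_monoid :: "'s set \<Rightarrow> ('s \<Rightarrow> 's \<Rightarrow> enat) \<Rightarrow> 's word set monoid" where
  "artin_monoid S m = artin_group S m \<lparr> carrier := artin_pos S m \<rparr>"

text \<open>In the non-commutative monoid \<open>artin_monoid S m\<close>, the relation \<open>divides\<close> is divisibility
  on the left: \<open>a\<close> divides \<open>b\<close> iff \<open>b = a c\<close> for some \<open>c\<close>. The monoid has no nontrivial
  invertible element, so a least common multiple is unique when it exists.\<close>

definition garside :: "'s set \<Rightarrow> ('s \<Rightarrow> 's \<Rightarrow> enat) \<Rightarrow> 's word set" where
  "garside S m =
     (THE d. d \<in> artin_pos S m \<and>
        (\<forall>s\<in>S. artin_gen S m s divides\<^bsub>artin_monoid S m\<^esub> d) \<and>
        (\<forall>e\<in>artin_pos S m. (\<forall>s\<in>S. artin_gen S m s divides\<^bsub>artin_monoid S m\<^esub> e) \<longrightarrow>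
           d divides\<^bsub>artin_monoid S m\<^esub> e))"

definition artin_inf :: "'s set \<Rightarrow> ('s \<Rightarrow> 's \<Rightarrow> enat) \<Rightarrow> 's word set \<Rightarrow> int" where
  "artin_inf S m x =
     (GREATEST k::int.
        garside S m [^]\<^bsub>artin_group S m\<^esub> (- k) \<otimes>\<^bsub>artin_group S m\<^esub> x \<in> artin_pos S m)"

definition artin_sup :: "'s set \<Rightarrow> ('s \<Rightarrow> 's \<Rightarrow> enat) \<Rightarrow> 's word set \<Rightarrow> int" where
  "artin_sup S m x =
     (LEAST k::int.
        inv\<^bsub>artin_group S m\<^esub> x \<otimes>\<^bsub>artin_group S m\<^esub> garside S m [^]\<^bsub>artin_group S m\<^esub> k
          \<in> artin_pos S m)"

definition absorbable :: "'s set \<Rightarrow> ('s \<Rightarrow> 's \<Rightarrow> enat) \<Rightarrow> 's word set \<Rightarrow> bool" where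
  "absorbable S m y \<longleftrightarrow>
     y \<in> carrier (artin_group S m) \<and> (artin_inf S m y = 0 \<or> artin_sup S m y = 0) \<and>
     (\<exists>x\<in>carrier (artin_group S m).
        artin_inf S m (x \<otimes>\<^bsub>artin_group S m\<^esub> y) = artin_inf S m x \<and>
        artin_sup S m (x \<otimes>\<^bsub>artin_group S m\<^esub> y) = artin_sup S m x)"

section \<open>The three generating sets\<close>

definition X_P :: "'s set \<Rightarrow> ('s \<Rightarrow> 's \<Rightarrow> enat) \<Rightarrow> 's word set set" where
  "X_P S m = \<Union> (proper_irred_parabolics S m) \<union>
     generate (artin_group S m) {garside S m [^]\<^bsub>artin_group S m\<^esub> (2::nat)}"

definition X_NP :: "'s set \<Rightarrow> ('s \<Rightarrow> 's \<Rightarrow> enat) \<Rightarrow> 's word set set" where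
  "X_NP S m = (\<Union>P\<in>proper_irred_parabolics S m. normalizer (artin_group S m) P)"

definition X_abs :: "'s set \<Rightarrow> ('s \<Rightarrow> 's \<Rightarrow> enat) \<Rightarrow> 's word set set" where
  "X_abs S m = {y. absorbable S m y}"

section \<open>Word metrics\<close>

text \<open>The word metric takes the value \<open>\<infinity>\<close> at \<open>(g, h)\<close> exactly if \<open>g\<inverse> h\<close> is not in the
  subgroup generated by \<open>X\<close>; it is finite when \<open>X\<close> generates \<open>G\<close>.\<close>

definition word_dist :: "('a, 'b) monoid_scheme \<Rightarrow> 'a set \<Rightarrow> 'a \<Rightarrow> 'a \<Rightarrow> enat" where
  "word_dist G X g h =
     Inf {enat (length ws) | ws. set ws \<subseteq> X \<union> m_inv G ` X \<and>
            foldr (\<otimes>\<^bsub>G\<^esub>) ws \<one>\<^bsub>G\<^esub> = inv\<^bsub>G\<^esub> g \<otimes>\<^bsub>G\<^esub> h}"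

text \<open>\<open>gen_preceq G X Y\<close>: the identity map from \<open>G\<close> with the metric of \<open>Y\<close> to \<open>G\<close> with the
  metric of \<open>X\<close> is Lipschitz. The metrics being integer-valued, the Lipschitz constant may be
  taken in \<open>nat\<close>.\<close>

definition gen_preceq :: "('a, 'b) monoid_scheme \<Rightarrow> 'a set \<Rightarrow> 'a set \<Rightarrow> bool" where
  "gen_preceq G X Y \<longleftrightarrow>
     (\<exists>C::nat. \<forall>g\<in>carrier G. \<forall>h\<in>carrier G. word_dist G X g h \<le> enat C * word_dist G Y g h)"

end

theory Submission
  imports Defs
begin

text \<open>
  The finite Coxeter group is studied through its geometric representation, which gives the
  exchange condition and the exact orders of the products \<open>s t\<close>. Normal forms over its simple
  elements show that the positive braid monoid is cancellative and embeds in the Artin-Tits group,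
  and that \<open>sup\<close> of a positive element is the length of its normal form.

  A positive \<open>y\<close> is absorbable as soon as some positive \<open>x\<close> satisfies \<open>sup (x y) = sup x\<close> and
  \<open>inf (x y) = 0\<close>. If \<open>y\<close> lies in a proper parabolic submonoid and is not divisible by \<open>\<Delta>\<^sub>T\<close>, take
  \<open>x = \<Delta>\<^sub>T\<^sup>n y\<inverse>\<close>. The powers of \<open>\<Delta>\<^sub>T\<close> (rank of \<open>T\<close> at least 2) split as \<open>\<Delta>\<^sub>T\<^sup>n = s\<^sup>n z\<close>, and
  \<open>\<Delta>\<^sub>T\<^sup>-\<^sup>n \<Delta>\<^sup>n\<close> is absorbed by \<open>s\<^sup>n\<close>, so that the powers of \<open>\<Delta>\<close> have bounded norm as well.
  An element of the normalizer of \<open>A\<^sub>T\<close> is, up to an even power of \<open>\<Delta>\<close> and a left factor in \<open>A\<^sub>T\<close>, a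
  positive \<open>g\<close> with \<open>t' g = g t\<close> for letters \<open>t, t' \<in> T\<close>; a power of \<open>t'\<close> and a power of \<open>\<Delta>\<close>
  reduce such a \<open>g\<close> to an element absorbed by a power of a letter.

  For the second comparison, the parabolic subgroups lie in their normalizers and \<open>\<Delta>\<^sup>2\<close> is central.
\<close>

section \<open>Groups generated by involutions\<close>

text \<open>The obstacle is uniformity: the exponents of \<open>\<Delta>\<close> and the lengths of
  ribbons are unbounded, so an element has to be absorbed in one stroke and not letter by letter.
  Powers of a letter are good absorbers because equal letters never merge: \<open>s\<^sup>n\<close>
  has canonical length exactly \<open>n\<close>, although its support is a single letter. Rank at
  least 3 enters because two letters then span a proper parabolic subgroup, whose Garside element,
  unlike any power of \<open>s\<close>, involves the second letter; this keeps
  \<open>\<Delta>\<close> from dividing the products in question. Counting absorbable factors gives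
  2 for powers of a proper \<open>\<Delta>\<^sub>T\<close>, 3 for powers of \<open>\<Delta>\<close>
  and for positive elements of a proper parabolic, 6 for ribbons and 12 for normalizers. All
  arguments take place on words modulo the braid relations. No group of fractions is constructed; to
  see that no positive words are identified in the group, signed words act on formal
  fractions.\<close>

class group_mult = monoid_mult + inverse +
  assumes group_left_inverse [simp]: "inverse a * a = 1"
begin

lemma group_left_cancel [simp]: "inverse a * (a * b) = b"
  by (simp flip: mult_assoc)

lemma group_right_inverse [simp]: "a * inverse a = 1"
proof -
  have "inverse (inverse a) * (inverse a * (a * inverse a)) = 1"
    by (subst group_left_cancel) (rule group_left_inverse)
  then show ?thesis by (subst (asm) group_left_cancel)
qed

lemma group_right_cancel [simp]: "a * (inverse a * b) = b"
  by (simp flip: mult_assoc)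

lemma group_inverse_unique: "a * b = 1 \<Longrightarrow> inverse a = b"
  by (metis group_left_cancel mult_1_right)

lemma group_inverse_inverse [simp]: "inverse (inverse a) = a"
  by (rule group_inverse_unique) simp

lemma group_inverse_mult [simp]: "inverse (a * b) = inverse b * inverse a"
  by (rule group_inverse_unique) (simp add: mult_assoc)

lemma group_inverse_one [simp]: "inverse 1 = 1"
  by (rule group_inverse_unique) simp

lemma group_mult_left_cancel [simp]: "a * b = a * c \<longleftrightarrow> b = c"
  by (metis group_left_cancel)

lemma group_mult_right_cancel [simp]: "b * a = c * a \<longleftrightarrow> b = c"
  by (metis mult_assoc group_right_inverse mult_1_right)

end

section \<open>Alternating words\<close>

fun alt :: "'a \<Rightarrow> 'a \<Rightarrow> nat \<Rightarrow> 'a list" where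
  "alt a b 0 = []"
| "alt a b (Suc n) = a # alt b a n"

lemma length_alt [simp]: "length (alt a b n) = n"
  by (induction n arbitrary: a b) auto

lemma alt_Suc_right: "alt a b (Suc n) = alt a b n @ [if even n then a else b]"
  by (induction n arbitrary: a b) auto

lemma rev_alt: "rev (alt a b n) = (if even n then alt b a n else alt a b n)"
proof (induction n arbitrary: a b)
  case (Suc n)
  have "rev (alt a b (Suc n)) = rev (alt b a n) @ [a]" by simp
  also have "\<dots> = (if even (Suc n) then alt b a (Suc n) else alt a b (Suc n))"
    by (simp only: Suc.IH alt_Suc_right) auto
  finally show ?case .
qed simp

lemma set_alt: "set (alt a b n) \<subseteq> {a, b}"
  by (induction n arbitrary: a b) auto

lemma set_alt_ge2: "2 \<le> n \<Longrightarrow> set (alt a b n) = {a, b}"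
proof -
  assume "2 \<le> n"
  then obtain k where "n = Suc (Suc k)" by (auto simp: numeral_2_eq_2 Suc_le_eq dest!: less_imp_Suc_add)
  then show ?thesis using set_alt[of a b k] by auto
qed

lemma alt_in_lists: "a \<in> S \<Longrightarrow> b \<in> S \<Longrightarrow> alt a b n \<in> lists S"
  using set_alt[of a b n] by auto

lemma alt_unique:
  assumes "xs \<in> lists {a, b}" "distinct_adj xs" "xs \<noteq> []" "hd xs = a"
  shows "xs = alt a b (length xs)"
  using assms
proof (induction xs arbitrary: a b rule: list.induct)
  case (Cons x xs)
  show ?case
  proof (cases xs)
    case xs: (Cons y ys)
    have "y = b" using Cons.prems xs by auto
    then have "xs = alt b a (length xs)"
      using Cons.prems xs by (intro Cons.IH) (auto simp: insert_commute)
    then show ?thesis using Cons.prems by simp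
  qed (use Cons in simp)
qed simp

lemma map_alt: "map f (alt a b n) = alt (f a) (f b) n"
  by (induction n arbitrary: a b) auto

text \<open>\<open>r\<close> need not be injective and \<open>W\<close> need not be the whole type:
  words over \<open>S\<close> are evaluated in an ambient group, and \<open>len\<close> refers to
  words over \<open>S\<close> only.\<close>

locale involution_group =
  fixes S :: "'s set" and r :: "'s \<Rightarrow> 'w::group_mult"
  assumes r_sq: "s \<in> S \<Longrightarrow> r s * r s = 1"
begin

lemma r_inverse [simp]: "s \<in> S \<Longrightarrow> inverse (r s) = r s"
  by (rule group_inverse_unique) (rule r_sq)

lemma r_r [simp]: "s \<in> S \<Longrightarrow> r s * (r s * x) = x"
  using r_sq[of s] by (simp flip: mult.assoc)

definition ev :: "'s list \<Rightarrow> 'w" where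
  "ev u = prod_list (map r u)"

lemma ev_simps [simp]: "ev [] = 1" "ev (s # u) = r s * ev u" "ev (u @ v) = ev u * ev v"
  by (simp_all add: ev_def)

lemma ev_rev: "u \<in> lists S \<Longrightarrow> ev (rev u) = inverse (ev u)"
  by (induction u) auto

definition W :: "'w set" where
  "W = ev ` lists S"

definition len :: "'w \<Rightarrow> nat" where
  "len w = (LEAST n. \<exists>u\<in>lists S. ev u = w \<and> length u = n)"

lemma rev_in_lists: "u \<in> lists A \<Longrightarrow> rev u \<in> lists A"
  by auto

lemma ev_in_W [simp, intro]: "u \<in> lists S \<Longrightarrow> ev u \<in> W"
  by (auto simp: W_def)

lemma r_in_W [simp, intro]: "s \<in> S \<Longrightarrow> r s \<in> W"
  using ev_in_W[of "[s]"] by simp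

lemma one_in_W [simp, intro]: "1 \<in> W"
  using ev_in_W[of "[]"] by simp

lemma mult_in_W [simp, intro]: "x \<in> W \<Longrightarrow> y \<in> W \<Longrightarrow> x * y \<in> W"
proof -
  assume "x \<in> W" "y \<in> W"
  then obtain u v where "u \<in> lists S" "v \<in> lists S" "x = ev u" "y = ev v" by (auto simp: W_def)
  then show "x * y \<in> W" using ev_in_W[of "u @ v"] by simp
qed

lemma inverse_in_W [simp, intro]: "x \<in> W \<Longrightarrow> inverse x \<in> W"
proof -
  assume "x \<in> W"
  then obtain u where "u \<in> lists S" "x = ev u" by (auto simp: W_def)
  then show "inverse x \<in> W" using ev_in_W[OF rev_in_lists[of u S]] by (simp add: ev_rev)
qed

lemma reduced_word:
  assumes "w \<in> W"
  obtains u where "u \<in> lists S" "ev u = w" "length u = len w"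
proof -
  have "\<exists>n. \<exists>u\<in>lists S. ev u = w \<and> length u = n" using assms by (auto simp: W_def)
  then have "\<exists>u\<in>lists S. ev u = w \<and> length u = len w"
    unfolding len_def by (rule LeastI_ex)
  then show thesis using that by blast
qed

lemma len_ev_le: "u \<in> lists S \<Longrightarrow> len (ev u) \<le> length u"
  unfolding len_def by (rule Least_le) blast

lemma len_mult_le: "x \<in> W \<Longrightarrow> y \<in> W \<Longrightarrow> len (x * y) \<le> len x + len y"
proof -
  assume "x \<in> W" "y \<in> W"
  obtain u where u: "u \<in> lists S" "ev u = x" "length u = len x" using reduced_word[OF \<open>x \<in> W\<close>] .
  obtain v where v: "v \<in> lists S" "ev v = y" "length v = len y" using reduced_word[OF \<open>y \<in> W\<close>] .
  show ?thesis using len_ev_le[of "u @ v"] u v by simp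
qed

lemma len_one [simp]: "len 1 = 0"
  using len_ev_le[of "[]"] by simp

lemma len_eq_0: "w \<in> W \<Longrightarrow> len w = 0 \<longleftrightarrow> w = 1"
proof
  assume "w \<in> W" "len w = 0"
  then show "w = 1" using reduced_word[of w] by force
qed simp

lemma len_inverse [simp]:
  assumes "w \<in> W" shows "len (inverse w) = len w"
proof -
  have "len (inverse x) \<le> len x" if x: "x \<in> W" for x
  proof -
    obtain u where "u \<in> lists S" "ev u = x" "length u = len x" using reduced_word[OF x] by blast
    then show ?thesis using len_ev_le[of "rev u"] ev_rev[of u] by (simp add: in_lists_conv_set)
  qed
  from this[of w] this[of "inverse w"] assms show ?thesis by auto
qed

lemma len_r_le: "s \<in> S \<Longrightarrow> len (r s) \<le> 1"
  using len_ev_le[of "[s]"] by simp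

lemma len_mult_r_le: "w \<in> W \<Longrightarrow> s \<in> S \<Longrightarrow> len (w * r s) \<le> Suc (len w)"
  using len_mult_le[of w "r s"] len_r_le[of s] by simp

lemma len_mult_r_ge: "w \<in> W \<Longrightarrow> s \<in> S \<Longrightarrow> len w \<le> Suc (len (w * r s))"
  using len_mult_r_le[of "w * r s" s] by (simp add: mult.assoc r_sq)

lemma len_r_mult_le: "w \<in> W \<Longrightarrow> s \<in> S \<Longrightarrow> len (r s * w) \<le> Suc (len w)"
  using len_mult_le[of "r s" w] len_r_le[of s] by simp

lemma reduced_appendD:
  assumes "u @ v \<in> lists S" "len (ev (u @ v)) = length (u @ v)"
  shows "len (ev u) = length u" "len (ev v) = length v"
proof -
  have uv: "u \<in> lists S" "v \<in> lists S" using assms by auto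
  then have "len (ev u * ev v) \<le> len (ev u) + len (ev v)" by (intro len_mult_le ev_in_W)
  with len_ev_le[OF uv(1)] len_ev_le[OF uv(2)] assms(2)
  show "len (ev u) = length u" "len (ev v) = length v" by simp_all
qed

end

section \<open>The geometric representation\<close>

text \<open>The class \<open>group_mult\<close> asks for a type, so the representation takes values
  in all permutations of the vector space; linearity is carried separately by
  \<open>lin\<close>.\<close>

typedef 'v sym = "{f :: 'v \<Rightarrow> 'v. bij f}"
  morphisms sapply Sym
  by (auto intro: bij_id)

setup_lifting type_definition_sym

instantiation sym :: (type) group_mult
begin

lift_definition one_sym :: "'a sym" is id by simp
lift_definition times_sym :: "'a sym \<Rightarrow> 'a sym \<Rightarrow> 'a sym" is "(\<circ>)" by (rule bij_comp)
lift_definition inverse_sym :: "'a sym \<Rightarrow> 'a sym" is "inv_into UNIV" by (rule bij_imp_bij_inv)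
definition divide_sym :: "'a sym \<Rightarrow> 'a sym \<Rightarrow> 'a sym" where "divide_sym x y = x * inverse y"

instance
  by standard (transfer; auto simp: fun_eq_iff bij_is_inj)+

end

lemma sapply_one [simp]: "sapply 1 = id"
  by transfer simp

lemma sapply_mult [simp]: "sapply (x * y) v = sapply x (sapply y v)"
  by transfer simp

lemma sym_eqI: "(\<And>v. sapply x v = sapply y v) \<Longrightarrow> x = y"
  by (simp add: sapply_inject[symmetric] fun_eq_iff)

locale coxeter_geometry =
  fixes S :: "'s set" and m :: "'s \<Rightarrow> 's \<Rightarrow> nat"
  assumes finite_S: "finite S"
    and m_sym: "s \<in> S \<Longrightarrow> t \<in> S \<Longrightarrow> m s t = m t s"
    and m_diag: "s \<in> S \<Longrightarrow> m s s = 1"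
    and m_ge2: "s \<in> S \<Longrightarrow> t \<in> S \<Longrightarrow> s \<noteq> t \<Longrightarrow> 2 \<le> m s t"
begin

definition c :: "'s \<Rightarrow> 's \<Rightarrow> real" where
  "c s t = - cos (pi / real (m s t))"

definition E :: "'s \<Rightarrow> 's \<Rightarrow> real" where
  "E s = (\<lambda>x. if x = s then 1 else 0)"

text \<open>The Tits form paired with the simple root \<open>E s\<close>. Vectors are functions on
  the whole type; coordinates outside \<open>S\<close> do not enter here and are fixed by every
  reflection.\<close>

definition b :: "'s \<Rightarrow> ('s \<Rightarrow> real) \<Rightarrow> real" where
  "b s v = (\<Sum>t\<in>S. c s t * v t)"

definition refl :: "'s \<Rightarrow> ('s \<Rightarrow> real) \<Rightarrow> 's \<Rightarrow> real" where
  "refl s v = (\<lambda>x. v x - 2 * b s v * E s x)"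

definition R :: "'s \<Rightarrow> ('s \<Rightarrow> real) sym" where
  "R s = Sym (refl s)"

definition lin :: "(('s \<Rightarrow> real) \<Rightarrow> 's \<Rightarrow> real) \<Rightarrow> bool" where
  "lin f \<longleftrightarrow> (\<forall>p q v w. f (\<lambda>x. p * v x + q * w x) = (\<lambda>x. p * f v x + q * f w x))"

lemma c_diag [simp]: "s \<in> S \<Longrightarrow> c s s = 1"
  by (simp add: c_def m_diag)

lemma c_sym: "s \<in> S \<Longrightarrow> t \<in> S \<Longrightarrow> c s t = c t s"
  by (simp add: c_def m_sym)

lemma b_lin: "b s (\<lambda>x. p * v x + q * w x) = p * b s v + q * b s w"
  by (simp add: b_def algebra_simps sum.distrib sum_distrib_left)

lemma b_diff: "b s (\<lambda>x. v x - q * w x) = b s v - q * b s w"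
  using b_lin[of s 1 v "- q" w] by simp

lemma b_E [simp]: "t \<in> S \<Longrightarrow> b s (E t) = c s t"
  using finite_S by (simp add: b_def E_def sum.delta if_distrib cong: if_cong)

lemma refl_lin: "lin (refl s)"
  by (simp add: lin_def refl_def b_lin algebra_simps)

lemma linD: "lin f \<Longrightarrow> f (\<lambda>x. p * v x + q * w x) = (\<lambda>x. p * f v x + q * f w x)"
  by (simp add: lin_def)

lemma lin_comp: "lin f \<Longrightarrow> lin g \<Longrightarrow> lin (\<lambda>v. f (g v))"
  by (simp add: lin_def)

lemma refl_refl: "s \<in> S \<Longrightarrow> refl s (refl s v) = v"
  by (simp add: refl_def b_diff)

lemma bij_refl: "s \<in> S \<Longrightarrow> bij (refl s)"
  using refl_refl by (intro o_bij[of "refl s"]) (auto simp: fun_eq_iff)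

lemma sapply_R [simp]: "s \<in> S \<Longrightarrow> sapply (R s) = refl s"
  by (simp add: R_def Sym_inverse bij_refl)

sublocale involution_group S R
proof
  fix s assume "s \<in> S"
  have "sapply (R s * R s) v = sapply 1 v" for v
    using \<open>s \<in> S\<close> by (simp add: refl_refl)
  then show "R s * R s = 1" by (rule sym_eqI)
qed

lemma lin_ev: "u \<in> lists S \<Longrightarrow> lin (sapply (ev u))"
proof (induction u rule: list.induct)
  case (Cons s u)
  then have "lin (\<lambda>v. refl s (sapply (ev u) v))" using lin_comp[OF refl_lin, of "sapply (ev u)" s] by simp
  moreover have "sapply (ev (s # u)) = (\<lambda>v. refl s (sapply (ev u) v))"
    using Cons by (auto simp: fun_eq_iff)
  ultimately show ?case by simp
qed (simp add: lin_def)

lemma lin_W: "w \<in> W \<Longrightarrow> lin (sapply w)"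
  unfolding W_def using lin_ev by blast

lemma sapply_uminus: "w \<in> W \<Longrightarrow> sapply w (\<lambda>x. - v x) = (\<lambda>x. - sapply w v x)"
  using linD[OF lin_W, of w "- 1" v 0 v] by simp

lemma sapply_zero: "w \<in> W \<Longrightarrow> sapply w (\<lambda>x. 0) = (\<lambda>x. 0)"
  using linD[OF lin_W, of w 0 "\<lambda>x. 0" 0 "\<lambda>x. 0"] by simp

subsection \<open>Dihedral subgroups\<close>

text \<open>The Chebyshev quotient sin(j a) / sin a with a = pi / m. These are the coordinates of
  the roots in the plane of \<open>E s\<close> and \<open>E t\<close>; the two reflections produce
  the recurrence \<open>sn_rec\<close>.\<close>

definition sn :: "'s \<Rightarrow> 's \<Rightarrow> nat \<Rightarrow> real" where
  "sn s t j = sin (real j * (pi / real (m s t))) / sin (pi / real (m s t))"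

lemma angle:
  assumes "s \<in> S" "t \<in> S" "s \<noteq> t"
  shows "0 < pi / real (m s t)" "pi / real (m s t) < pi" "0 < sin (pi / real (m s t))"
proof -
  have "2 \<le> real (m s t)" using m_ge2[OF assms] by simp
  then show 1: "0 < pi / real (m s t)" "pi / real (m s t) < pi"
    by (simp_all add: divide_less_eq)
  then show "0 < sin (pi / real (m s t))" by (rule sin_gt_zero)
qed

lemma sn_rec: "sn s t (Suc (Suc j)) = - 2 * c s t * sn s t (Suc j) - sn s t j"
proof -
  have "sin (real (Suc (Suc j)) * a) = 2 * cos a * sin (real (Suc j) * a) - sin (real j * a)" for a
  proof -
    have 1: "real (Suc (Suc j)) * a = real (Suc j) * a + a"
      and 2: "real j * a = real (Suc j) * a - a"
      by (simp_all add: algebra_simps)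
    show ?thesis unfolding 1 2 sin_add sin_diff by (simp add: algebra_simps)
  qed
  from this[of "pi / real (m s t)"] show ?thesis
    unfolding sn_def c_def by (simp only: diff_divide_distrib) simp
qed

lemma sn_values:
  assumes "s \<in> S" "t \<in> S" "s \<noteq> t"
  shows "sn s t 0 = 0" "sn s t 1 = 1" "sn s t (m s t) = 0" "sn s t (Suc (m s t)) = - 1"
    "sn s t (m s t - 1) = 1"
proof -
  let ?a = "pi / real (m s t)"
  have m: "2 \<le> m s t" using m_ge2[OF assms] .
  then have ma: "real (m s t) * ?a = pi" by simp
  show "sn s t 0 = 0" "sn s t 1 = 1" using angle(3)[OF assms] by (simp_all add: sn_def)
  show "sn s t (m s t) = 0" using ma by (simp add: sn_def)
  have "real (Suc (m s t)) * ?a = ?a + pi" using m by (simp add: field_simps)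
  then show "sn s t (Suc (m s t)) = - 1" using angle(3)[OF assms] by (simp add: sn_def)
  have "real (m s t - 1) * ?a = pi - ?a" using m by (simp add: of_nat_diff field_simps)
  then show "sn s t (m s t - 1) = 1" using angle(3)[OF assms] by (simp add: sn_def)
qed

lemma sn_nonneg:
  assumes "s \<in> S" "t \<in> S" "s \<noteq> t" "j \<le> m s t"
  shows "0 \<le> sn s t j"
proof -
  let ?a = "pi / real (m s t)"
  have "real j * ?a \<le> real (m s t) * ?a"
    using angle(1)[OF assms(1-3)] assms(4) by (intro mult_right_mono) auto
  also have "\<dots> = pi" using m_ge2[OF assms(1-3)] by simp
  finally have "0 \<le> sin (real j * ?a)" using angle(1)[OF assms(1-3)] by (intro sin_ge_zero) auto
  then show ?thesis using angle(3)[OF assms(1-3)] by (simp add: sn_def)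
qed

lemma refl_comb:
  assumes "s \<in> S" "t \<in> S"
  shows "refl s (\<lambda>x. p * E s x + q * E t x) = (\<lambda>x. (- 2 * c s t * q - p) * E s x + q * E t x)"
proof -
  have "b s (\<lambda>x. p * E s x + q * E t x) = p + q * c s t"
    using assms by (simp add: b_lin)
  then show ?thesis by (simp add: refl_def fun_eq_iff algebra_simps)
qed

lemma dihedral_root:
  assumes "s \<in> S" "t \<in> S" "s \<noteq> t"
  shows "sapply (ev (rev (alt t s k))) (E s) =
    (if even k then (\<lambda>x. sn s t (Suc k) * E s x + sn s t k * E t x)
     else (\<lambda>x. sn s t k * E s x + sn s t (Suc k) * E t x))"
proof (induction k)
  case 0
  show ?case using sn_values[OF assms] by simp
next
  case (Suc k)
  have "rev (alt t s (Suc k)) = (if even k then t else s) # rev (alt t s k)"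
    by (subst alt_Suc_right) simp
  then have "sapply (ev (rev (alt t s (Suc k)))) (E s) =
      refl (if even k then t else s) (sapply (ev (rev (alt t s k))) (E s))"
    using assms by simp
  also have "\<dots> = (if even (Suc k) then (\<lambda>x. sn s t (Suc (Suc k)) * E s x + sn s t (Suc k) * E t x)
     else (\<lambda>x. sn s t (Suc k) * E s x + sn s t (Suc (Suc k)) * E t x))"
    unfolding Suc.IH
    using refl_comb[OF assms(1,2), of "sn s t k" "sn s t (Suc k)"]
      refl_comb[OF assms(2,1), of "sn s t k" "sn s t (Suc k)"] c_sym[OF assms(1,2)]
    by (simp add: sn_rec add.commute)
  finally show ?case .
qed

lemma fixed_by_dihedral:
  assumes "b s v = 0" "b t v = 0" "u \<in> lists {s, t}" "s \<in> S" "t \<in> S"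
  shows "sapply (ev u) v = v"
  using assms(3)
proof (induction u rule: list.induct)
  case (Cons x u)
  then show ?case using assms by (auto simp: refl_def)
qed simp

text \<open>The word on the right ends in \<open>s\<close>, which negates \<open>E s\<close>. What
  remains has length m - 1 and coefficients 1 and 0; negated, they match the values 0 and -1 of
  \<open>sn\<close> at m and m + 1 on the left.\<close>

lemma dihedral_root_top:
  assumes "s \<in> S" "t \<in> S" "s \<noteq> t"
  shows "sapply (ev (rev (alt t s (m s t)))) (E s) = sapply (ev (rev (alt s t (m s t)))) (E s)"
proof -
  obtain k where k: "m s t = Suc k" using m_ge2[OF assms] by (cases "m s t") auto
  have "rev (alt s t (m s t)) = rev (alt t s k) @ [s]" by (simp add: k)
  then have "sapply (ev (rev (alt s t (m s t)))) (E s) = sapply (ev (rev (alt t s k))) (refl s (E s))"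
    using assms by simp
  also have "refl s (E s) = (\<lambda>x. - E s x)" using assms by (simp add: refl_def)
  also have "sapply (ev (rev (alt t s k))) \<dots> = (\<lambda>x. - sapply (ev (rev (alt t s k))) (E s) x)"
    using assms by (intro sapply_uminus ev_in_W rev_in_lists alt_in_lists)
  also have "\<dots> = sapply (ev (rev (alt t s (m s t)))) (E s)"
    using sn_values[OF assms] by (simp add: dihedral_root[OF assms] k del: alt.simps)
  finally show ?thesis by simp
qed

text \<open>Both sides are linear, fix the vectors orthogonal to both simple roots, and agree on
  \<open>E s\<close> and \<open>E t\<close> by \<open>dihedral_root_top\<close>. The form is
  nondegenerate on the plane of these roots, so every vector splits accordingly.\<close>

lemma braid_relation:
  assumes st: "s \<in> S" "t \<in> S" "s \<noteq> t"
  shows "ev (alt s t (m s t)) = ev (alt t s (m s t))"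
proof -
  let ?k = "m s t"
  have ts: "t \<in> S" "s \<in> S" "t \<noteq> s" using st by auto
  have in_lists: "rev (alt x y ?k) \<in> lists S" if "x \<in> S" "y \<in> S" for x y
    using that by (intro rev_in_lists alt_in_lists)
  have "ev (rev (alt t s ?k)) = ev (rev (alt s t ?k))"
  proof (rule sym_eqI)
    fix v
    \<comment> \<open>The Gram determinant of \<open>E s\<close> and \<open>E t\<close>;
      \<open>p\<close> and \<open>q\<close> below solve the 2 by 2 system that makes
      \<open>v'\<close> orthogonal to both.\<close>
    define d where "d = 1 - c s t * c s t"
    have "d = (sin (pi / real ?k))\<^sup>2" by (simp add: d_def c_def sin_squared_eq flip: power2_eq_square)
    then have d: "d \<noteq> 0" using angle(3)[OF st] by simp
    define p where "p = (b s v - c s t * b t v) / d"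
    define q where "q = (b t v - c s t * b s v) / d"
    define v' where "v' = (\<lambda>x. v x - (p * E s x + q * E t x))"
    have bv': "b x v' = b x v - (p * c x s + q * c x t)" for x
      using b_diff[of x v 1 "\<lambda>x. p * E s x + q * E t x"] st by (simp add: v'_def b_lin)
    have pq: "p + q * c s t = b s v" "p * c s t + q = b t v"
      using d by (simp_all add: p_def q_def field_simps) (simp_all add: d_def algebra_simps)
    have v'0: "b s v' = 0" "b t v' = 0" using pq st c_sym[of t s] by (simp_all add: bv')
    have "v = (\<lambda>x. 1 * v' x + 1 * (p * E s x + q * E t x))" by (simp add: v'_def)
    moreover have "sapply (ev (rev (alt t s ?k))) \<dots> = sapply (ev (rev (alt s t ?k))) \<dots>"
    proof -
      have fix_v': "sapply (ev (rev (alt t s ?k))) v' = v'" "sapply (ev (rev (alt s t ?k))) v' = v'"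
        using st v'0 by (intro fixed_by_dihedral[of s _ t] rev_in_lists alt_in_lists; simp)+
      have "sapply (ev (rev (alt t s ?k))) (E t) = sapply (ev (rev (alt s t ?k))) (E t)"
        using dihedral_root_top[OF ts] m_sym[OF st(1,2)] by simp
      then show ?thesis
        using dihedral_root_top[OF st] st
        by (simp only: linD[OF lin_ev] in_lists fix_v')
    qed
    ultimately show "sapply (ev (rev (alt t s ?k))) v = sapply (ev (rev (alt s t ?k))) v" by simp
  qed
  then show ?thesis by (cases "even (m s t)") (simp_all add: rev_alt)
qed

subsection \<open>Roots\<close>

definition nn :: "('s \<Rightarrow> real) \<Rightarrow> bool" where
  "nn v \<longleftrightarrow> (\<forall>x. 0 \<le> v x)"

lemma nn_E [simp]: "nn (E s)"
  by (simp add: nn_def E_def)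

lemma nn_comb: "nn v \<Longrightarrow> nn w \<Longrightarrow> 0 \<le> p \<Longrightarrow> 0 \<le> q \<Longrightarrow> nn (\<lambda>x. p * v x + q * w x)"
  by (simp add: nn_def)

lemma nn_dihedral:
  assumes "s \<in> S" "t \<in> S" "s \<noteq> t" "k < m s t"
  obtains p q where "0 \<le> p" "0 \<le> q"
    "sapply (ev (rev (alt t s k))) (E s) = (\<lambda>x. p * E s x + q * E t x)"
proof (cases "even k")
  case True
  show ?thesis
    by (rule that[of "sn s t (Suc k)" "sn s t k"])
      (use assms True in \<open>simp_all add: sn_nonneg dihedral_root\<close>)
next
  case False
  show ?thesis
    by (rule that[of "sn s t k" "sn s t (Suc k)"])
      (use assms False in \<open>simp_all add: sn_nonneg dihedral_root\<close>)
qed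

text \<open>Write \<open>w = v * ev a\<close> with \<open>a\<close> a word in \<open>s\<close> and
  the last letter \<open>t\<close> of \<open>w\<close>, as long as possible. Then neither
  \<open>s\<close> nor \<open>t\<close> shortens \<open>v\<close>, so induction makes the images of
  both simple roots under \<open>v\<close> nonnegative, while \<open>a\<close> is alternating of
  length below \<open>m s t\<close> and sends \<open>E s\<close> to a nonnegative combination of the
  two.\<close>

theorem root_nonneg:
  assumes "w \<in> W" "s \<in> S" "len w \<le> len (w * R s)"
  shows "nn (sapply w (E s))"
  using assms
proof (induction "len w" arbitrary: w s rule: less_induct)
  case less
  show ?case
  proof (cases "w = 1")
    case False
    obtain u where u: "u \<in> lists S" "ev u = w" "length u = len w"
      using reduced_word[OF less.prems(1)] .
    have "u \<noteq> []" using u False by auto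
    then obtain u' t where ut: "u = u' @ [t]" by (metis rev_exhaust)
    have t: "t \<in> S" "u' \<in> lists S" using u ut by auto
    have red_u': "len (ev u') = length u'" using reduced_appendD(1)[of u' "[t]"] u ut by simp
    have wt: "w = ev u' * R t" "len w = Suc (len (ev u'))" using u ut red_u' by auto
    have "s \<noteq> t" using wt t less.prems by (auto simp: mult.assoc r_sq)
    define Q where "Q n \<longleftrightarrow> (\<exists>v a. v \<in> W \<and> a \<in> lists {s, t} \<and> w = v * ev a \<and>
      len w = len v + length a \<and> length a = n)" for n
    have Q1: "Q 1"
      unfolding Q_def using wt t by (intro exI[of _ "ev u'"] exI[of _ "[t]"]) auto
    have Qb: "Q n \<Longrightarrow> n \<le> len w" for n by (auto simp: Q_def)
    define n where "n = Greatest Q"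
    have Qn: "Q n" unfolding n_def using GreatestI_nat[of Q, OF Q1 Qb] .
    have nmax: "Q k \<Longrightarrow> k \<le> n" for k unfolding n_def using Greatest_le_nat[of Q, OF _ Qb] .
    have n1: "1 \<le> n" using nmax[OF Q1] .
    obtain v a where va: "v \<in> W" "a \<in> lists {s, t}" "w = v * ev a" "len w = len v + length a"
      "length a = n" using Qn by (auto simp: Q_def)
    have aS: "a \<in> lists S" using va(2) less.prems(2) t(1) by auto
    have up: "len v \<le> len (v * R x)" if x: "x \<in> {s, t}" for x
    proof (rule ccontr)
      \<comment> \<open>A letter shortening \<open>v\<close> could be moved to the front of
        \<open>a\<close>, against the choice of \<open>n\<close>.\<close>
      assume neg: "\<not> ?thesis"
      have xS: "x \<in> S" using x less.prems(2) t(1) by auto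
      have eq: "w = v * R x * ev (x # a)" using xS va by (simp add: mult.assoc)
      have "len w \<le> len (v * R x) + len (ev (x # a))"
        unfolding eq using xS va(1) aS by (intro len_mult_le mult_in_W ev_in_W r_in_W) auto
      also have "len (ev (x # a)) \<le> Suc (length a)" using len_ev_le[of "x # a"] xS aS by simp
      finally have "len w = len (v * R x) + length (x # a)" using neg va(4) by simp
      then have "Q (Suc n)" unfolding Q_def
        using eq va xS x by (intro exI[of _ "v * R x"] exI[of _ "x # a"]) auto
      then show False using nmax by fastforce
    qed
    have "len v < len w" using va n1 by simp
    then have nn_v: "nn (sapply v (E s))" "nn (sapply v (E t))"
      using less.hyps[of v s] less.hyps[of v t] up va(1) less.prems(2) t(1) by auto
    have red_a: "length a \<le> length a'" if "a' \<in> lists S" "ev a' = ev a" for a'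
      using len_mult_le[OF va(1) ev_in_W[OF that(1)]] len_ev_le[OF that(1)] that(2) va(3,4) by simp
    have "distinct_adj a"
    proof (rule ccontr)
      assume "\<not> distinct_adj a"
      then have "\<exists>xs x ys. a = xs @ [x, x] @ ys"
      proof (induction a rule: list.induct)
        case (Cons z zs)
        show ?case
        proof (cases "zs \<noteq> [] \<and> z = hd zs")
          case True
          then have "z # zs = [] @ [z, z] @ tl zs" by (cases zs) auto
          then show ?thesis by blast
        next
          case False
          then have "\<not> distinct_adj zs" using Cons.prems by (auto simp: distinct_adj_Cons)
          from Cons.IH[OF this] obtain xs x ys where "zs = xs @ [x, x] @ ys" by blast
          then have "z # zs = (z # xs) @ [x, x] @ ys" by simp
          then show ?thesis by blast
        qed
      qed simp
      then obtain xs x ys where a: "a = xs @ [x, x] @ ys" by blast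
      then have "ev (xs @ ys) = ev a" using aS by simp
      with red_a[of "xs @ ys"] a aS show False by simp
    qed
    \<comment> \<open>If \<open>a\<close> ended in \<open>s\<close>, then \<open>w * R s\<close>
      would be shorter than \<open>w\<close>.\<close>
    have last_a: "last a = t"
    proof (rule ccontr)
      assume "last a \<noteq> t"
      moreover have "a \<noteq> []" using n1 va(5) by auto
      moreover then have "last a \<in> {s, t}" using va(2) by auto
      ultimately have a: "a = a' @ [s]" if "a' = butlast a" for a'
        using that append_butlast_last_id[of a] by auto
      define a' where "a' = butlast a"
      note a = a[OF a'_def]
      have "w * R s = v * ev a'" using va(3) a less.prems(2) by (simp add: mult.assoc r_sq)
      also have "len \<dots> \<le> len v + len (ev a')" using va(1) aS a by (intro len_mult_le ev_in_W) auto
      also have "len (ev a') \<le> length a'" using aS a by (intro len_ev_le) auto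
      finally show False using less.prems(3) va(4) a by simp
    qed
    have "rev a = alt t s (length (rev a))"
      using va(2,5) n1 \<open>distinct_adj a\<close> last_a
      by (intro alt_unique) (auto simp: hd_rev)
    then have a: "a = rev (alt t s n)" using va(5) by (metis length_rev rev_rev_ident)
    \<comment> \<open>From length \<open>m s t\<close> on, the braid relation would let
      \<open>a\<close> end in \<open>s\<close>, which again makes \<open>w * R s\<close> shorter
      than \<open>w\<close>.\<close>
    have "n < m s t"
    proof (rule ccontr)
      assume "\<not> n < m s t"
      then obtain j where j: "n = m s t + j" by (metis le_add_diff_inverse not_less)
      have "\<exists>z. alt t s n = alt t s (m s t) @ z"
      proof -
        have "\<exists>z. alt x y (k + j) = alt x y k @ z" for x y k
          by (induction k arbitrary: x y) auto
        then show ?thesis by (simp add: j)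
      qed
      then obtain z where z: "alt t s n = alt t s (m s t) @ z" by blast
      have zS: "set z \<subseteq> S" using set_alt[of t s n] z less.prems(2) t(1) by auto
      obtain k where k: "m s t = Suc k" using m_ge2[OF less.prems(2) t(1) \<open>s \<noteq> t\<close>] by (cases "m s t") auto
      have len_z: "length z = j" using arg_cong[OF z, of length] by (simp add: j)
      have "ev (rev (alt t s (m s t))) = ev (rev (alt s t (m s t)))"
        using braid_relation[OF less.prems(2) t(1) \<open>s \<noteq> t\<close>] by (cases "even (m s t)") (simp_all add: rev_alt)
      then have "ev a = ev (rev z) * ev (rev (alt s t (m s t)))" by (simp add: a z)
      also have "\<dots> = ev (rev z @ rev (alt t s k)) * R s" by (simp add: k mult.assoc)
      finally have "w * R s = v * ev (rev z @ rev (alt t s k))"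
        using va(3) less.prems(2) by (simp add: mult.assoc r_sq)
      also have "len \<dots> \<le> len v + len (ev (rev z @ rev (alt t s k)))"
        using va(1) zS less.prems(2) t(1) set_alt[of t s k] by (intro len_mult_le ev_in_W) auto
      also have "len (ev (rev z @ rev (alt t s k))) \<le> length (rev z @ rev (alt t s k))"
        using zS less.prems(2) t(1) set_alt[of t s k] by (intro len_ev_le) auto
      finally show False using less.prems(3) va(4,5) j k len_z by simp
    qed
    from nn_dihedral[OF less.prems(2) t(1) \<open>s \<noteq> t\<close> this, folded a]
    obtain p q where pq: "0 \<le> p" "0 \<le> q" "sapply (ev a) (E s) = (\<lambda>x. p * E s x + q * E t x)" .
    have "sapply w (E s) = (\<lambda>x. p * sapply v (E s) x + q * sapply v (E t) x)"
      using va(3) pq(3) linD[OF lin_W[OF va(1)]] by simp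
    then show ?thesis using nn_comb[OF nn_v pq(1,2)] by simp
  qed simp
qed

text \<open>If \<open>R s\<close> kept the length, \<open>root_nonneg\<close> would apply to both
  \<open>w\<close> and \<open>w * R s\<close> and make a root and its negative nonnegative, so that
  the root would vanish.\<close>

lemma root_sign:
  assumes "w \<in> W" "s \<in> S"
  shows "nn (sapply w (E s)) \<and> len (w * R s) = Suc (len w) \<or>
    \<not> nn (sapply w (E s)) \<and> nn (\<lambda>x. - sapply w (E s) x) \<and> Suc (len (w * R s)) = len w"
proof -
  let ?v = "sapply w (E s)"
  have nonzero: "?v \<noteq> (\<lambda>x. 0)"
  proof
    assume "?v = (\<lambda>x. 0)"
    then have "sapply (inverse w * w) (E s) = (\<lambda>x. 0)"
      unfolding sapply_mult using sapply_zero[of "inverse w"] assms by simp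
    then have "E s s = 0" by simp
    then show False by (simp add: E_def)
  qed
  have "refl s (E s) = (\<lambda>x. - E s x)" using assms by (simp add: refl_def)
  then have neg: "sapply (w * R s) (E s) = (\<lambda>x. - ?v x)"
    using assms by (simp add: sapply_uminus)
  have not_both: "\<not> (nn ?v \<and> nn (\<lambda>x. - ?v x))"
    using nonzero by (auto simp: nn_def fun_eq_iff intro: antisym)
  have ws: "w * R s \<in> W" "w * R s * R s = w" using assms by (auto simp: mult.assoc r_sq)
  have up: "nn ?v" if "len w \<le> len (w * R s)" using root_nonneg[OF assms that] .
  have down: "nn (\<lambda>x. - ?v x)" if "len (w * R s) \<le> len w"
    using root_nonneg[OF ws(1) assms(2)] that ws(2) neg by simp
  show ?thesis
    using up down not_both len_mult_r_le[OF assms] len_mult_r_ge[OF assms] by fastforce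
qed

lemma len_rev_alt:
  assumes "s \<in> S" "t \<in> S" "s \<noteq> t" "k \<le> m s t"
  shows "len (ev (rev (alt s t k))) = k"
  using assms
proof (induction k arbitrary: s t)
  case (Suc k)
  let ?w = "ev (rev (alt t s k))"
  have "len ?w = k" using Suc m_sym[of s t] by auto
  moreover have "?w \<in> W" using Suc.prems by (intro ev_in_W rev_in_lists alt_in_lists)
  moreover have "nn (sapply ?w (E s))"
  proof -
    have "k < m s t" using Suc.prems by simp
    from nn_dihedral[OF Suc.prems(1-3) this] obtain p q where "0 \<le> p" "0 \<le> q"
      "sapply ?w (E s) = (\<lambda>x. p * E s x + q * E t x)" .
    then show ?thesis by (simp add: nn_comb)
  qed
  ultimately show ?case using root_sign[of ?w s] Suc.prems(1) by simp
qed simp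

lemma len_alt:
  assumes "s \<in> S" "t \<in> S" "s \<noteq> t" "k \<le> m s t"
  shows "len (ev (alt s t k)) = k"
  using len_rev_alt[of s t k] len_rev_alt[of t s k] assms m_sym[of s t]
  by (cases "even k") (auto simp: rev_alt)

subsection \<open>The exchange condition\<close>

definition Bf :: "('s \<Rightarrow> real) \<Rightarrow> ('s \<Rightarrow> real) \<Rightarrow> real" where
  "Bf v w = (\<Sum>s\<in>S. v s * b s w)"

lemma Bf_sym: "Bf v w = Bf w v"
proof -
  have "Bf v w = (\<Sum>s\<in>S. \<Sum>t\<in>S. v s * c s t * w t)"
    by (simp add: Bf_def b_def sum_distrib_left mult.assoc)
  also have "\<dots> = (\<Sum>t\<in>S. \<Sum>s\<in>S. v s * c s t * w t)" by (rule sum.swap)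
  also have "\<dots> = Bf w v"
    by (auto simp: Bf_def b_def sum_distrib_left c_sym intro!: sum.cong)
  finally show ?thesis .
qed

lemma Bf_E: "s \<in> S \<Longrightarrow> Bf (E s) w = b s w"
  using finite_S by (simp add: Bf_def E_def if_distrib[of "\<lambda>x. x * _"] cong: if_cong)

lemma Bf_diff: "Bf (\<lambda>x. v x - q * w x) z = Bf v z - q * Bf w z"
  by (simp add: Bf_def algebra_simps sum_subtractf sum_distrib_left)

lemma Bf_refl: "s \<in> S \<Longrightarrow> Bf (refl s v) (refl s w) = Bf v w"
proof -
  assume s: "s \<in> S"
  have "Bf (refl s v) z = Bf v z - 2 * b s v * b s z" for v z
    using s by (simp add: refl_def Bf_diff Bf_E)
  moreover have "Bf v (refl s w) = Bf v w - 2 * b s w * b s v"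
    using calculation[of w v] by (simp add: Bf_sym)
  moreover have "b s (refl s w) = - b s w" using s by (simp add: refl_def b_diff)
  ultimately show ?thesis by simp
qed

lemma Bf_W: "w \<in> W \<Longrightarrow> Bf (sapply w v) (sapply w v') = Bf v v'"
proof -
  have "Bf (sapply (ev u) v) (sapply (ev u) v') = Bf v v'" if "u \<in> lists S" for u
    using that by (induction u rule: list.induct) (auto simp: Bf_refl)
  then show "w \<in> W \<Longrightarrow> ?thesis" by (auto simp: W_def)
qed

text \<open>A reflection is determined by its root, so \<open>w\<close> conjugates the reflection in \<open>E s\<close> to
  the one in \<open>w (E s)\<close>.\<close>

lemma reflection_conj:
  assumes "w \<in> W" "s \<in> S" "x \<in> S" "sapply w (E s) = E x"
  shows "R x * w = w * R s"
proof (rule sym_eqI)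
  fix v
  have "sapply (w * R s) v = sapply w (\<lambda>y. 1 * v y + (- 2 * b s v) * E s y)"
    using assms by (simp add: refl_def)
  also have "\<dots> = (\<lambda>y. sapply w v y - 2 * b s v * E x y)"
    unfolding linD[OF lin_W[OF assms(1)]] assms(4) by simp
  also have "b s v = b x (sapply w v)"
    using Bf_W[OF assms(1), of "E s" v] assms by (simp add: Bf_E)
  finally show "sapply (R x * w) v = sapply (w * R s) v" using assms by (simp add: refl_def)
qed

text \<open>Reading \<open>u\<close> from the right, let \<open>x\<close> be the letter at which the
  nonnegative root \<open>?\<beta>\<close> turns negative. As \<open>refl x\<close> changes the
  coordinate \<open>x\<close> only, \<open>?\<beta>\<close> is a multiple of \<open>E x\<close>;
  invariance of the form gives norm 1, so \<open>?\<beta> = E x\<close>, and by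
  \<open>reflection_conj\<close> the letter \<open>x\<close> is the one to delete.\<close>

lemma right_exchange:
  assumes "u \<in> lists S" "s \<in> S" "\<not> nn (sapply (ev u) (E s))"
  shows "\<exists>u1 x u2. u = u1 @ x # u2 \<and> ev u * R s = ev (u1 @ u2)"
  using assms
proof (induction u rule: list.induct)
  case (Cons x u)
  have u: "u \<in> lists S" "x \<in> S" using Cons.prems by auto
  let ?\<beta> = "sapply (ev u) (E s)"
  show ?case
  proof (cases "nn ?\<beta>")
    case False
    then obtain u1 y u2 where "u = u1 @ y # u2" "ev u * R s = ev (u1 @ u2)"
      using Cons.IH u Cons.prems by blast
    then have "x # u = (x # u1) @ y # u2 \<and> ev (x # u) * R s = ev ((x # u1) @ u2)"
      by (simp add: mult.assoc)
    then show ?thesis by blast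
  next
    case True
    have neg: "nn (\<lambda>y. - refl x ?\<beta> y)"
      using root_sign[of "ev (x # u)" s] Cons.prems ev_in_W[of "x # u"] u by auto
    have "refl x ?\<beta> y = ?\<beta> y" if "y \<noteq> x" for y
      using that by (simp add: refl_def E_def)
    then have "?\<beta> y \<le> 0" if "y \<noteq> x" for y
      using that neg[unfolded nn_def, rule_format, of y] by simp
    then have "?\<beta> y = 0" if "y \<noteq> x" for y using that True by (simp add: nn_def antisym)
    then have "?\<beta> = (\<lambda>y. 0 - (- ?\<beta> x) * E x y)" by (auto simp: E_def)
    then obtain q where q: "?\<beta> = (\<lambda>y. 0 - q * E x y)" by blast
    have "Bf (\<lambda>x. 0) v = 0" "b x (\<lambda>x. 0) = 0" for v by (simp_all add: Bf_def b_def)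
    then have "Bf ?\<beta> v = - q * b x v" "b x ?\<beta> = - q" for v
      unfolding q Bf_diff b_diff Bf_E[OF u(2)] b_E[OF u(2)] using u by simp_all
    moreover have "Bf ?\<beta> ?\<beta> = 1" using Bf_W[of "ev u" "E s" "E s"] u Cons.prems by (simp add: Bf_E)
    moreover have \<beta>x: "?\<beta> x = - q" unfolding q by (simp add: E_def)
    ultimately have "?\<beta> x * ?\<beta> x = 1" by simp
    moreover have "0 \<le> ?\<beta> x" using True by (simp add: nn_def)
    ultimately have "?\<beta> x = 1" using square_eq_1_iff[of "?\<beta> x"] by auto
    then have "?\<beta> = E x" unfolding q using \<beta>x by (auto simp: E_def)
    then have "R x * ev u = ev u * R s" using reflection_conj u Cons.prems by simp
    then have "ev (x # u) * R s = ev ([] @ u)" using u Cons.prems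
      by (simp add: mult.assoc r_sq)
    then show ?thesis by blast
  qed
qed simp

lemma left_exchange:
  assumes "u \<in> lists S" "s \<in> S" "len (R s * ev u) \<le> len (ev u)"
  shows "\<exists>u1 x u2. u = u1 @ x # u2 \<and> R s * ev u = ev (u1 @ u2)"
proof -
  have ru: "rev u \<in> lists S" using assms(1) by (rule rev_in_lists)
  have eq: "ev (rev u) * R s = inverse (R s * ev u)" using assms by (simp add: ev_rev)
  have "len (ev (rev u) * R s) \<le> len (ev (rev u))"
    unfolding eq using assms by (subst len_inverse) (auto simp: ev_rev)
  then have "\<not> nn (sapply (ev (rev u)) (E s))"
    using root_sign[OF ev_in_W[OF ru] assms(2)] by auto
  then obtain u1 x u2 where u: "rev u = u1 @ x # u2" "ev (rev u) * R s = ev (u1 @ u2)"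
    using right_exchange[OF ru assms(2)] by blast
  have "u = rev u2 @ x # rev u1" using arg_cong[OF u(1), of rev] by simp
  moreover have "u1 @ u2 \<in> lists S" using ru u by simp
  then have "R s * ev u = ev (rev u2 @ rev u1)"
    using arg_cong[OF u(2), of inverse] unfolding eq by (simp add: ev_rev[symmetric])
  ultimately show ?thesis by blast
qed

text \<open>Only the finite entries of \<open>k\<close> are prescribed. Where \<open>k\<close> is
  infinite, \<open>m\<close> may take any value, which \<open>spherical_finite_entries\<close>
  exploits.\<close>

lemma pres_cong_ev:
  assumes "\<And>s t n. s \<in> S \<Longrightarrow> t \<in> S \<Longrightarrow> s \<noteq> t \<Longrightarrow> k s t = enat n \<Longrightarrow> m s t = n"
    and "(u, v) \<in> pres_cong S (braid_relations S k \<union> square_relations S)"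
  shows "ev (map fst u) = ev (map fst v)"
  using assms(2)
proof induction
  case (rel p q u v)
  have mf: "map fst (alt_word a b n) = alt a b n" for a b :: 's and n
    by (induction n arbitrary: a b) auto
  consider (braid) s t n where "u = alt_word s t n" "v = alt_word t s n" "s \<in> S" "t \<in> S" "s \<noteq> t"
      "k s t = enat n"
    | (square) s where "s \<in> S" "u = [(s, True), (s, True)]" "v = []"
    using rel.hyps(5) unfolding braid_relations_def square_relations_def by blast
  then have "ev (map fst u) = ev (map fst v)"
  proof cases
    case (braid s t n)
    then show ?thesis using braid_relation[of s t] assms(1)[of s t n] mf by simp
  qed (simp add: r_sq)
  then show ?case by simp
qed auto

end

lemma alt_word_eq: "alt_word a b n = map (\<lambda>s. (s, True)) (alt a b n)"
  by (induction n arbitrary: a b) auto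

text \<open>If \<open>m s t = \<infinity>\<close>, then no relation constrains the pair \<open>s, t\<close>, so the geometric
  representations for all finite values of this entry are representations of the Coxeter group.
  This makes the order of \<open>s t\<close> infinite.\<close>

lemma spherical_finite_entries:
  assumes "finite S" "coxeter_matrix S k" "spherical_type S k" "s \<in> S" "t \<in> S"
  shows "k s t \<noteq> \<infinity>"
proof
  assume inf: "k s t = \<infinity>"
  let ?cong = "pres_cong S (braid_relations S k \<union> square_relations S)"
  let ?w = "\<lambda>i. map (\<lambda>s. (s, True)) (alt s t i)"
  have w: "?w i \<in> words S" for i using set_alt[of s t i] assms(4,5) by auto
  have "?cong `` {?w i} \<in> carrier (coxeter_group S k)" for i
    using w by (auto simp: coxeter_group_def presented_group_def intro: quotientI)
  then have "\<not> inj (\<lambda>i. ?cong `` {?w i})"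
    using assms(3) finite_subset[of "range (\<lambda>i. ?cong `` {?w i})"] range_inj_infinite
    unfolding spherical_type_def by blast
  then obtain i j where ij: "i < j" "?cong `` {?w i} = ?cong `` {?w j}"
    unfolding inj_on_def by (metis linorder_neqE_nat)
  then have cong: "(?w i, ?w j) \<in> ?cong"
    using eq_equiv_class[OF _ equiv_pres_cong w] by blast
  \<comment> \<open>The default \<open>j + 2\<close> is a legal entry and bounds both word lengths,
    so that the two alternating words keep their different lengths \<open>i\<close> and
    \<open>j\<close>.\<close>
  define M where "M x y = (case k x y of enat n \<Rightarrow> n | \<infinity> \<Rightarrow> j + 2)" for x y
  have "s \<noteq> t" using inf assms(2,4) by (auto simp: coxeter_matrix_def)
  have "2 \<le> n" if "(2 :: enat) \<le> enat n" for n using that by (simp add: numeral_eq_enat)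
  note two = this
  interpret coxeter_geometry S M
  proof
    show "finite S" by fact
    fix x assume x: "x \<in> S"
    have "k x x = 1" using assms(2) x unfolding coxeter_matrix_def by blast
    then show "M x x = 1" by (simp add: M_def one_enat_def)
    fix y assume y: "y \<in> S"
    have "k x y = k y x" using assms(2) x y unfolding coxeter_matrix_def by blast
    then show "M x y = M y x" by (simp add: M_def)
    assume "x \<noteq> y"
    then have "2 \<le> k x y" using assms(2) x y unfolding coxeter_matrix_def by blast
    then show "2 \<le> M x y" using two by (cases "k x y") (simp_all add: M_def)
  qed
  have "ev (map fst (?w i)) = ev (map fst (?w j))"
    using cong by (rule pres_cong_ev[rotated]) (simp add: M_def)
  then have "ev (alt s t i) = ev (alt s t j)" by (simp add: comp_def)
  moreover have "M s t = j + 2" using inf by (simp add: M_def)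
  ultimately show False
    using len_alt[OF assms(4,5) \<open>s \<noteq> t\<close>, of i] len_alt[OF assms(4,5) \<open>s \<noteq> t\<close>, of j] ij(1) by simp
qed

section \<open>Finite Coxeter groups and the weak order\<close>

lemma finite_argmax:
  fixes f :: "'a \<Rightarrow> nat"
  assumes "finite A" "A \<noteq> {}"
  shows "\<exists>a\<in>A. \<forall>b\<in>A. f b \<le> f a"
proof -
  have "Max (f ` A) \<in> f ` A" using assms by (intro Max_in) auto
  then obtain a where "a \<in> A" "Max (f ` A) = f a" by blast
  then show ?thesis using assms(1) Max_ge[of "f ` A"] by (intro bexI[of _ a]) auto
qed

text \<open>The roots are left behind here: apart from the matrix, only the braid relations, the
  exact lengths of alternating words, the exchange condition and finiteness are retained.\<close>

locale coxeter_system = involution_group S r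
  for S :: "'s set" and r :: "'s \<Rightarrow> 'w::group_mult" +
  fixes m :: "'s \<Rightarrow> 's \<Rightarrow> nat"
  assumes finite_S: "finite S"
    and m_sym: "s \<in> S \<Longrightarrow> t \<in> S \<Longrightarrow> m s t = m t s"
    and m_ge2: "s \<in> S \<Longrightarrow> t \<in> S \<Longrightarrow> s \<noteq> t \<Longrightarrow> 2 \<le> m s t"
    and ev_alt: "s \<in> S \<Longrightarrow> t \<in> S \<Longrightarrow> s \<noteq> t \<Longrightarrow> ev (alt s t (m s t)) = ev (alt t s (m s t))"
    and len_alt: "s \<in> S \<Longrightarrow> t \<in> S \<Longrightarrow> s \<noteq> t \<Longrightarrow> k \<le> m s t \<Longrightarrow> len (ev (alt s t k)) = k"
    and exchange: "u \<in> lists S \<Longrightarrow> s \<in> S \<Longrightarrow> len (r s * ev u) \<le> len (ev u) \<Longrightarrow>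
      \<exists>u1 x u2. u = u1 @ x # u2 \<and> r s * ev u = ev (u1 @ u2)"
    and finite_W: "finite W"
begin

lemma len_r [simp]: "s \<in> S \<Longrightarrow> len (r s) = 1"
proof -
  assume s: "s \<in> S"
  have "len (r s) \<noteq> 0" using exchange[of "[]" s] s by auto
  then show ?thesis using len_r_le[OF s] by simp
qed

lemma len_r_mult:
  assumes "s \<in> S" "w \<in> W"
  shows "len (r s * w) = Suc (len w) \<or> Suc (len (r s * w)) = len w"
proof (cases "len (r s * w) \<le> len w")
  case True
  obtain u where u: "u \<in> lists S" "ev u = w" "length u = len w" using reduced_word[OF assms(2)] .
  then obtain u1 x u2 where x: "u = u1 @ x # u2" "r s * w = ev (u1 @ u2)"
    using exchange[of u s] True assms(1) by auto
  have "len (r s * w) \<le> length (u1 @ u2)" unfolding x(2) using u x by (intro len_ev_le) auto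
  moreover have "len w \<le> Suc (len (r s * w))"
    using len_r_mult_le[of "r s * w" s] assms by simp
  ultimately show ?thesis using u(3) x(1) by simp
next
  case False
  then show ?thesis using len_r_mult_le[OF assms(2,1)] by simp
qed

section \<open>Reduced products and the prefix order\<close>

definition red :: "'w \<Rightarrow> 'w \<Rightarrow> bool" where
  "red x y \<longleftrightarrow> x \<in> W \<and> y \<in> W \<and> len (x * y) = len x + len y"

definition le :: "'w \<Rightarrow> 'w \<Rightarrow> bool" where
  "le a x \<longleftrightarrow> (\<exists>y. red a y \<and> x = a * y)"

lemma redD: "red x y \<Longrightarrow> x \<in> W" "red x y \<Longrightarrow> y \<in> W" "red x y \<Longrightarrow> len (x * y) = len x + len y"
  by (auto simp: red_def)

lemma red_assoc1:
  assumes "red x y" "red (x * y) z"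
  shows "red y z" "red x (y * z)"
  using assms len_mult_le[of y z] len_mult_le[of x "y * z"] by (auto simp: red_def mult.assoc)

lemma red_assoc2:
  assumes "red y z" "red x (y * z)"
  shows "red x y" "red (x * y) z"
  using assms len_mult_le[of x y] len_mult_le[of "x * y" z] by (auto simp: red_def mult.assoc)

lemma red_one [simp]: "x \<in> W \<Longrightarrow> red x 1" "x \<in> W \<Longrightarrow> red 1 x"
  by (simp_all add: red_def)

lemma leI: "red a y \<Longrightarrow> le a (a * y)"
  by (auto simp: le_def)

lemma leE:
  assumes "le a x" obtains y where "red a y" "x = a * y"
  using assms by (auto simp: le_def)

lemma le_iff: "le a x \<longleftrightarrow> red a (inverse a * x)"
  by (force simp: le_def)

lemma le_W: "le a x \<Longrightarrow> a \<in> W" "le a x \<Longrightarrow> x \<in> W"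
  by (auto simp: le_def dest: redD)

lemma le_refl [simp]: "x \<in> W \<Longrightarrow> le x x"
  by (simp add: le_iff)

lemma one_le [simp]: "x \<in> W \<Longrightarrow> le 1 x"
  by (simp add: le_iff)

lemma le_trans:
  assumes "le a b" "le b c" shows "le a c"
proof -
  obtain y z where y: "red a y" "b = a * y" and z: "red b z" "c = b * z"
    using assms by (metis leE)
  then have "red a (y * z)" using red_assoc1[of a y z] by simp
  then show ?thesis using leI[of a "y * z"] y z by (simp add: mult.assoc)
qed

lemma le_len: "le a x \<Longrightarrow> len a \<le> len x"
  by (auto simp: le_def dest: redD)

lemma le_len_eq: "le a x \<Longrightarrow> len x \<le> len a \<Longrightarrow> a = x"
  by (auto simp: le_def red_def len_eq_0)

lemma le_mult_left:
  assumes "red x y" "le a y" shows "red x a" "le (x * a) (x * y)"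
proof -
  obtain z where z: "red a z" "y = a * z" using assms(2) by (rule leE)
  then show "red x a" "le (x * a) (x * y)"
    using red_assoc2[of a z x] assms(1) leI[of "x * a" z] by (auto simp: mult.assoc)
qed

lemma le_cancel_left:
  assumes "red x a" "le (x * a) (x * y)" shows "le a y"
proof -
  obtain z where z: "red (x * a) z" "x * y = x * a * z" using assms(2) by (rule leE)
  then have "y = a * z" by (simp add: mult.assoc)
  then show ?thesis using red_assoc1(1)[OF assms(1) z(1)] leI by simp
qed

lemma red_r: "s \<in> S \<Longrightarrow> w \<in> W \<Longrightarrow> red (r s) w \<longleftrightarrow> len w < len (r s * w)"
  using len_r_mult[of s w] by (auto simp: red_def)

lemma le_r: "s \<in> S \<Longrightarrow> w \<in> W \<Longrightarrow> le (r s) w \<longleftrightarrow> len (r s * w) < len w"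
  by (simp add: le_iff red_r)

lemma not_le_r: "s \<in> S \<Longrightarrow> w \<in> W \<Longrightarrow> \<not> le (r s) w \<longleftrightarrow> red (r s) w"
  using len_r_mult[of s w] by (auto simp: le_r red_r)

lemma first_letter:
  assumes "w \<in> W" "w \<noteq> 1"
  obtains s w' where "s \<in> S" "red (r s) w'" "w = r s * w'"
proof -
  obtain u where u: "u \<in> lists S" "ev u = w" "length u = len w" using reduced_word[OF assms(1)] .
  then obtain s u' where su: "u = s # u'" using assms(2) by (cases u) auto
  then have "len (ev u') = length u'" using reduced_appendD(2)[of "[s]" u'] u by simp
  then have "red (r s) (ev u')" using u su by (auto simp: red_def)
  then show thesis using that[of s "ev u'"] u su by auto
qed

text \<open>By exchange, \<open>r s * w\<close> arises from a reduced word of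
  \<open>w = x * y\<close> by deleting a letter. A deletion inside \<open>x\<close> would shorten
  \<open>r s * x\<close>, against \<open>red (r s) x\<close>; so the letter lies in
  \<open>y\<close>, and \<open>r s * x\<close> is a prefix of \<open>w\<close>.\<close>

lemma le_extend:
  assumes "le x w" "s \<in> S" "red (r s) x" "le (r s) w"
  shows "le (r s * x) w"
proof -
  obtain y where y: "red x y" "w = x * y" using assms(1) by (rule leE)
  obtain ux where ux: "ux \<in> lists S" "ev ux = x" "length ux = len x" using reduced_word[of x] redD[OF y(1)] by blast
  obtain uy where uy: "uy \<in> lists S" "ev uy = y" "length uy = len y" using reduced_word[of y] redD[OF y(1)] by blast
  have w: "w \<in> W" "len (r s * w) < len w" using le_W[OF assms(1)] le_r assms(2,4) by auto
  have "ev (ux @ uy) = w" using ux uy y by simp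
  then obtain u1 z u2 where z: "ux @ uy = u1 @ z # u2" "r s * w = ev (u1 @ u2)"
    using exchange[of "ux @ uy" s] ux uy assms(2) w(2) by auto
  have "(\<exists>v. ux = u1 @ z # v \<and> u2 = v @ uy) \<or> (\<exists>v. uy = v @ z # u2 \<and> u1 = ux @ v)"
    using z(1) by (auto simp: append_eq_append_conv2 append_eq_Cons_conv)
  then show ?thesis
  proof (elim disjE exE conjE)
    fix v assume v: "ux = u1 @ z # v" "u2 = v @ uy"
    have "r s * x * y = ev (u1 @ v) * y" using z(2) y(2) v uy by (simp add: mult.assoc)
    then have "r s * x = ev (u1 @ v)" by simp
    also have "len \<dots> \<le> length (u1 @ v)" using ux v by (intro len_ev_le) auto
    finally show ?thesis using redD[OF assms(3)] ux v assms(2) by simp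
  next
    fix v assume v: "uy = v @ z # u2" "u1 = ux @ v"
    have eq: "w = r s * x * ev (v @ u2)" using arg_cong[OF z(2), of "(*) (r s)"] assms(2) ux v
      by (simp add: mult.assoc)
    have vS: "v @ u2 \<in> lists S" using uy v by auto
    have W: "r s * x \<in> W" "ev (v @ u2) \<in> W" using redD[OF assms(3)] vS by auto
    have "len (ev (v @ u2)) < len y" using len_ev_le[OF vS] uy v by simp
    moreover have "len w = len x + len y" using redD[OF y(1)] y(2) by simp
    moreover have "len (r s * x) = Suc (len x)" using redD[OF assms(3)] assms(2) by simp
    moreover have "len w \<le> len (r s * x) + len (ev (v @ u2))"
      using len_mult_le[OF W] eq by simp
    ultimately have "red (r s * x) (ev (v @ u2))" using W eq by (simp add: red_def)
    then show ?thesis using leI eq by simp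
  qed
qed

lemma le_alt:
  assumes "s \<in> S" "t \<in> S" "s \<noteq> t" "le (r s) w" "le (r t) w" "k \<le> m s t"
  shows "le (ev (alt s t k)) w"
  using assms
proof (induction k arbitrary: s t)
  case 0
  then show ?case using le_W by auto
next
  case (Suc k)
  have "k \<le> m t s" using Suc.prems m_sym by simp
  then have "le (ev (alt t s k)) w" using Suc.IH[of t s] Suc.prems by auto
  moreover have "red (r s) (ev (alt t s k))"
    using len_alt[of s t "Suc k"] len_alt[of t s k] Suc.prems \<open>k \<le> m t s\<close>
    by (simp add: red_def alt_in_lists)
  ultimately show ?case using le_extend Suc.prems by simp
qed

lemma reduced_subword:
  assumes "T \<subseteq> S" "u \<in> lists T"
  shows "\<exists>v\<in>lists T. ev v = ev u \<and> length v = len (ev u)"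
  using assms(2)
proof (induction u rule: list.induct)
  case (Cons t u)
  then obtain v where v: "v \<in> lists T" "ev v = ev u" "length v = len (ev u)" by auto
  have t: "t \<in> T" "t \<in> S" "v \<in> lists S" using Cons.prems assms(1) v by auto
  show ?case
  proof (cases "len (r t * ev v) \<le> len (ev v)")
    case True
    then obtain u1 x u2 where x: "v = u1 @ x # u2" "r t * ev v = ev (u1 @ u2)"
      using exchange t by blast
    have "Suc (len (r t * ev v)) = len (ev v)" using len_r_mult[of t "ev v"] t True by auto
    then have "length (u1 @ u2) = len (ev (t # u))" using v x by simp
    then show ?thesis using v x by (intro bexI[of _ "u1 @ u2"]) auto
  next
    case False
    then have "len (r t * ev v) = Suc (len (ev v))" using len_r_mult[of t "ev v"] t by auto
    then show ?thesis using v t by (intro bexI[of _ "t # v"]) auto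
  qed
qed auto

text \<open>Its main use is with the longest element of \<open>T\<close>: it is a prefix of
  everything that has all letters of \<open>T\<close> as descents.\<close>

lemma le_of_descents:
  assumes "T \<subseteq> S" "x \<in> W" "\<And>t. t \<in> T \<Longrightarrow> le (r t) x" "w \<in> ev ` lists T"
  shows "le w x"
proof -
  obtain v where v: "v \<in> lists T" "ev v = w" "length v = len w"
    using assms(4) reduced_subword[OF assms(1)] by blast
  have "len (ev v) = length v \<Longrightarrow> le (ev v) x" using v(1)
  proof (induction v rule: list.induct)
    case (Cons t v)
    have S: "t # v \<in> lists S" using Cons.prems assms(1) by auto
    then have red: "len (ev v) = length v" using reduced_appendD(2)[of "[t]" v] Cons.prems by simp
    then have "red (r t) (ev v)" using Cons.prems S by (auto simp: red_def)
    moreover have "le (ev v) x" using Cons red by auto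
    ultimately show ?case using le_extend[of "ev v" x t] assms(3) Cons.prems(2) S by auto
  qed (use assms(2) in auto)
  then show ?thesis using v by simp
qed

section \<open>Joins of pairs with a common upper bound\<close>

definition is_join :: "'w \<Rightarrow> 'w \<Rightarrow> 'w \<Rightarrow> bool" where
  "is_join a b c \<longleftrightarrow> le a c \<and> le b c \<and> (\<forall>y. le a y \<longrightarrow> le b y \<longrightarrow> le c y)"

lemma join_common_letter:
  assumes IH: "\<And>x1 a b. len x1 < len x \<Longrightarrow> le a x1 \<Longrightarrow> le b x1 \<Longrightarrow> \<exists>c. is_join a b c"
    and "s \<in> S" "le (r s) a" "le (r s) b" "le a x" "le b x"
  shows "\<exists>c. is_join a b c"
proof -
  obtain a1 where a1: "red (r s) a1" "a = r s * a1" using assms(3) by (rule leE)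
  obtain b1 where b1: "red (r s) b1" "b = r s * b1" using assms(4) by (rule leE)
  have "le (r s) x" using assms le_trans by blast
  then obtain x1 where x1: "red (r s) x1" "x = r s * x1" by (rule leE)
  have "le a1 x1" "le b1 x1" using assms le_cancel_left a1 b1 x1 by auto
  moreover have "len x1 < len x" using x1 assms(2) by (simp add: redD)
  ultimately obtain c1 where c1: "is_join a1 b1 c1" using IH by blast
  have c1x: "le c1 x1" using c1 \<open>le a1 x1\<close> \<open>le b1 x1\<close> by (simp add: is_join_def)
  have red_c1: "red (r s) c1" using le_mult_left(1)[OF x1(1) c1x] .
  have "is_join a b (r s * c1)"
    unfolding is_join_def
  proof (intro conjI allI impI)
    show "le a (r s * c1)" "le b (r s * c1)"
      using c1 a1 b1 le_mult_left(2)[OF red_c1] by (auto simp: is_join_def)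
    fix y assume y: "le a y" "le b y"
    then have "le (r s) y" using assms le_trans by blast
    then obtain y1 where y1: "red (r s) y1" "y = r s * y1" by (rule leE)
    have "le a1 y1" "le b1 y1" using y le_cancel_left a1 b1 y1 by auto
    then have "le c1 y1" using c1 by (simp add: is_join_def)
    then show "le (r s * c1) y" using le_mult_left(2)[OF y1(1)] y1(2) by simp
  qed
  then show ?thesis by blast
qed

text \<open>For different first letters \<open>s\<close> and \<open>t\<close>, every common upper
  bound lies above \<open>?d = ev (alt s t (m s t))\<close>, by \<open>le_alt\<close>. Joining
  \<open>a\<close> with \<open>?d\<close> (common letter \<open>s\<close>) and the result with
  \<open>b\<close> (common letter \<open>t\<close>) leaves two instances of
  \<open>join_common_letter\<close>, where cancelling the letter makes the induction hypothesis
  applicable.\<close>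

lemma bounded_join:
  "le a x \<Longrightarrow> le b x \<Longrightarrow> \<exists>c. is_join a b c"
proof (induction "len x" arbitrary: x a b rule: less_induct)
  case less
  have W: "a \<in> W" "b \<in> W" "x \<in> W" using less.prems le_W by auto
  consider "a = 1" | "b = 1" | "a \<noteq> 1" "b \<noteq> 1" by blast
  then show ?case
  proof cases
    case 1
    then have "is_join a b b" using W by (simp add: is_join_def)
    then show ?thesis by blast
  next
    case 2
    then have "is_join a b a" using W by (simp add: is_join_def)
    then show ?thesis by blast
  next
    case 3
    obtain s where s: "s \<in> S" "le (r s) a" using first_letter[OF W(1) 3(1)] leI by metis
    obtain t where t: "t \<in> S" "le (r t) b" using first_letter[OF W(2) 3(2)] leI by metis
    have IH: "\<exists>c. is_join a' b' c" if "len x1 < len x" "le a' x1" "le b' x1" for x1 a' b'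
      using less.hyps[OF that] .
    have common: "\<exists>c. is_join a' b' c"
      if "y \<in> S" "le (r y) a'" "le (r y) b'" "le a' x" "le b' x" for y a' b'
      by (rule join_common_letter[of x y a' b', OF IH that])
    show ?thesis
    proof (cases "s = t")
      case True
      then show ?thesis using common[of s a b] s t less.prems by blast
    next
      case False
      let ?d = "ev (alt s t (m s t))"
      obtain k where k: "m s t = Suc k" using m_ge2[OF s(1) t(1) False] by (cases "m s t") auto
      have d: "le ?d y" if "le (r s) y" "le (r t) y" for y
        using le_alt[of s t y "m s t"] that s t False by simp
      have dx: "le (r s) x" "le (r t) x" using s t less.prems le_trans by blast+
      have letters: "le (r x) (ev (alt x y (Suc k)))" if "x \<in> S" "y \<in> S" "x \<noteq> y" "m x y = Suc k" for x y
      proof -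
        have "red (r x) (ev (alt y x k))"
          using len_alt[of x y "Suc k"] len_alt[of y x k] that m_sym[of x y]
          by (simp add: red_def alt_in_lists)
        then show ?thesis using leI by simp
      qed
      have ds: "le (r s) ?d" using letters[of s t] s t False k by simp
      have dt: "le (r t) ?d"
        using letters[of t s] s t False k m_sym[of s t] ev_alt[of s t] by simp
      obtain d1 where d1: "is_join a ?d d1"
        using common[of s a ?d] s ds less.prems(1) d[OF dx] by blast
      have "le d1 x" using d1 less.prems(1) d[OF dx] by (simp add: is_join_def)
      moreover have "le (r t) d1" using d1 dt le_trans by (auto simp: is_join_def)
      ultimately obtain e where e: "is_join d1 b e"
        using common[of t d1 b] t less.prems(2) by blast
      have "is_join a b e"
        unfolding is_join_def
      proof (intro conjI allI impI)
        show "le a e" "le b e" using d1 e le_trans by (auto simp: is_join_def)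
        fix y assume y: "le a y" "le b y"
        then have "le ?d y" using d s t le_trans by blast
        then show "le e y" using y d1 e by (simp add: is_join_def)
      qed
      then show ?thesis by blast
    qed
  qed
qed

subsection \<open>Longest elements\<close>

definition longest :: "'s set \<Rightarrow> 'w" where
  "longest T = (SOME w. w \<in> ev ` lists T \<and> (\<forall>x\<in>ev ` lists T. len x \<le> len w))"

context
  fixes T assumes T: "T \<subseteq> S"
begin

lemma WT_closed:
  "x \<in> ev ` lists T \<Longrightarrow> y \<in> ev ` lists T \<Longrightarrow> x * y \<in> ev ` lists T"
  "x \<in> ev ` lists T \<Longrightarrow> inverse x \<in> ev ` lists T"
  "t \<in> T \<Longrightarrow> r t \<in> ev ` lists T"
  "x \<in> ev ` lists T \<Longrightarrow> x \<in> W"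
proof -
  show "x * y \<in> ev ` lists T" if "x \<in> ev ` lists T" "y \<in> ev ` lists T"
  proof -
    obtain u v where "u \<in> lists T" "v \<in> lists T" "x = ev u" "y = ev v" using \<open>x \<in> _\<close> \<open>y \<in> _\<close> by blast
    then show ?thesis by (intro image_eqI[of _ _ "u @ v"]) auto
  qed
  show "inverse x \<in> ev ` lists T" if x: "x \<in> ev ` lists T"
  proof -
    obtain u where u: "u \<in> lists T" "x = ev u" using x by blast
    then have "u \<in> lists S" using T by auto
    then show ?thesis using u rev_in_lists[of u T] by (intro image_eqI[of _ _ "rev u"]) (auto simp: ev_rev)
  qed
  show "r t \<in> ev ` lists T" if "t \<in> T" using that by (intro image_eqI[of _ _ "[t]"]) auto
  show "x \<in> W" if "x \<in> ev ` lists T" using that T by auto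
qed

lemma longest_max: "longest T \<in> ev ` lists T" "x \<in> ev ` lists T \<Longrightarrow> len x \<le> len (longest T)"
proof -
  have fin: "finite (ev ` lists T)" using finite_subset[OF _ finite_W] WT_closed(4) by blast
  moreover have "1 \<in> ev ` lists T" by (intro image_eqI[of _ _ "[]"]) auto
  ultimately have "\<exists>w\<in>ev ` lists T. \<forall>x\<in>ev ` lists T. len x \<le> len w"
    by (intro finite_argmax) auto
  then have "\<exists>w. w \<in> ev ` lists T \<and> (\<forall>x\<in>ev ` lists T. len x \<le> len w)" by blast
  from someI_ex[OF this, folded longest_def]
  show "longest T \<in> ev ` lists T" "x \<in> ev ` lists T \<Longrightarrow> len x \<le> len (longest T)" by blast+
qed

lemma longest_W [simp]: "longest T \<in> W"
  using longest_max(1) WT_closed(4) by blast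

lemma le_longest: "x \<in> ev ` lists T \<Longrightarrow> le x (longest T)"
proof (rule le_of_descents[OF T longest_W])
  fix t assume t: "t \<in> T"
  have "len (r t * longest T) \<le> len (longest T)"
    using longest_max(2)[OF WT_closed(1)[OF WT_closed(3)[OF t] longest_max(1)]] .
  then show "le (r t) (longest T)" using t T len_r_mult[of t "longest T"] by (auto simp: le_r)
qed

lemma longest_unique: "x \<in> ev ` lists T \<Longrightarrow> len (longest T) \<le> len x \<Longrightarrow> x = longest T"
  using le_longest le_len_eq by blast

lemma longest_inverse [simp]: "inverse (longest T) = longest T"
  using WT_closed(2)[OF longest_max(1)] by (rule longest_unique) simp

lemma longest_sq [simp]: "longest T * longest T = 1"
  using group_left_inverse[of "longest T"] by simp

text \<open>\<open>z = r t * longest T\<close> is one letter too short. Some \<open>t'\<close> in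
  \<open>T\<close> lengthens it on the right, since otherwise its inverse would have the longest
  element as a prefix; then \<open>z * r t'\<close> is the longest element.\<close>

lemma longest_conj: "t \<in> T \<Longrightarrow> \<exists>t'\<in>T. r t * longest T = longest T * r t'"
proof -
  assume t: "t \<in> T"
  define z where "z = r t * longest T"
  have z: "z \<in> ev ` lists T" "z \<in> W"
    using WT_closed(1)[OF WT_closed(3)[OF t] longest_max(1)] WT_closed(4) by (auto simp: z_def)
  have "le (r t) (longest T)" using le_longest WT_closed(3) t by blast
  then have zlen: "Suc (len z) = len (longest T)"
    using t T le_r[of t "longest T"] len_r_mult[of t "longest T"] by (auto simp: z_def)
  have "\<exists>t'\<in>T. \<not> le (r t') (inverse z)"
  proof (rule ccontr)
    assume "\<not> ?thesis"
    then have "le (longest T) (inverse z)"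
      using le_of_descents[OF T, of "inverse z" "longest T"] z longest_max(1) by auto
    then have "len (longest T) \<le> len z" using le_len z(2) by fastforce
    then show False using zlen by simp
  qed
  then obtain t' where t': "t' \<in> T" "\<not> le (r t') (inverse z)" by blast
  then have "red (r t') (inverse z)" using T z(2) not_le_r by blast
  then have "len (r t' * inverse z) = Suc (len z)" using z(2) t' T by (auto simp: red_def)
  moreover have "inverse (r t' * inverse z) = z * r t'" using t' T by auto
  then have "len (z * r t') = len (r t' * inverse z)"
    using len_inverse[of "r t' * inverse z"] t' T z(2) by auto
  ultimately have "z * r t' = longest T"
    using zlen WT_closed(1)[OF z(1) WT_closed(3)[OF t'(1)]] by (intro longest_unique) auto
  then have "z * r t' * r t' = longest T * r t'" by simp
  then have "z = longest T * r t'" using t' T by (auto simp: mult.assoc r_sq)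
  then show ?thesis using t' by (auto simp: z_def)
qed

end

lemma WS: "ev ` lists S = W"
  by (simp add: W_def)

text \<open>The condition that \<open>w\<close> can absorb \<open>a\<close> becomes an upper bound
  on \<open>a\<close> in the prefix order, by the complement of \<open>w\<close> in the longest
  element. Joins therefore preserve it.\<close>

lemma red_iff_le_longest:
  assumes "w \<in> W" "a \<in> W"
  shows "red w a \<longleftrightarrow> le a (inverse w * longest S)"
proof
  assume "red w a"
  then have "le (w * a) (longest S)" using le_longest[of S "w * a"] assms by (simp add: WS)
  then obtain z where z: "red (w * a) z" "longest S = w * a * z" by (rule leE)
  then have "red a z" using red_assoc1 \<open>red w a\<close> by blast
  then show "le a (inverse w * longest S)" using leI z(2) by (auto simp: mult.assoc)
next
  assume "le a (inverse w * longest S)"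
  then obtain z where z: "red a z" "inverse w * longest S = a * z" by (rule leE)
  have "le w (longest S)" using le_longest[of S w] assms by (simp add: WS)
  then have "red w (a * z)" using z(2) by (simp add: le_iff)
  then show "red w a" using red_assoc2 z(1) by blast
qed

text \<open>In Garside terms, the left gcd of \<open>x\<close> and the complement of
  \<open>w\<close>: the largest prefix of \<open>x\<close> that \<open>w\<close> can absorb while
  remaining simple.\<close>

definition cap :: "'w \<Rightarrow> 'w \<Rightarrow> 'w" where
  "cap w x = (SOME a. le a x \<and> red w a \<and> (\<forall>b. le b x \<longrightarrow> red w b \<longrightarrow> le b a))"

text \<open>A candidate of maximal length is the greatest: its join with another candidate lies
  below \<open>x\<close>, is a candidate by \<open>red_iff_le_longest\<close>, and cannot be
  longer.\<close>

lemma cap: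
  assumes "w \<in> W" "x \<in> W"
  shows "le (cap w x) x" "red w (cap w x)" "le b x \<Longrightarrow> red w b \<Longrightarrow> le b (cap w x)"
proof -
  let ?A = "{a. le a x \<and> red w a}"
  have "finite ?A" using finite_subset[OF _ finite_W, of ?A] le_W by blast
  moreover have "1 \<in> ?A" using assms by simp
  ultimately have "\<exists>a\<in>?A. \<forall>b\<in>?A. len b \<le> len a"
    by (intro finite_argmax) auto
  then obtain a where a: "le a x" "red w a" "\<And>b. le b x \<Longrightarrow> red w b \<Longrightarrow> len b \<le> len a" by auto
  have "le b a" if b: "le b x" "red w b" for b
  proof -
    obtain c where c: "is_join a b c" using bounded_join a(1) b(1) by blast
    have "le c x" using c a b by (simp add: is_join_def)
    moreover have "le x (inverse w * longest S)" if "red w x" for x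
      using that red_iff_le_longest[OF assms(1) redD(2)[OF that]] by simp
    then have "le c (inverse w * longest S)"
      using c a(2) b(2) unfolding is_join_def by blast
    then have "red w c" using red_iff_le_longest[OF assms(1) le_W(1)] by blast
    ultimately have "len c \<le> len a" using a(3) by blast
    then have "a = c" using c le_len_eq by (simp add: is_join_def)
    then show ?thesis using c by (simp add: is_join_def)
  qed
  then have "\<exists>a. le a x \<and> red w a \<and> (\<forall>b. le b x \<longrightarrow> red w b \<longrightarrow> le b a)" using a by blast
  from someI_ex[OF this, folded cap_def]
  show "le (cap w x) x" "red w (cap w x)" "le b x \<Longrightarrow> red w b \<Longrightarrow> le b (cap w x)" by blast+
qed

lemma le_antisym: "le a b \<Longrightarrow> le b a \<Longrightarrow> a = b"
  using le_len le_len_eq by blast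

lemma cap_eqI:
  assumes "le a x" "red w a" "\<And>b. le b x \<Longrightarrow> red w b \<Longrightarrow> le b a"
  shows "cap w x = a"
proof -
  have "w \<in> W" "x \<in> W" using assms(1,2) le_W(2) redD(1) by auto
  note cap = cap[OF this]
  show ?thesis by (rule le_antisym) (use assms cap in blast)+
qed

text \<open>The matrix can be read off the group, so a conjugation that permutes the letters
  preserves it; see \<open>m_tau\<close>.\<close>

lemma m_least:
  assumes "s \<in> S" "t \<in> S" "s \<noteq> t" "0 < k" "ev (alt s t k) = ev (alt t s k)"
  shows "m s t \<le> k"
proof (rule ccontr)
  assume k: "\<not> ?thesis"
  obtain j where j: "k = Suc j" using assms(4) by (cases k) auto
  have "ev (alt t s (Suc k)) = r t * ev (alt t s k)" by (simp add: assms(5))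
  also have "\<dots> = ev (alt s t j)" using assms(2) j by simp
  finally show False
    using len_alt[of t s "Suc k"] len_alt[of s t j] assms k j m_sym[of s t] by simp
qed

end

section \<open>The positive braid monoid\<close>

context coxeter_system
begin

inductive br :: "'s list \<Rightarrow> 's list \<Rightarrow> bool"  (infix "\<simeq>" 50) where
  br_refl [simp, intro]: "u \<simeq> u"
| br_step: "s \<in> S \<Longrightarrow> t \<in> S \<Longrightarrow> s \<noteq> t \<Longrightarrow> p @ alt s t (m s t) @ q \<simeq> p @ alt t s (m s t) @ q"
| br_trans [trans]: "u \<simeq> v \<Longrightarrow> v \<simeq> w \<Longrightarrow> u \<simeq> w"

lemma br_sym: "u \<simeq> v \<Longrightarrow> v \<simeq> u"
proof (induction rule: br.induct)
  case (br_step s t p q)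
  then show ?case using br.br_step[of t s p q] m_sym[of s t] by simp
next
  case (br_trans u v w)
  then show ?case using br.br_trans by blast
qed simp

lemma br_context: "u \<simeq> v \<Longrightarrow> p @ u @ q \<simeq> p @ v @ q"
proof (induction rule: br.induct)
  case (br_step s t p' q')
  then show ?case using br.br_step[of s t "p @ p'" "q' @ q"] by simp
next
  case (br_trans u v w)
  then show ?case using br.br_trans by blast
qed simp

lemma br_append: "u \<simeq> u' \<Longrightarrow> v \<simeq> v' \<Longrightarrow> u @ v \<simeq> u' @ v'"
  using br_context[of u u' "[]" v] br_context[of v v' u' "[]"] br_trans by fastforce

lemma br_append_left: "v \<simeq> v' \<Longrightarrow> u @ v \<simeq> u @ v'"
  by (rule br_append[OF br_refl])

lemma br_append_right: "u \<simeq> u' \<Longrightarrow> u @ v \<simeq> u' @ v"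
  by (rule br_append[OF _ br_refl])

lemma br_Cons: "u \<simeq> v \<Longrightarrow> s # u \<simeq> s # v"
  using br_append_left[of u v "[s]"] by simp

lemma br_length: "u \<simeq> v \<Longrightarrow> length u = length v"
  by (induction rule: br.induct) auto

lemma br_Nil [simp]: "u \<simeq> [] \<longleftrightarrow> u = []"
  using br_length by fastforce

lemma br_set: "u \<simeq> v \<Longrightarrow> set u = set v"
proof (induction rule: br.induct)
  case (br_step s t p q)
  then have "set (alt s t (m s t)) = set (alt t s (m s t))"
    using m_ge2 by (simp add: set_alt_ge2 insert_commute)
  then show ?case by simp
qed auto

lemma br_lists: "u \<simeq> v \<Longrightarrow> u \<in> lists T \<longleftrightarrow> v \<in> lists T"
  by (simp add: lists_eq_set br_set)

lemma br_rev: "u \<simeq> v \<Longrightarrow> rev u \<simeq> rev v"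
proof (induction rule: br.induct)
  case (br_step s t p q)
  then show ?case
    using br.br_step[of s t "rev q" "rev p"] br.br_step[of t s "rev q" "rev p"] m_sym[of s t]
    by (cases "even (m s t)") (simp_all add: rev_alt)
next
  case (br_trans u v w)
  then show ?case using br.br_trans by blast
qed simp

lemma red_ConsD:
  assumes "s # u \<in> lists S" "len (ev (s # u)) = length (s # u)"
  shows "s \<in> S" "u \<in> lists S" "len (ev u) = length u" "red (r s) (ev u)"
proof -
  show "s \<in> S" "u \<in> lists S" using assms(1) by auto
  then show "len (ev u) = length u" using reduced_appendD(2)[of "[s]" u] assms by simp
  then show "red (r s) (ev u)" using assms \<open>s \<in> S\<close> \<open>u \<in> lists S\<close> by (auto simp: red_def)
qed

text \<open>If the first letters differ, the common value has the full alternating word as a prefix.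
  Each word is compared, after removal of its first letter, with a word obtained from this prefix;
  one braid relation links the two.\<close>

theorem matsumoto:
  assumes "u \<in> lists S" "v \<in> lists S" "len (ev u) = length u" "len (ev v) = length v" "ev u = ev v"
  shows "u \<simeq> v"
  using assms
proof (induction "length u" arbitrary: u v rule: less_induct)
  case less
  have len: "length u = length v" using less.prems by simp
  show ?case
  proof (cases u)
    case Nil
    then show ?thesis using len by simp
  next
    case (Cons s u')
    then obtain t v' where v: "v = t # v'" using len by (cases v) auto
    note u' = red_ConsD[OF less.prems(1,3)[unfolded Cons]]
    note v' = red_ConsD[OF less.prems(2,4)[unfolded v]]
    show ?thesis
    proof (cases "s = t")
      case True
      then have "ev u' = ev v'" using less.prems(5) Cons v by simp
      then have "u' \<simeq> v'" using less.hyps[of u' v'] Cons u' v' by simp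
      then show ?thesis using Cons v True br_Cons by simp
    next
      case False
      obtain k where k: "m s t = Suc k" using m_ge2[OF u'(1) v'(1) False] by (cases "m s t") auto
      define w where "w = ev u"
      have "le (r s) w" "le (r t) w"
        using leI[OF u'(4)] leI[OF v'(4)] less.prems(5) Cons v by (auto simp: w_def)
      then have "le (ev (alt s t (m s t))) w" using le_alt u'(1) v'(1) False by blast
      then obtain y where y: "red (ev (alt s t (m s t))) y" "w = ev (alt s t (m s t)) * y" by (rule leE)
      obtain z where z: "z \<in> lists S" "ev z = y" "length z = len y" using reduced_word redD[OF y(1)] by blast
      have wlen: "len w = length u" "length u = m s t + length z"
        using less.prems y z redD[OF y(1)] len_alt[OF u'(1) v'(1) False] by (auto simp: w_def)
      have 1: "u' \<simeq> alt t s k @ z"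
      proof (rule less.hyps)
        have "r s * ev u' = r s * ev (alt t s k @ z)" using y(2) z k Cons by (simp add: w_def mult.assoc)
        then show "ev u' = ev (alt t s k @ z)" by simp
        then show "len (ev (alt t s k @ z)) = length (alt t s k @ z)" using u' wlen k Cons by simp
      qed (use Cons u' z alt_in_lists[OF v'(1) u'(1), of k] in auto)
      have 2: "alt s t k @ z \<simeq> v'"
      proof (rule less.hyps)
        have "r t * ev v' = r t * ev (alt s t k @ z)"
          using y(2)[unfolded ev_alt[OF u'(1) v'(1) False]] z k v less.prems(5)
          by (simp add: w_def mult.assoc)
        then show "ev (alt s t k @ z) = ev v'" by simp
        then show "len (ev (alt s t k @ z)) = length (alt s t k @ z)" using v' wlen k v len by simp
        show "length (alt s t k @ z) < length u" using wlen k by simp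
      qed (use v' z alt_in_lists[OF u'(1) v'(1), of k] in auto)
      have "u \<simeq> alt s t (m s t) @ z" using br_Cons[OF 1, of s] Cons k by simp
      also have "\<dots> \<simeq> alt t s (m s t) @ z" using br_step[of s t "[]" z] u'(1) v'(1) False by simp
      also have "\<dots> \<simeq> v" using br_Cons[OF 2, of t] v k by simp
      finally show ?thesis .
    qed
  qed
qed

text \<open>By \<open>matsumoto\<close> the chosen reduced word is unique up to
  \<open>\<simeq>\<close>.\<close>

definition lift :: "'w \<Rightarrow> 's list" where
  "lift w = (SOME u. u \<in> lists S \<and> ev u = w \<and> length u = len w)"

lemma lift:
  assumes "w \<in> W"
  shows "lift w \<in> lists S" "ev (lift w) = w" "length (lift w) = len w"
proof -
  have "\<exists>u. u \<in> lists S \<and> ev u = w \<and> length u = len w" using reduced_word[OF assms] by blast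
  from someI_ex[OF this, folded lift_def]
  show "lift w \<in> lists S" "ev (lift w) = w" "length (lift w) = len w" by blast+
qed

lemma lift_eqI: "u \<in> lists S \<Longrightarrow> len (ev u) = length u \<Longrightarrow> lift (ev u) \<simeq> u"
  using lift[of "ev u"] by (intro matsumoto) auto

lemma lift_one [simp]: "lift 1 = []"
  using lift(3)[of 1] by simp

lemma lift_red: "red x y \<Longrightarrow> lift (x * y) \<simeq> lift x @ lift y"
  using lift_eqI[of "lift x @ lift y"] lift[of x] lift[of y] redD[of x y] by simp

lemma lift_r: "s \<in> S \<Longrightarrow> lift (r s) \<simeq> [s]"
  using lift_eqI[of "[s]"] by simp

lemma lift_le: "le a x \<Longrightarrow> lift x \<simeq> lift a @ lift (inverse a * x)"
  using lift_red[of a "inverse a * x"] by (simp add: le_iff)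

lemma lift_parabolic:
  assumes "T \<subseteq> S" "w \<in> ev ` lists T" shows "lift w \<in> lists T"
proof -
  obtain v where v: "v \<in> lists T" "ev v = w" "length v = len w"
    using assms(2) reduced_subword[OF assms(1)] by blast
  then have "lift (ev v) \<simeq> v" using assms(1) by (intro lift_eqI) auto
  then show ?thesis using br_lists v by metis
qed

subsection \<open>Normal forms\<close>

text \<open>Left multiplication of a list of simple factors: \<open>w\<close> takes over all it can
  absorb from the first factor, and the remainder is passed down the list. A final remainder 1 is
  dropped, so that the length of the list is meaningful.\<close>

fun mul :: "'w \<Rightarrow> 'w list \<Rightarrow> 'w list" where
  "mul w [] = (if w = 1 then [] else [w])"
| "mul w (x # L) = w * cap w x # mul (inverse (cap w x) * x) L"

lemma cap_W:
  assumes "w \<in> W" "x \<in> W"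
  shows "cap w x \<in> W" "w * cap w x \<in> W" "inverse (cap w x) * x \<in> W"
  using cap[OF assms] redD assms by (auto dest: le_W)

lemma mul_W: "w \<in> W \<Longrightarrow> L \<in> lists W \<Longrightarrow> mul w L \<in> lists W"
proof (induction L arbitrary: w rule: list.induct)
  case (Cons x L)
  then show ?case using cap_W[of w x] by auto
qed auto

lemma mul_one [simp]: "L \<in> lists W \<Longrightarrow> mul 1 L = L"
proof (induction L rule: list.induct)
  case (Cons x L)
  then have "cap 1 x = x" by (intro cap_eqI) auto
  then show ?case using Cons by simp
qed simp

lemma length_mul: "length (mul w L) \<le> Suc (length L)"
  by (induction L arbitrary: w) auto

text \<open>The largest prefix of \<open>x\<close> that \<open>w\<close> can absorb after \<open>v\<close> has absorbed \<open>cap v x\<close> is the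
  largest prefix that \<open>w * v\<close> can absorb; hence the monoid acts on lists of simple elements.\<close>

lemma mul_mul:
  assumes "red w v" "L \<in> lists W"
  shows "mul w (mul v L) = mul (w * v) L"
  using assms
proof (induction L arbitrary: w v rule: list.induct)
  case Nil
  note W = redD[OF Nil(1)]
  have "cap w v = v" using Nil W by (intro cap_eqI) auto
  moreover have "w = 1" if "w * v = 1" "v = 1" using that by simp
  moreover have "v = 1" if "w * v = 1" using W that len_eq_0[of v] by simp
  ultimately show ?case by auto
next
  case (Cons x L)
  note W = redD[OF Cons.prems(1)]
  have xW: "x \<in> W" "L \<in> lists W" using Cons.prems by auto
  define a where "a = cap v x"
  define c where "c = cap w (v * a)"
  define e where "e = cap (w * v) x"
  note a = cap[OF W(2) xW(1), folded a_def]
  have vaW: "v * a \<in> W" using redD[OF a(2)] W by auto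
  note c = cap[OF W(1) vaW, folded c_def]
  note e = cap[OF mult_in_W[OF W(1,2)] xW(1), folded e_def]
  have red_ve: "red v e" "red w (v * e)" using red_assoc1[OF Cons.prems(1) e(2)] .
  have "le e a" using a(3)[OF e(1) red_ve(1)] .
  then have "le (v * e) (v * a)" using le_mult_left(2)[OF a(2)] by blast
  then have 1: "le (v * e) c" using c(3) red_ve(2) by blast
  have "le v c" using c(3)[OF leI[OF a(2)] Cons.prems(1)] .
  then obtain c' where c': "red v c'" "c = v * c'" by (rule leE)
  have "le c' a" using le_cancel_left[OF c'(1)] c(1) c'(2) by simp
  then have "le c' x" using a(1) le_trans by blast
  moreover have "red (w * v) c'" using red_assoc2(2)[OF c'(1)] c(2) c'(2) by simp
  ultimately have "le c' e" using e(3) by blast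
  then have "le c (v * e)" using le_mult_left(2)[OF red_ve(1)] c'(2) by simp
  then have c_eq: "c = v * e" using 1 le_antisym by blast
  define d where "d = inverse e * a"
  define b where "b = inverse a * x"
  have "red e d" using \<open>le e a\<close> by (simp add: le_iff d_def)
  moreover have "red a b" using a(1) by (simp add: le_iff b_def)
  moreover have "a = e * d" by (simp add: d_def)
  ultimately have "red d b" using red_assoc1(1) by blast
  have "mul w (mul v (x # L)) = w * c # mul (inverse c * (v * a)) (mul b L)"
    by (simp add: a_def b_def c_def)
  also have "inverse c * (v * a) = d" by (simp add: c_eq d_def mult.assoc)
  also have "mul d (mul b L) = mul (d * b) L" using Cons.IH[OF \<open>red d b\<close> xW(2)] .
  also have "d * b = inverse e * x" by (simp add: d_def b_def mult.assoc)
  finally have "mul w (mul v (x # L)) = w * c # mul (inverse e * x) L" .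
  moreover have "mul (w * v) (x # L) = w * v * e # mul (inverse e * x) L" by (simp add: e_def)
  ultimately show ?case by (simp only: c_eq mult.assoc)
qed

definition nfact :: "'s list \<Rightarrow> 'w list \<Rightarrow> 'w list" where
  "nfact u L = foldr (\<lambda>s. mul (r s)) u L"

definition nf :: "'s list \<Rightarrow> 'w list" where
  "nf u = nfact u []"

lemma nfact_simps [simp]:
  "nfact [] L = L" "nfact (s # u) L = mul (r s) (nfact u L)" "nfact (u @ v) L = nfact u (nfact v L)"
  by (simp_all add: nfact_def)

lemma nf_simps: "nf [] = []" "nf (s # u) = mul (r s) (nf u)" "nf (u @ v) = nfact u (nf v)"
  by (simp_all add: nf_def)

lemma nfact_W: "u \<in> lists S \<Longrightarrow> L \<in> lists W \<Longrightarrow> nfact u L \<in> lists W"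
proof (induction u rule: list.induct)
  case (Cons s u)
  then have "r s \<in> W" "nfact u L \<in> lists W" by auto
  then show ?case using mul_W by simp
qed simp

lemma nf_W: "u \<in> lists S \<Longrightarrow> nf u \<in> lists W"
  by (simp add: nf_def nfact_W)

text \<open>A reduced word acts through its value in \<open>W\<close>. Both sides of a braid
  relation are reduced with the same value, which makes \<open>nf\<close> invariant under
  \<open>\<simeq>\<close>.\<close>

lemma nfact_reduced:
  assumes "u \<in> lists S" "len (ev u) = length u" "L \<in> lists W"
  shows "nfact u L = mul (ev u) L"
  using assms(1,2)
proof (induction u rule: list.induct)
  case (Cons s u)
  note u = red_ConsD[OF Cons.prems]
  have "nfact (s # u) L = mul (r s) (mul (ev u) L)" using Cons u by simp
  also have "\<dots> = mul (ev (s # u)) L" using mul_mul[OF u(4) assms(3)] by simp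
  finally show ?case .
qed (use assms in simp)

lemma nf_br: "u \<simeq> v \<Longrightarrow> u \<in> lists S \<Longrightarrow> nf u = nf v"
proof (induction rule: br.induct)
  case (br_step s t p q)
  have q: "q \<in> lists S" using br_step by simp
  have "nfact (alt s t (m s t)) (nf q) = mul (ev (alt s t (m s t))) (nf q)"
    using br_step nf_W[OF q] by (intro nfact_reduced) (auto simp: len_alt alt_in_lists)
  also have "\<dots> = mul (ev (alt t s (m s t))) (nf q)" by (simp only: ev_alt[OF br_step.hyps(1-3)])
  also have "\<dots> = nfact (alt t s (m s t)) (nf q)"
    using br_step nf_W[OF q] len_alt[of t s "m t s"] m_sym[of s t]
    by (intro nfact_reduced[symmetric]) (auto simp: alt_in_lists)
  finally show ?case by (simp add: nf_simps)
next
  case (br_trans u v w)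
  then show ?case using br_lists by metis
qed simp

text \<open>Reads a list of simple factors back as a word; through \<open>wd_nf\<close>, it makes
  \<open>nf\<close> a complete invariant of \<open>\<simeq>\<close> on words over
  \<open>S\<close>.\<close>

definition wd :: "'w list \<Rightarrow> 's list" where
  "wd L = concat (map lift L)"

lemma wd_simps [simp]: "wd [] = []" "wd (x # L) = lift x @ wd L"
  by (simp_all add: wd_def)

lemma wd_lists: "L \<in> lists W \<Longrightarrow> wd L \<in> lists S"
proof (induction L rule: list.induct)
  case (Cons x L)
  then show ?case using lift(1)[of x] by simp
qed simp

lemma wd_mul: "w \<in> W \<Longrightarrow> L \<in> lists W \<Longrightarrow> wd (mul w L) \<simeq> lift w @ wd L"
proof (induction L arbitrary: w rule: list.induct)
  case (Cons x L)
  have x: "x \<in> W" "L \<in> lists W" using Cons.prems by auto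
  let ?a = "cap w x"
  note a = cap[OF Cons.prems(1) x(1)]
  have "wd (mul w (x # L)) \<simeq> lift (w * ?a) @ lift (inverse ?a * x) @ wd L"
    using Cons.IH[OF cap_W(3)[OF Cons.prems(1) x(1)] x(2)] by (simp add: br_append_left)
  also have "\<dots> \<simeq> (lift w @ lift ?a) @ lift (inverse ?a * x) @ wd L"
    using lift_red[OF a(2)] by (rule br_append_right)
  also have "\<dots> \<simeq> lift w @ (lift ?a @ lift (inverse ?a * x)) @ wd L" by simp
  also have "\<dots> \<simeq> lift w @ lift x @ wd L"
    using br_sym[OF lift_le[OF a(1)]] by (rule br_context)
  finally show ?case by simp
qed simp

lemma wd_nf: "u \<in> lists S \<Longrightarrow> wd (nf u) \<simeq> u"
proof (induction u rule: list.induct)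
  case (Cons s u)
  then have s: "s \<in> S" "u \<in> lists S" by auto
  have "wd (nf (s # u)) \<simeq> lift (r s) @ wd (nf u)"
    using wd_mul[OF r_in_W[OF s(1)] nf_W[OF s(2)]] by (simp add: nf_simps)
  also have "\<dots> \<simeq> [s] @ u" using br_append[OF lift_r[OF s(1)]] Cons s by blast
  finally show ?case by simp
qed (simp add: nf_simps)

text \<open>Up to \<open>\<simeq>\<close>, \<open>u\<close> depends only on \<open>s\<close> and the normal form of \<open>s # u\<close>; this is left
  cancellation.\<close>

lemma nf_tail:
  assumes "s \<in> S" "u \<in> lists S"
  obtains h K where "nf (s # u) = h # K" "le (r s) h" "K \<in> lists W" "u \<simeq> lift (r s * h) @ wd K"
proof (cases "nf u")
  case Nil
  then have "r s \<noteq> 1" using len_r[OF assms(1)] by fastforce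
  then have "nf (s # u) = [r s]" using Nil by (simp add: nf_simps)
  moreover have "u \<simeq> []" using br_sym[OF wd_nf[OF assms(2)]] Nil by simp
  then have "u \<simeq> lift (r s * r s) @ wd []" using assms by (simp add: r_sq)
  ultimately show ?thesis using that assms(1) by simp
next
  case (Cons x L)
  have x: "x \<in> W" "L \<in> lists W" using nf_W[OF assms(2)] Cons by auto
  have rs: "r s \<in> W" using assms by simp
  let ?a = "cap (r s) x" 
  let ?K = "mul (inverse ?a * x) L"
  note a = cap[OF rs x(1)]
  have "u \<simeq> lift x @ wd L" using br_sym[OF wd_nf[OF assms(2)]] Cons by simp
  also have "\<dots> \<simeq> (lift ?a @ lift (inverse ?a * x)) @ wd L"
    using lift_le[OF a(1)] by (rule br_append_right)
  also have "\<dots> = lift ?a @ lift (inverse ?a * x) @ wd L" by simp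
  also have "\<dots> \<simeq> lift ?a @ wd ?K"
    by (rule br_append_left[OF br_sym[OF wd_mul[OF cap_W(3)[OF rs x(1)] x(2)]]])
  finally have "u \<simeq> lift (r s * (r s * ?a)) @ wd ?K" using assms by simp
  moreover have "nf (s # u) = (r s * ?a) # ?K" using Cons by (simp add: nf_simps)
  moreover have "le (r s) (r s * ?a)" using leI a(2) .
  moreover have "?K \<in> lists W" using mul_W cap_W(3)[OF rs x(1)] x(2) by blast
  ultimately show ?thesis using that by blast
qed

lemma br_left_cancel_letter:
  assumes "s # u \<simeq> s # v" "s \<in> S" "u \<in> lists S"
  shows "u \<simeq> v"
proof -
  have v: "v \<in> lists S" using br_lists[OF assms(1), of S] assms by auto
  have nf_eq: "nf (s # u) = nf (s # v)" using nf_br[OF assms(1)] assms by simp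
  from nf_tail[OF assms(2,3)] obtain h K where
    h: "nf (s # u) = h # K" "u \<simeq> lift (r s * h) @ wd K" by blast
  from nf_tail[OF assms(2) v] obtain h' K' where
    h': "nf (s # v) = h' # K'" "v \<simeq> lift (r s * h') @ wd K'" by blast
  have "h' = h" "K' = K" using h(1) h'(1) nf_eq by auto
  then have "lift (r s * h) @ wd K \<simeq> v" using br_sym[OF h'(2)] by simp
  with h(2) show ?thesis by (rule br_trans)
qed

lemma br_left_cancel: "p @ u \<simeq> p @ v \<Longrightarrow> p \<in> lists S \<Longrightarrow> u \<in> lists S \<Longrightarrow> u \<simeq> v"
proof (induction p rule: list.induct)
  case (Cons s p)
  have p: "s \<in> S" "p \<in> lists S" using Cons.prems(2) by auto
  have "p @ u \<simeq> p @ v"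
    using br_left_cancel_letter[of s "p @ u" "p @ v"] Cons.prems p by simp
  then show ?case using Cons.IH Cons.prems(3) p(2) by blast
qed simp

lemma br_right_cancel: "u @ p \<simeq> v @ p \<Longrightarrow> p \<in> lists S \<Longrightarrow> u \<in> lists S \<Longrightarrow> u \<simeq> v"
proof -
  assume "u @ p \<simeq> v @ p" "p \<in> lists S" "u \<in> lists S"
  then have "rev u \<simeq> rev v"
    using br_left_cancel[OF _ rev_in_lists rev_in_lists, of p u "rev v"] br_rev[of "u @ p" "v @ p"]
    by simp
  from br_rev[OF this] show "u \<simeq> v" by simp
qed

section \<open>Canonical length\<close>

definition nfl :: "'s list \<Rightarrow> nat" where
  "nfl u = length (nf u)"

lemma nfl_br: "u \<simeq> v \<Longrightarrow> u \<in> lists S \<Longrightarrow> nfl u = nfl v"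
  by (simp add: nfl_def nf_br)

lemma nfl_lift: "w \<in> W \<Longrightarrow> u \<in> lists S \<Longrightarrow> nfl (lift w @ u) \<le> Suc (nfl u)"
  using lift[of w] by (simp add: nfl_def nf_simps nfact_reduced nf_W length_mul)

lemma nfl_wd: "L \<in> lists W \<Longrightarrow> nfl (wd L) \<le> length L"
proof (induction L rule: list.induct)
  case (Cons x L)
  then show ?case using nfl_lift[of x "wd L"] wd_lists[of L] by simp
qed (simp add: nfl_def nf_simps)

text \<open>By \<open>nf_tail\<close>, removing the first letter only shrinks the first simple
  factor, and what remains is a product of no more simple elements than before.\<close>

lemma nfl_suffix: "u \<in> lists S \<Longrightarrow> v \<in> lists S \<Longrightarrow> nfl v \<le> nfl (u @ v)"
proof (induction u rule: list.induct)
  case (Cons s u)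
  then have s: "s \<in> S" "u @ v \<in> lists S" by auto
  from nf_tail[OF this] obtain h K where
    h: "nf (s # u @ v) = h # K" "le (r s) h" "K \<in> lists W" "u @ v \<simeq> lift (r s * h) @ wd K" .
  have "nfl (u @ v) = nfl (lift (r s * h) @ wd K)" using nfl_br[OF h(4) s(2)] .
  also have "\<dots> \<le> Suc (nfl (wd K))"
    using s(1) le_W[OF h(2)] wd_lists[OF h(3)] by (intro nfl_lift) auto
  also have "\<dots> \<le> nfl (s # u @ v)" using nfl_wd[OF h(3)] h(1) by (simp add: nfl_def)
  finally show ?case using Cons by simp
qed simp

text \<open>Since \<open>cap (r s) (r s) = 1\<close>, equal letters never merge and every factor of
  the normal form stays a single letter.\<close>

lemma nfl_replicate: "s \<in> S \<Longrightarrow> nfl (replicate n s) = n"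
proof -
  assume s: "s \<in> S"
  have "cap (r s) (r s) = 1"
  proof (rule cap_eqI)
    fix b assume b: "le b (r s)" "red (r s) b"
    have "b \<noteq> r s" using b(2) s by (auto simp: red_def r_sq)
    then have "len b < len (r s)" using b(1) le_len_eq by (meson not_le)
    then have "b = 1" using s le_W(1)[OF b(1)] by (simp add: len_eq_0)
    then show "le b 1" by simp
  qed (use s in auto)
  then have "mul (r s) (r s # L) = r s # mul (r s) L" for L by simp
  moreover have "r s \<noteq> 1" using len_r[OF s] by fastforce
  ultimately have *: "mul (r s) (replicate k (r s)) = replicate (Suc k) (r s)" for k
    by (induction k) simp_all
  have "nf (replicate n s) = replicate n (r s)"
    by (induction n) (simp_all add: nf_simps * del: replicate.simps(2), simp_all add: nf_simps *)
  then show ?thesis by (simp add: nfl_def)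
qed

subsection \<open>Divisibility by a letter\<close>

definition dv :: "'s list \<Rightarrow> 's list \<Rightarrow> bool" where
  "dv u v \<longleftrightarrow> (\<exists>x\<in>lists S. v \<simeq> u @ x)"

lemma nf_lift_append:
  assumes "w \<in> W" "w \<noteq> 1" "u \<in> lists S" "v \<simeq> lift w @ u"
  obtains h K where "nf v = h # K" "le w h"
proof -
  have v: "v \<in> lists S" using assms lift(1) br_lists[OF assms(4), of S] by simp
  have "nf v = nf (lift w @ u)" using nf_br[OF assms(4) v] .
  also have "\<dots> = mul w (nf u)"
    using assms lift[of w] by (simp add: nf_simps nfact_reduced nf_W)
  finally have nf_v: "nf v = mul w (nf u)" .
  show ?thesis
  proof (cases "nf u")
    case Nil
    then show ?thesis using nf_v that[of w "[]"] assms by simp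
  next
    case (Cons x L)
    then have "x \<in> W" using nf_W[OF assms(3)] by auto
    then show ?thesis using nf_v Cons that leI[OF cap(2)[OF assms(1)]] by simp
  qed
qed

text \<open>The first factor of the normal form carries all letters that divide \<open>u\<close>, so
  divisibility by letters becomes a question about descents in the finite group.\<close>

lemma dv_letter:
  assumes "s \<in> S" "u \<in> lists S"
  shows "dv [s] u \<longleftrightarrow> (\<exists>h K. nf u = h # K \<and> le (r s) h)"
proof
  assume "dv [s] u"
  then obtain x where x: "x \<in> lists S" "u \<simeq> [s] @ x" by (auto simp: dv_def)
  moreover have "[s] @ x \<simeq> lift (r s) @ x" using br_sym[OF lift_r[OF assms(1)]] by (rule br_append_right)
  ultimately have "u \<simeq> lift (r s) @ x" using br_trans by blast
  moreover have "r s \<noteq> 1" using len_r[OF assms(1)] by fastforce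
  ultimately show "\<exists>h K. nf u = h # K \<and> le (r s) h"
    using nf_lift_append[of "r s" x u] x assms(1) by blast
next
  assume "\<exists>h K. nf u = h # K \<and> le (r s) h"
  then obtain h K where h: "nf u = h # K" "le (r s) h" by blast
  have K: "h \<in> W" "K \<in> lists W" using nf_W[OF assms(2)] h by auto
  have "u \<simeq> lift h @ wd K" using br_sym[OF wd_nf[OF assms(2)]] h by simp
  also have "\<dots> \<simeq> (lift (r s) @ lift (inverse (r s) * h)) @ wd K"
    using lift_le[OF h(2)] by (rule br_append_right)
  also have "\<dots> \<simeq> ([s] @ lift (inverse (r s) * h)) @ wd K"
    using lift_r[OF assms(1)] by (intro br_append_right)
  finally have "u \<simeq> [s] @ lift (r s * h) @ wd K" using assms by simp
  moreover have "lift (r s * h) @ wd K \<in> lists S"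
    using lift(1)[of "r s * h"] wd_lists[OF K(2)] K assms by auto
  ultimately show "dv [s] u" unfolding dv_def by blast
qed

lemma dv_alt:
  assumes "s \<in> S" "t \<in> S" "s \<noteq> t" "u \<in> lists S" "dv [s] u" "dv [t] u"
  shows "dv (alt s t (m s t)) u"
proof -
  obtain h K where h: "nf u = h # K" "le (r s) h" "le (r t) h"
    using assms(5,6) unfolding dv_letter[OF assms(1,4)] dv_letter[OF assms(2,4)] by auto
  have K: "h \<in> W" "K \<in> lists W" using nf_W[OF assms(4)] h by auto
  have le: "le (ev (alt s t (m s t))) h" using le_alt[OF assms(1-3) h(2,3)] by simp
  let ?y = "inverse (ev (alt s t (m s t))) * h"
  have yW: "?y \<in> W" using le by (auto simp: le_iff dest: redD)
  have "u \<simeq> lift h @ wd K" using br_sym[OF wd_nf[OF assms(4)]] h by simp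
  also have "\<dots> \<simeq> (lift (ev (alt s t (m s t))) @ lift ?y) @ wd K"
    using lift_le[OF le] by (rule br_append_right)
  also have "\<dots> \<simeq> (alt s t (m s t) @ lift ?y) @ wd K"
    using len_alt[OF assms(1-3) order_refl] alt_in_lists[OF assms(1,2)]
    by (intro br_append_right lift_eqI) simp_all
  finally have "u \<simeq> alt s t (m s t) @ lift ?y @ wd K" by simp
  moreover have "lift ?y @ wd K \<in> lists S" using lift(1)[OF yW] wd_lists[OF K(2)] by simp
  ultimately show ?thesis unfolding dv_def by blast
qed

end

section \<open>Garside elements of parabolic submonoids\<close>

definition pw :: "nat \<Rightarrow> 'a list \<Rightarrow> 'a list" where
  "pw n u = concat (replicate n u)"

lemma pw_simps [simp]: "pw 0 u = []" "pw (Suc n) u = u @ pw n u"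
  by (simp_all add: pw_def)

lemma pw_add: "pw (a + b) u = pw a u @ pw b u"
  by (induction a) auto

lemma pw_lists: "u \<in> lists T \<Longrightarrow> pw n u \<in> lists T"
  by (induction n) auto

lemma length_pw [simp]: "length (pw n u) = n * length u"
  by (induction n) auto

lemma in_lists_mono: "T \<subseteq> S \<Longrightarrow> u \<in> lists T \<Longrightarrow> u \<in> lists S"
  by auto

context coxeter_system
begin

definition D :: "'s set \<Rightarrow> 's list" where
  "D T = lift (longest T)"

context
  fixes T assumes T: "T \<subseteq> S"
begin

lemma D_lists: "D T \<in> lists T"
  unfolding D_def using lift_parabolic[OF T longest_max(1)[OF T]] .

lemma D_dvd:
  assumes "x \<in> ev ` lists T"
  shows "\<exists>v\<in>lists T. lift x @ v \<simeq> D T"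
proof -
  have "D T \<simeq> lift x @ lift (inverse x * longest T)"
    unfolding D_def using lift_le[OF le_longest[OF T assms]] .
  moreover from this have "lift (inverse x * longest T) \<in> lists T"
    using br_lists D_lists by fastforce
  ultimately show ?thesis using br_sym by blast
qed

lemma D_letter:
  assumes "t \<in> T"
  shows "\<exists>v\<in>lists T. t # v \<simeq> D T"
proof -
  obtain v where v: "v \<in> lists T" "lift (r t) @ v \<simeq> D T" using D_dvd[OF WT_closed(3)[OF T assms]] by blast
  have "[t] @ v \<simeq> lift (r t) @ v" using br_sym[OF lift_r] assms T by (intro br_append_right) blast
  then show ?thesis using v br_trans by fastforce
qed

lemma D_set: "set (D T) = T"
proof
  show "set (D T) \<subseteq> T" using D_lists by auto
  show "T \<subseteq> set (D T)"
  proof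
    fix t assume "t \<in> T"
    then obtain v where "t # v \<simeq> D T" using D_letter by blast
    from br_set[OF this] show "t \<in> set (D T)" by auto
  qed
qed

lemma D_conj:
  assumes "s \<in> T" "t \<in> T" "r s * longest T = longest T * r t"
  shows "s # D T \<simeq> D T @ [t]"
proof -
  define y where "y = r s * longest T"
  have S: "s \<in> S" "t \<in> S" using assms T by auto
  have yW: "y \<in> W" using S T by (auto simp: y_def)
  have "le (r s) (longest T)" using le_longest[OF T WT_closed(3)[OF T assms(1)]] .
  then have y: "red (r s) y" using S by (simp add: le_iff y_def)
  have w: "r s * y = longest T" using S by (simp add: y_def)
  have w': "y * r t = longest T" unfolding y_def assms(3) using S by (simp add: mult.assoc r_sq)
  have "red y (r t)" using redD[OF y] S yW by (simp add: red_def w w')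
  then have 2: "D T \<simeq> lift y @ lift (r t)" using lift_red[of y "r t"] by (simp add: D_def w')
  have "D T \<simeq> lift (r s) @ lift y" using lift_red[OF y] by (simp add: D_def w)
  then have 1: "D T \<simeq> [s] @ lift y" using br_append_right[OF lift_r[OF S(1)]] br_trans by blast
  have "lift y @ lift (r t) \<simeq> lift y @ [t]" using br_append_left[OF lift_r[OF S(2)]] .
  then have "D T \<simeq> lift y @ [t]" using 2 br_trans by blast
  then have "s # D T \<simeq> ([s] @ lift y) @ [t]" using br_Cons by simp
  also have "\<dots> \<simeq> D T @ [t]" using br_append_right[OF br_sym[OF 1]] .
  finally show ?thesis .
qed

lemma D_conj_ex:
  assumes "s \<in> T"
  shows "\<exists>t\<in>T. s # D T \<simeq> D T @ [t] \<and> t # D T \<simeq> D T @ [s]"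
proof -
  obtain t where t: "t \<in> T" "r s * longest T = longest T * r t" using longest_conj[OF T assms] by blast
  have "longest T * r t * longest T = r s * longest T * longest T" using t(2) by simp
  then have "longest T * r t * longest T = r s" using T by (simp add: mult.assoc)
  then have "longest T * (longest T * r t * longest T) = longest T * r s" using T by simp
  moreover have "longest T * (longest T * x) = x" for x using T by (simp flip: mult.assoc)
  ultimately have "r t * longest T = longest T * r s" by (simp add: mult.assoc)
  then show ?thesis using D_conj t assms by blast
qed

lemma D_move_right: "u \<in> lists T \<Longrightarrow> \<exists>u'\<in>lists T. u @ D T \<simeq> D T @ u'"
proof (induction u rule: list.induct)
  case (Cons s u)
  then obtain u' where u': "u' \<in> lists T" "u @ D T \<simeq> D T @ u'" by auto
  obtain t where t: "t \<in> T" "s # D T \<simeq> D T @ [t]" using D_conj_ex Cons.prems by auto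
  have "(s # u) @ D T \<simeq> (s # D T) @ u'" using br_Cons[OF u'(2)] by simp
  also have "\<dots> \<simeq> (D T @ [t]) @ u'" using br_append_right[OF t(2)] .
  finally show ?case using t u' by (intro bexI[of _ "t # u'"]) auto
qed (rule bexI[of _ "[]"], auto)

lemma D_move_left: "u \<in> lists T \<Longrightarrow> \<exists>u'\<in>lists T. D T @ u \<simeq> u' @ D T"
proof (induction u rule: list.induct)
  case (Cons s u)
  then obtain u' where u': "u' \<in> lists T" "D T @ u \<simeq> u' @ D T" by auto
  obtain t where t: "t \<in> T" "t # D T \<simeq> D T @ [s]" using D_conj_ex Cons.prems by auto
  have "D T @ s # u \<simeq> (t # D T) @ u" using br_append_right[OF br_sym[OF t(2)], of u] by simp
  also have "\<dots> \<simeq> (t # u') @ D T" using br_Cons[OF u'(2)] by simp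
  finally show ?case using t u' by (intro bexI[of _ "t # u'"]) auto
qed (rule bexI[of _ "[]"], auto)

lemma pw_move_right: "u \<in> lists T \<Longrightarrow> \<exists>u'\<in>lists T. u @ pw n (D T) \<simeq> pw n (D T) @ u'"
proof (induction n arbitrary: u)
  case (Suc n)
  obtain v where v: "v \<in> lists T" "u @ D T \<simeq> D T @ v" using D_move_right[OF Suc.prems] by blast
  obtain u' where u': "u' \<in> lists T" "v @ pw n (D T) \<simeq> pw n (D T) @ u'" using Suc.IH[OF v(1)] by blast
  have "u @ pw (Suc n) (D T) \<simeq> D T @ v @ pw n (D T)" using br_append_right[OF v(2)] by simp
  also have "\<dots> \<simeq> D T @ pw n (D T) @ u'" using br_append_left[OF u'(2)] .
  finally show ?case using u' by auto
qed auto

lemma pw_move_left: "u \<in> lists T \<Longrightarrow> \<exists>u'\<in>lists T. pw n (D T) @ u \<simeq> u' @ pw n (D T)"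
proof (induction n arbitrary: u)
  case (Suc n)
  obtain v where v: "v \<in> lists T" "pw n (D T) @ u \<simeq> v @ pw n (D T)" using Suc.IH[OF Suc.prems] by blast
  obtain u' where u': "u' \<in> lists T" "D T @ v \<simeq> u' @ D T" using D_move_left[OF v(1)] by blast
  have "pw (Suc n) (D T) @ u \<simeq> D T @ v @ pw n (D T)" using br_append_left[OF v(2)] by simp
  also have "\<dots> \<simeq> u' @ pw (Suc n) (D T)" using br_append_right[OF u'(2), of "pw n (D T)"] by simp
  finally show ?case using u' by auto
qed auto

lemma pw_D_lists: "pw n (D T) \<in> lists T" "pw n (D T) \<in> lists S"
  using pw_lists[OF D_lists] T by auto

text \<open>Moving \<open>x\<close> across the power of \<open>D T\<close> yields \<open>x'\<close>,
  and cancelling \<open>x\<close> on the right leaves a complement on the other side: left divisors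
  of the power are right divisors.\<close>

lemma pw_swap_left:
  assumes "u \<in> lists T" "x \<in> lists T" "u @ x \<simeq> pw n (D T)"
  shows "\<exists>x'\<in>lists T. x' @ u \<simeq> pw n (D T)"
proof -
  obtain x' where x': "x' \<in> lists T" "pw n (D T) @ x \<simeq> x' @ pw n (D T)"
    using pw_move_left assms(2) by blast
  have "(x' @ u) @ x \<simeq> x' @ pw n (D T)" using br_append_left[OF assms(3)] by simp
  also have "\<dots> \<simeq> pw n (D T) @ x" using br_sym[OF x'(2)] .
  finally have "x' @ u \<simeq> pw n (D T)"
    using assms(1,2) x'(1) T by (elim br_right_cancel) auto
  then show ?thesis using x'(1) by blast
qed

lemma nfl_pw: "nfl (pw n (D T)) \<le> n"
proof (induction n)
  case (Suc n)
  have "nfl (D T @ pw n (D T)) \<le> Suc (nfl (pw n (D T)))"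
    unfolding D_def using longest_W[OF T] pw_D_lists(2) unfolding D_def by (intro nfl_lift) auto
  then show ?case using Suc by simp
qed (simp add: nfl_def nf_simps)

text \<open>The prefix \<open>u\<close> is turned into a suffix by \<open>pw_swap_left\<close>, so
  that \<open>nfl_suffix\<close> applies. The prefix version \<open>nfl_prefix\<close> is deduced
  from this.\<close>

lemma nfl_dv:
  assumes "u \<in> lists T" "x \<in> lists T" "u @ x \<simeq> pw n (D T)"
  shows "nfl u \<le> n"
proof -
  obtain x' where x': "x' \<in> lists T" "x' @ u \<simeq> pw n (D T)" using pw_swap_left[OF assms] by blast
  have "nfl u \<le> nfl (x' @ u)" using x'(1) assms(1) T by (intro nfl_suffix) auto
  also have "\<dots> = nfl (pw n (D T))" using x'(1) assms(1) T by (intro nfl_br[OF x'(2)]) auto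
  finally show ?thesis using nfl_pw[of n] by simp
qed

text \<open>Each simple factor has a complement in \<open>D T\<close>; the complements are collected
  at the right end by moving them across powers of \<open>D T\<close>.\<close>

lemma wd_dv_pw:
  assumes "L \<in> lists W" "wd L \<in> lists T" "length L \<le> n"
  shows "\<exists>x\<in>lists T. wd L @ x \<simeq> pw n (D T)"
  using assms
proof (induction L arbitrary: n rule: list.induct)
  case Nil
  then show ?case using pw_D_lists(1)[of n] by auto
next
  case (Cons h L)
  obtain k where k: "n = Suc k" using Cons.prems(3) by (cases n) auto
  have h: "h \<in> W" "L \<in> lists W" "lift h \<in> lists T" "wd L \<in> lists T" "length L \<le> k"
    using Cons.prems k by auto
  have "h \<in> ev ` lists T" using lift(2)[OF h(1)] h(3) by (intro image_eqI[of _ _ "lift h"]) simp_all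
  then obtain z where z: "z \<in> lists T" "lift h @ z \<simeq> D T" using D_dvd by blast
  obtain x where x: "x \<in> lists T" "wd L @ x \<simeq> pw k (D T)" using Cons.IH h by blast
  obtain z' where z': "z' \<in> lists T" "z @ pw k (D T) \<simeq> pw k (D T) @ z'" using pw_move_right[OF z(1)] by blast
  have "wd (h # L) @ x @ z' \<simeq> lift h @ pw k (D T) @ z'"
    using br_append_left[OF br_append_right[OF x(2), of z'], of "lift h"] by simp
  also have "\<dots> \<simeq> lift h @ z @ pw k (D T)" using br_append_left[OF br_sym[OF z'(2)]] .
  also have "\<dots> \<simeq> pw n (D T)" using br_append_right[OF z(2), of "pw k (D T)"] k by simp
  finally show ?case using x(1) z'(1) by (intro bexI[of _ "x @ z'"]) simp_all
qed

lemma dv_pw: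
  assumes "u \<in> lists T" "nfl u \<le> n"
  shows "\<exists>x\<in>lists T. u @ x \<simeq> pw n (D T)"
proof -
  have uS: "u \<in> lists S" using assms(1) T by auto
  have "wd (nf u) \<in> lists T" using br_lists[OF wd_nf[OF uS]] assms(1) by simp
  then obtain x where x: "x \<in> lists T" "wd (nf u) @ x \<simeq> pw n (D T)"
    using wd_dv_pw[OF nf_W[OF uS] _ assms(2)[unfolded nfl_def]] by blast
  have "u @ x \<simeq> wd (nf u) @ x" using br_append_right[OF br_sym[OF wd_nf[OF uS]]] .
  then show ?thesis using x br_trans by blast
qed

end

lemma nfl_prefix:
  assumes "u \<in> lists S" "v \<in> lists S"
  shows "nfl u \<le> nfl (u @ v)"
proof -
  have "u @ v \<in> lists S" using assms by simp
  then obtain x where x: "x \<in> lists S" "(u @ v) @ x \<simeq> pw (nfl (u @ v)) (D S)"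
    using dv_pw[OF order_refl _ order_refl] by blast
  then show ?thesis using nfl_dv[of S u "v @ x"] assms by simp
qed

lemma D_sq_central: "u \<in> lists S \<Longrightarrow> u @ D S @ D S \<simeq> D S @ D S @ u"
proof (induction u rule: list.induct)
  case (Cons s u)
  obtain t where t: "t \<in> S" "s # D S \<simeq> D S @ [t]" "t # D S \<simeq> D S @ [s]"
    using D_conj_ex[of S s] Cons.prems by auto
  have "s # u @ D S @ D S \<simeq> (s # D S) @ D S @ u" using br_Cons Cons by simp
  also have "\<dots> \<simeq> (D S @ [t]) @ D S @ u" using br_append_right[OF t(2)] .
  also have "\<dots> = D S @ (t # D S) @ u" by simp
  also have "\<dots> \<simeq> D S @ (D S @ [s]) @ u" using br_context[OF t(3)] .
  finally show ?case by simp
qed simp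

subsection \<open>Ribbons\<close>

text \<open>The induction applies the claim to words shorter than \<open>w\<close> twice: for the braid relation of
  two different first letters, and for the rest of the word.\<close>

lemma parabolic_divisor:
  assumes T: "T \<subseteq> S" and g: "g \<in> lists S" "\<And>t. t \<in> T \<Longrightarrow> \<not> dv [t] g"
    and "w \<in> lists T" "z \<in> lists T" "dv z (w @ g)"
  shows "\<exists>w'\<in>lists T. w \<simeq> z @ w'"
  using assms(4-6)
proof (induction "length w" arbitrary: w z rule: less_induct)
  case less
  show ?case
  proof (cases z)
    case Nil
    then show ?thesis using less.prems(1) by auto
  next
    case (Cons s z1)
    then have s: "s \<in> T" "z1 \<in> lists T" "s \<in> S" using less.prems(2) T by auto
    obtain x where x: "x \<in> lists S" "w @ g \<simeq> s # z1 @ x" using less.prems(3) Cons by (auto simp: dv_def)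
    have z1S: "z1 @ x \<in> lists S" using s(2) T x(1) by auto
    have dv_s: "dv [s] (w @ g)" unfolding dv_def using x z1S by (intro bexI[of _ "z1 @ x"]) auto
    have "w \<noteq> []" using dv_s g(2)[OF s(1)] by auto
    then obtain t w1 where w: "w = t # w1" by (cases w) auto
    then have t: "t \<in> T" "w1 \<in> lists T" "t \<in> S" "w1 @ g \<in> lists S" using less.prems(1) T g(1) by auto
    show ?thesis
    proof (cases "s = t")
      case True
      then have "w1 @ g \<simeq> z1 @ x" using br_left_cancel_letter[of t "w1 @ g"] x(2) w t by simp
      then have "dv z1 (w1 @ g)" using x(1) by (auto simp: dv_def)
      then obtain w' where "w' \<in> lists T" "w1 \<simeq> z1 @ w'" using less.hyps[of w1 z1] w t(2) s(2) by auto
      then show ?thesis using br_Cons[of w1 "z1 @ w'" t] w Cons True by auto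
    next
      case False
      obtain k where k: "m t s = Suc k" using m_ge2[OF t(3) s(3)] False by (cases "m t s") auto
      have "dv [t] (w @ g)" unfolding dv_def using w t by (intro bexI[of _ "w1 @ g"]) auto
      moreover have "w @ g \<in> lists S" using w t by simp
      ultimately have "dv (alt t s (m t s)) (w @ g)" using dv_alt[OF t(3) s(3)] False dv_s by blast
      then obtain y where y: "y \<in> lists S" "t # w1 @ g \<simeq> t # alt s t k @ y"
        using w k by (auto simp: dv_def)
      then have "w1 @ g \<simeq> alt s t k @ y" using br_left_cancel_letter t by blast
      then have "dv (alt s t k) (w1 @ g)" using y(1) by (auto simp: dv_def)
      then obtain w2 where w2: "w2 \<in> lists T" "w1 \<simeq> alt s t k @ w2"
        using less.hyps[of w1 "alt s t k"] w t(2) alt_in_lists[OF s(1) t(1), of k] by auto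
      \<comment> \<open>The braid relation rewrites \<open>w\<close> with first letter
        \<open>s\<close>. The rest \<open>w3\<close> is as long as \<open>w1\<close>, so the
        induction hypothesis applies a second time.\<close>
      define w3 where "w3 = alt t s k @ w2"
      have w3: "w3 \<in> lists T" using w2(1) alt_in_lists[OF t(1) s(1), of k] by (simp add: w3_def)
      have len3: "length w3 = length w1" using br_length[OF w2(2)] by (simp add: w3_def)
      have "w \<simeq> alt t s (m t s) @ w2" using br_Cons[OF w2(2), of t] w k by simp
      also have "\<dots> \<simeq> alt s t (m t s) @ w2" using br_step[of t s "[]" w2] t(3) s(3) False by simp
      also have "\<dots> = s # w3" by (simp add: k w3_def)
      finally have ww3: "w \<simeq> s # w3" .
      have "s # w3 @ g \<simeq> s # z1 @ x"
        using br_trans[OF br_sym[OF br_append_right[OF ww3, of g]] x(2)] by simp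
      then have "w3 @ g \<simeq> z1 @ x" using br_left_cancel_letter[of s "w3 @ g"] s(3) w3 T g(1) by auto
      then have "dv z1 (w3 @ g)" using x(1) by (auto simp: dv_def)
      then obtain w' where w': "w' \<in> lists T" "w3 \<simeq> z1 @ w'"
        using less.hyps[of w3 z1] len3 w w3 s(2) by auto
      have "w \<simeq> z @ w'" using br_trans[OF ww3 br_Cons[OF w'(2)]] Cons by simp
      then show ?thesis using w'(1) by blast
    qed
  qed
qed

lemma len_1E:
  assumes "y \<in> W" "len y = 1"
  obtains t where "t \<in> S" "y = r t"
proof -
  obtain u where u: "u \<in> lists S" "ev u = y" "length u = len y" using reduced_word[OF assms(1)] .
  then obtain t where "u = [t]" using assms(2) by (cases u) auto
  then show thesis using that[of t] u by simp
qed

text \<open>A ribbon passes through its normal form: each simple factor conjugates a letter to a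
  letter. Hence multiplying by powers of the letter only thickens the factors.\<close>

lemma ribbon_nfl:
  assumes "h \<in> lists S" "t \<in> S" "t' \<in> S" "t # h \<simeq> h @ [t']" "\<not> dv [t] h" "nfl h \<le> n"
  shows "nfl (replicate n t @ h) \<le> n"
  using assms
proof (induction n arbitrary: h t)
  case 0
  then show ?case by simp
next
  case (Suc n)
  show ?case
  proof (cases "nf h")
    case Nil
    then have "h = []" using wd_nf[OF Suc.prems(1)] br_sym[of "[]" h] by simp
    then show ?thesis using nfl_replicate[OF Suc.prems(2), of "Suc n"] by simp
  next
    case (Cons h1 K)
    have h1: "h1 \<in> W" "K \<in> lists W" using nf_W[OF Suc.prems(1)] Cons by auto
    let ?K = "wd K"
    have KS: "?K \<in> lists S" using wd_lists h1(2) .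
    have lS: "lift h1 \<in> lists S" using lift(1) h1(1) .
    have h: "h \<simeq> lift h1 @ ?K" using br_sym[OF wd_nf[OF Suc.prems(1)]] Cons by simp
    have "\<not> le (r t) h1" using Suc.prems(5) dv_letter[OF Suc.prems(2,1)] Cons by auto
    then have red_t: "red (r t) h1" using not_le_r Suc.prems(2) h1(1) by blast
    have "cap (r t) h1 = h1" using red_t h1(1) by (intro cap_eqI) auto
    then have nf_th: "nf (t # h) = r t * h1 # K" using Cons h1 by (simp add: nf_simps)
    have "t # h \<simeq> lift h1 @ ?K @ [t']" using br_trans[OF Suc.prems(4) br_append_right[OF h, of "[t']"]] by simp
    \<comment> \<open>By the ribbon equation \<open>t # h\<close> also starts with
      \<open>lift h1\<close>, so \<open>h1\<close> is a prefix of the first factor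
      \<open>r t * h1\<close>; comparing lengths, the quotient is a letter
      \<open>t1\<close>.\<close>
    then have "le h1 (r t * h1)"
    proof (cases "h1 = 1")
      case False
      from nf_lift_append[OF h1(1) False _ \<open>t # h \<simeq> lift h1 @ ?K @ [t']\<close>] KS Suc.prems(3)
      obtain x L where "nf (t # h) = x # L" "le h1 x" by auto
      then show ?thesis using nf_th by simp
    qed (use Suc.prems(2) in simp)
    then obtain y where y: "red h1 y" "r t * h1 = h1 * y" by (rule leE)
    have "len y = 1" using redD(3)[OF y(1)] redD(3)[OF red_t] y(2) Suc.prems(2) by simp
    then obtain t1 where t1: "t1 \<in> S" "y = r t1" using len_1E redD(2)[OF y(1)] by blast
    have "[t] @ lift h1 \<simeq> lift (r t) @ lift h1"
      using br_append_right[OF br_sym[OF lift_r[OF Suc.prems(2)]]] .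
    also have "\<dots> \<simeq> lift (r t * h1)" using br_sym[OF lift_red[OF red_t]] .
    finally have tl: "t # lift h1 \<simeq> lift (r t * h1)" by simp
    also have "lift (r t * h1) \<simeq> lift h1 @ lift (r t1)" using lift_red[OF y(1)] y(2) t1(2) by simp
    also have "\<dots> \<simeq> lift h1 @ [t1]" using br_append_left[OF lift_r[OF t1(1)]] .
    finally have t_h1: "t # lift h1 \<simeq> lift h1 @ [t1]" .
    have "lift h1 @ (t1 # ?K) \<simeq> t # lift h1 @ ?K" using br_append_right[OF br_sym[OF t_h1], of ?K] by simp
    also have "\<dots> \<simeq> t # h" using br_Cons[OF br_sym[OF h]] .
    also have "\<dots> \<simeq> lift h1 @ (?K @ [t'])" by fact
    finally have ribbon: "t1 # ?K \<simeq> ?K @ [t']" using lS KS t1(1) by (elim br_left_cancel) auto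
    \<comment> \<open>If \<open>t1\<close> divided the rest, it would pass back through
      \<open>lift h1\<close> as \<open>t\<close>, and \<open>t\<close> would divide
      \<open>h\<close>.\<close>
    have "\<not> dv [t1] ?K"
    proof
      assume "dv [t1] ?K"
      then obtain x where x: "x \<in> lists S" "?K \<simeq> t1 # x" by (auto simp: dv_def)
      have "h \<simeq> (lift h1 @ [t1]) @ x" using br_trans[OF h br_append_left[OF x(2)]] by simp
      also have "\<dots> \<simeq> (t # lift h1) @ x" using br_append_right[OF br_sym[OF t_h1]] .
      finally have "h \<simeq> [t] @ lift h1 @ x" by simp
      moreover have "lift h1 @ x \<in> lists S" using lS x(1) by simp
      ultimately show False using Suc.prems(5) unfolding dv_def by blast
    qed
    moreover have "nfl ?K \<le> n" using nfl_wd[OF h1(2)] Suc.prems(6) Cons by (simp add: nfl_def)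
    ultimately have IH: "nfl (replicate n t1 @ ?K) \<le> n"
      using Suc.IH[OF KS t1(1) Suc.prems(3) ribbon] by blast
    have pass: "replicate k t @ lift h1 \<simeq> lift h1 @ replicate k t1" for k
    proof (induction k)
      case (Suc k)
      have "replicate (Suc k) t @ lift h1 \<simeq> (t # lift h1) @ replicate k t1" using br_Cons[OF Suc] by simp
      also have "\<dots> \<simeq> (lift h1 @ [t1]) @ replicate k t1" using br_append_right[OF t_h1] .
      finally show ?case by simp
    qed simp
    \<comment> \<open>One copy of \<open>t\<close> thickens the factor \<open>h1\<close> to
      \<open>r t * h1\<close>; the other \<open>n\<close> copies pass through it as powers of
      \<open>t1\<close> and meet the rest, where the induction hypothesis applies.\<close>
    have "replicate (Suc n) t @ h \<simeq> t # (replicate n t @ lift h1) @ ?K"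
      using br_append_left[OF h, of "replicate (Suc n) t"] by simp
    also have "\<dots> \<simeq> t # (lift h1 @ replicate n t1) @ ?K" using br_Cons[OF br_append_right[OF pass]] .
    also have "\<dots> = (t # lift h1) @ replicate n t1 @ ?K" by simp
    also have "\<dots> \<simeq> lift (r t * h1) @ replicate n t1 @ ?K" using br_append_right[OF tl] .
    finally have "nfl (replicate (Suc n) t @ h) = nfl (lift (r t * h1) @ replicate n t1 @ ?K)"
      using Suc.prems(1,2) by (intro nfl_br) auto
    also have "\<dots> \<le> Suc (nfl (replicate n t1 @ ?K))"
      using h1(1) Suc.prems(2) t1(1) KS by (intro nfl_lift) auto
    finally show ?thesis using IH by simp
  qed
qed

end

section \<open>The positive monoid embeds in the Artin-Tits group\<close>

context coxeter_system
begin

lemma r_inj: "s \<in> S \<Longrightarrow> t \<in> S \<Longrightarrow> r s = r t \<longleftrightarrow> s = t"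
proof
  assume st: "s \<in> S" "t \<in> S" "r s = r t"
  show "s = t"
  proof (rule ccontr)
    assume "s \<noteq> t"
    then have "len (ev (alt s t 2)) = 2" using len_alt m_ge2 st(1,2) by blast
    then show False using st by (simp add: numeral_2_eq_2 r_sq)
  qed
qed simp

section \<open>Conjugation by the Garside element\<close>

definition tau :: "'s \<Rightarrow> 's" where
  "tau s = (SOME t. t \<in> S \<and> r s * longest S = longest S * r t)"

lemma tau:
  assumes "s \<in> S"
  shows "tau s \<in> S" "r s * longest S = longest S * r (tau s)"
proof -
  have "\<exists>t. t \<in> S \<and> r s * longest S = longest S * r t" using longest_conj[of S s] assms by auto
  from someI_ex[OF this, folded tau_def]
  show "tau s \<in> S" "r s * longest S = longest S * r (tau s)" by blast+
qed

lemma longest_longest [simp]: "longest S * (longest S * x) = x"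
  by (simp flip: mult.assoc)

lemma r_tau:
  assumes "s \<in> S" shows "r (tau s) = longest S * r s * longest S"
proof -
  have "longest S * (r s * longest S) = longest S * longest S * r (tau s)"
    unfolding tau(2)[OF assms] by (simp add: mult.assoc)
  then show ?thesis by (simp add: mult.assoc)
qed

lemma tau_tau [simp]: "s \<in> S \<Longrightarrow> tau (tau s) = s"
  using r_inj[of "tau (tau s)" s] tau(1) by (simp add: r_tau mult.assoc)

lemma ev_tau: "u \<in> lists S \<Longrightarrow> ev (map tau u) = longest S * ev u * longest S"
  by (induction u rule: list.induct) (auto simp: r_tau mult.assoc)

lemma m_tau:
  assumes "s \<in> S" "t \<in> S" "s \<noteq> t"
  shows "m (tau s) (tau t) = m s t"
proof -
  have le: "m (tau a) (tau b) \<le> m a b" if "a \<in> S" "b \<in> S" "a \<noteq> b" for a b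
  proof (rule m_least)
    show "tau a \<noteq> tau b" using that tau_tau by metis
    have "ev (map tau (alt a b (m a b))) = ev (map tau (alt b a (m a b)))"
      using that unfolding ev_tau[OF alt_in_lists[OF that(1,2)]] ev_tau[OF alt_in_lists[OF that(2,1)]]
      by (simp only: ev_alt[OF that])
    then show "ev (alt (tau a) (tau b) (m a b)) = ev (alt (tau b) (tau a) (m a b))"
      by (simp add: map_alt)
    show "0 < m a b" using m_ge2[OF that] by simp
  qed (use that tau in auto)
  have "tau s \<noteq> tau t" using assms tau_tau by metis
  then have "m (tau (tau s)) (tau (tau t)) \<le> m (tau s) (tau t)" using le tau(1) assms by blast
  then show ?thesis using le[OF assms] assms by simp
qed

lemma map_tau_lists: "u \<in> lists S \<Longrightarrow> map tau u \<in> lists S"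
  using tau(1) by auto

lemma br_tau: "u \<simeq> v \<Longrightarrow> map tau u \<simeq> map tau v"
proof (induction rule: br.induct)
  case (br_step s t p q)
  have "tau s \<noteq> tau t" using br_step tau_tau by metis
  then show ?case
    using br.br_step[of "tau s" "tau t" "map tau p" "map tau q"] br_step tau(1)
    by (simp add: map_alt m_tau)
next
  case (br_trans u v w)
  then show ?case using br.br_trans by blast
qed simp

lemma D_tau_letter: "s \<in> S \<Longrightarrow> D S @ [s] \<simeq> tau s # D S"
  using D_conj[of S "tau s" s] tau(1) tau(2)[of "tau s"] br_sym by simp

lemma D_tau: "u \<in> lists S \<Longrightarrow> D S @ u \<simeq> map tau u @ D S"
proof (induction u rule: list.induct)
  case (Cons s u)
  have "D S @ s # u \<simeq> (tau s # D S) @ u"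
    using br_append_right[OF D_tau_letter[of s], of u] Cons.prems by simp
  also have "\<dots> \<simeq> map tau (s # u) @ D S" using br_Cons Cons by simp
  finally show ?case .
qed simp

abbreviation taun :: "nat \<Rightarrow> 's list \<Rightarrow> 's list" where
  "taun n \<equiv> map tau ^^ n"

lemma taun_lists: "u \<in> lists S \<Longrightarrow> taun n u \<in> lists S"
  by (induction n) (auto simp: tau(1))

lemma taun_append: "taun n (u @ v) = taun n u @ taun n v"
  by (induction n) auto

lemma taun_br: "u \<simeq> v \<Longrightarrow> taun n u \<simeq> taun n v"
  by (induction n) (auto intro: br_tau)

lemma taun_swap: "taun a (taun b u) = taun b (taun a u)"
  by (simp flip: funpow_add[unfolded comp_def fun_eq_iff, rule_format] add: add.commute)

lemma pw_tau: "u \<in> lists S \<Longrightarrow> pw n (D S) @ u \<simeq> taun n u @ pw n (D S)"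
proof (induction n)
  case (Suc n)
  have "pw (Suc n) (D S) @ u \<simeq> D S @ taun n u @ pw n (D S)" using br_append_left[OF Suc.IH[OF Suc.prems]] by simp
  also have "\<dots> \<simeq> taun (Suc n) u @ D S @ pw n (D S)"
    using br_append_right[OF D_tau[OF taun_lists[OF Suc.prems]]] by simp
  finally show ?case by simp
qed simp

lemma DS_lists: "D S \<in> lists S" "pw n (D S) \<in> lists S"
  using D_lists pw_D_lists by auto

lemma taun_D: "taun n (D S) \<simeq> D S"
proof (induction n)
  case (Suc n)
  have "map tau (D S) @ D S \<simeq> D S @ D S" using br_sym[OF D_tau[OF DS_lists(1)]] .
  then have "map tau (D S) \<simeq> D S" using DS_lists map_tau_lists by (elim br_right_cancel) auto
  then show ?case using br_trans[OF br_tau[OF Suc]] by simp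
qed simp

text \<open>The complement of \<open>s\<close> in the Garside element. In the group, the inverse of
  \<open>s\<close> is \<open>\<Delta>\<^sup>-\<^sup>1\<close> followed by \<open>star s\<close>,
  which is how inverse letters act on fractions.\<close>

definition star :: "'s \<Rightarrow> 's list" where
  "star s = (SOME v. v \<in> lists S \<and> v @ [s] \<simeq> D S)"

lemma star:
  assumes "s \<in> S"
  shows "star s \<in> lists S" "star s @ [s] \<simeq> D S" "tau s # star s \<simeq> D S"
proof -
  obtain v where "v \<in> lists S" "s # v \<simeq> D S" using D_letter[of S s] assms by auto
  then have "\<exists>v. v \<in> lists S \<and> v @ [s] \<simeq> D S"
    using pw_swap_left[of S "[s]" v 1] assms by auto
  from someI_ex[OF this, folded star_def]
  show star: "star s \<in> lists S" "star s @ [s] \<simeq> D S" by blast+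
  have "(tau s # star s) @ [s] \<simeq> tau s # D S" using br_Cons[OF star(2)] by simp
  also have "\<dots> \<simeq> D S @ [s]" using br_sym[OF D_tau_letter[OF assms]] .
  finally show "tau s # star s \<simeq> D S" using star(1) tau(1) assms by (elim br_right_cancel) auto
qed

text \<open>The pair \<open>(n, u)\<close> stands for the left fraction of \<open>u\<close> by the \<open>n\<close>-th power of the Garside
  element. Signed letters act on fractions from the left.\<close>

fun act :: "'s \<times> bool \<Rightarrow> nat \<times> 's list \<Rightarrow> nat \<times> 's list" where
  "act (s, True) (n, u) = (n, taun n [s] @ u)"
| "act (s, False) (n, u) = (Suc n, taun n (star s) @ u)"

text \<open>Equality of fractions by cross-multiplication, legitimate because the powers of
  \<open>D S\<close> commute.\<close>

definition eqv :: "nat \<times> 's list \<Rightarrow> nat \<times> 's list \<Rightarrow> bool" where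
  "eqv x y \<longleftrightarrow> snd x \<in> lists S \<and> snd y \<in> lists S \<and>
    pw (fst y) (D S) @ snd x \<simeq> pw (fst x) (D S) @ snd y"

lemma eqv_refl: "snd x \<in> lists S \<Longrightarrow> eqv x x"
  by (simp add: eqv_def)

lemma eqv_sym: "eqv x y \<Longrightarrow> eqv y x"
  by (auto simp: eqv_def intro: br_sym)

lemma pw_commute: "pw a u @ pw b u = pw b u @ pw a u"
  by (metis add.commute pw_add)

lemma eqv_trans: "eqv x y \<Longrightarrow> eqv y z \<Longrightarrow> eqv x z"
proof -
  assume xy: "eqv x y" and yz: "eqv y z"
  let ?p = "\<lambda>x. pw (fst x) (D S)"
  have swap: "?p a @ ?p b @ w = ?p b @ ?p a @ w" for a b :: "nat \<times> 's list" and w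
    using pw_commute[of "fst a" "D S" "fst b"] by (metis append.assoc)
  have "?p y @ ?p z @ snd x = ?p z @ ?p y @ snd x" by (rule swap)
  also have "\<dots> \<simeq> ?p z @ ?p x @ snd y" using xy by (auto simp: eqv_def intro: br_append_left)
  also have "\<dots> = ?p x @ ?p z @ snd y" by (rule swap)
  also have "\<dots> \<simeq> ?p x @ ?p y @ snd z" using yz by (auto simp: eqv_def intro: br_append_left)
  also have "\<dots> = ?p y @ ?p x @ snd z" by (rule swap)
  finally have "?p z @ snd x \<simeq> ?p x @ snd z"
    using DS_lists xy by (elim br_left_cancel) (auto simp: eqv_def)
  then show ?thesis using xy yz by (simp add: eqv_def)
qed

lemma pw_taun_commute:
  assumes "w \<in> lists S" "pw n' (D S) @ u \<simeq> pw n (D S) @ u'"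
  shows "pw n' (D S) @ taun n w @ u \<simeq> pw n (D S) @ taun n' w @ u'"
proof -
  have "pw n' (D S) @ taun n w @ u \<simeq> taun n' (taun n w) @ pw n' (D S) @ u"
    using br_append_right[OF pw_tau[OF taun_lists[OF assms(1)]]] by simp
  also have "\<dots> \<simeq> taun n (taun n' w) @ pw n (D S) @ u'"
    using br_append_left[OF assms(2)] taun_swap by simp
  also have "\<dots> \<simeq> pw n (D S) @ taun n' w @ u'"
    using br_append_right[OF br_sym[OF pw_tau[OF taun_lists[OF assms(1)]]]] by simp
  finally show ?thesis .
qed

lemma act_eqv:
  assumes "fst a \<in> S" "eqv x y"
  shows "eqv (act a x) (act a y)"
proof -
  obtain s b where a: "a = (s, b)" by (cases a)
  obtain n u n' u' where x: "x = (n, u)" and y: "y = (n', u')" by (cases x, cases y)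
  have s: "s \<in> S" "[s] \<in> lists S" using assms a by auto
  have u: "u \<in> lists S" "u' \<in> lists S" "pw n' (D S) @ u \<simeq> pw n (D S) @ u'"
    using assms(2) by (auto simp: eqv_def x y)
  show ?thesis
  proof (cases b)
    case True
    show ?thesis
      using pw_taun_commute[OF s(2) u(3)] taun_lists[OF s(2)] u
      by (simp add: a x y True eqv_def)
  next
    case False
    have "pw n' (D S) @ taun n (star s) @ u \<simeq> pw n (D S) @ taun n' (star s) @ u'"
      by (rule pw_taun_commute[OF star(1)[OF s(1)] u(3)])
    from br_append_left[OF this, of "D S"] show ?thesis
      using taun_lists[OF star(1)[OF s(1)]] u by (simp add: a x y False eqv_def)
  qed
qed

lemma foldr_act_eqv: "p \<in> words S \<Longrightarrow> eqv x y \<Longrightarrow> eqv (foldr act p x) (foldr act p y)"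
  by (induction p rule: list.induct) (auto intro!: act_eqv)

lemma foldr_act_lists:
  assumes "p \<in> words S" "snd x \<in> lists S"
  shows "snd (foldr act p x) \<in> lists S"
  using foldr_act_eqv[OF assms(1) eqv_refl[OF assms(2)]] by (simp add: eqv_def)

definition pos :: "'s list \<Rightarrow> 's word" where
  "pos u = map (\<lambda>s. (s, True)) u"

lemma pos_simps [simp]: "pos [] = []" "pos (s # u) = (s, True) # pos u" "pos (u @ v) = pos u @ pos v"
  by (simp_all add: pos_def)

lemma pos_words: "u \<in> lists S \<Longrightarrow> pos u \<in> words S"
  by (auto simp: pos_def)

lemma foldr_act_pos: "foldr act (pos u) (n, v) = (n, taun n u @ v)"
proof (induction u)
  case Nil
  have "taun n [] = []" by (induction n) auto
  then show ?case by simp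
next
  case (Cons s u)
  then show ?case using taun_append[of n "[s]" u] by simp
qed

lemma alt_word_pos: "alt_word a b n = pos (alt a b n)"
  by (simp add: pos_def alt_word_eq)

lemma star_eqv:
  assumes "s \<in> S" "u \<in> lists S" "w \<in> lists S" "w \<simeq> D S"
  shows "eqv (Suc n, taun n w @ u) (n, u)"
proof -
  have "taun n w \<simeq> D S" using br_trans[OF taun_br[OF assms(4)] taun_D] .
  then have "pw n (D S) @ taun n w @ u \<simeq> pw n (D S) @ D S @ u"
    by (intro br_append_left br_append_right)
  also have "pw n (D S) @ D S @ u = pw (Suc n) (D S) @ u"
    using pw_commute[of n "D S" 1] by (metis append.assoc append_Nil2 One_nat_def pw_simps)
  finally show ?thesis using taun_lists[OF assms(3)] assms by (simp add: eqv_def)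
qed

end

locale artin = coxeter_system S r m
  for S :: "'s set" and r :: "'s \<Rightarrow> 'w::group_mult" and m +
  fixes k :: "'s \<Rightarrow> 's \<Rightarrow> enat"
  assumes k_m: "s \<in> S \<Longrightarrow> t \<in> S \<Longrightarrow> s \<noteq> t \<Longrightarrow> k s t = enat (m s t)"
    and S_nonempty: "S \<noteq> {}"
begin

abbreviation cong where "cong \<equiv> pres_cong S (braid_relations S k)"

abbreviation A where "A \<equiv> artin_group S k"

abbreviation A_mult (infixl "\<cdot>" 70) where "x \<cdot> y \<equiv> x \<otimes>\<^bsub>A\<^esub> y"

lemma pres_cong_eqv:
  assumes "(u, v) \<in> cong" "snd x \<in> lists S"
  shows "eqv (foldr act u x) (foldr act v x)"
  using assms
proof (induction)
  case (refl w)
  then show ?case using foldr_act_lists eqv_refl by blast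
next
  case (sym v w)
  then show ?case using eqv_sym by blast
next
  case (trans u v w)
  then show ?case using eqv_trans by blast
next
  case (cancel p q s b)
  define y where "y = foldr act q x"
  obtain n u where nu: "y = (n, u)" by (cases y)
  have u: "u \<in> lists S" using foldr_act_lists[OF cancel.hyps(2) cancel.prems] nu y_def by simp
  have "eqv (foldr act [(s, b), (s, \<not> b)] y) y"
  proof (cases b)
    case True
    \<comment> \<open>The inverse letter acts first and raises the exponent, so \<open>s\<close> is
      twisted once more and the complement equation for \<open>tau s # star s\<close> is the one
      needed.\<close>
    have "taun (Suc n) [s] = taun n [tau s]" by (simp add: funpow_swap1)
    then have "taun (Suc n) [s] @ taun n (star s) = taun n (tau s # star s)"
      using taun_append[of n "[tau s]" "star s"] by simp
    then have "foldr act [(s, b), (s, \<not> b)] y = (Suc n, taun n (tau s # star s) @ u)"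
      by (simp add: True nu)
    moreover have "tau s # star s \<in> lists S" using star(1) tau(1) cancel.hyps(3) by simp
    ultimately show ?thesis using star_eqv[OF cancel.hyps(3) u _ star(3)] cancel.hyps(3) nu by metis
  next
    case False
    have "foldr act [(s, b), (s, \<not> b)] y = (Suc n, taun n (star s @ [s]) @ u)"
      by (simp add: False nu taun_append)
    moreover have "star s @ [s] \<in> lists S" using star(1) cancel.hyps(3) by simp
    ultimately show ?thesis using star_eqv[OF cancel.hyps(3) u _ star(2)] cancel.hyps(3) nu by metis
  qed
  from foldr_act_eqv[OF cancel.hyps(1) this] show ?case by (simp add: y_def)
next
  case (rel p q u v)
  define y where "y = foldr act q x"
  obtain n z where nz: "y = (n, z)" by (cases y)
  have z: "z \<in> lists S" using foldr_act_lists[OF rel.hyps(2) rel.prems] nz y_def by simp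
  from rel.hyps(5) obtain s t where st: "s \<in> S" "t \<in> S" "s \<noteq> t"
    "u = pos (alt s t (m s t))" "v = pos (alt t s (m s t))"
    unfolding braid_relations_def alt_word_pos using k_m by auto
  have "alt s t (m s t) \<simeq> alt t s (m s t)" using br_step[OF st(1-3), of "[]" "[]"] by simp
  then have "taun n (alt s t (m s t)) @ z \<simeq> taun n (alt t s (m s t)) @ z"
    by (intro br_append_right taun_br)
  moreover have "taun n (alt s t (m s t)) \<in> lists S" "taun n (alt t s (m s t)) \<in> lists S"
    using taun_lists[OF alt_in_lists[OF st(1,2)]] taun_lists[OF alt_in_lists[OF st(2,1)]] by simp_all
  ultimately have "eqv (foldr act u y) (foldr act v y)"
    using z unfolding st(4,5) nz foldr_act_pos by (simp add: eqv_def br_append_left)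
  from foldr_act_eqv[OF rel.hyps(1) this] show ?case by (simp add: y_def)
qed

section \<open>Positive words in the Artin-Tits group\<close>

definition cl :: "'s list \<Rightarrow> 's word set" where
  "cl u = cong `` {pos u}"

text \<open>Congruent positive words act alike on the trivial fraction \<open>(0, [])\<close>, and
  \<open>eqv (0, u) (0, v)\<close> amounts to \<open>u \<simeq> v\<close>.\<close>

theorem cl_eq_iff:
  assumes "u \<in> lists S" "v \<in> lists S"
  shows "cl u = cl v \<longleftrightarrow> u \<simeq> v"
proof
  assume "cl u = cl v"
  then have "(pos u, pos v) \<in> cong"
    unfolding cl_def using eq_equiv_class[OF _ equiv_pres_cong] pos_words assms(2) by blast
  from pres_cong_eqv[OF this, of "(0, [])"] show "u \<simeq> v"
    by (simp add: foldr_act_pos eqv_def)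
next
  assume "u \<simeq> v"
  then have "(pos u, pos v) \<in> cong" using assms(1)
  proof (induction rule: br.induct)
    case (br_refl u)
    then show ?case using pos_words pres_cong.refl by blast
  next
    case (br_step s t p q)
    have "(alt_word s t (m s t), alt_word t s (m s t)) \<in> braid_relations S k"
      using br_step k_m unfolding braid_relations_def by blast
    then show ?case
      using pres_cong.rel[of "pos p" S "pos q" "pos (alt s t (m s t))" "pos (alt t s (m s t))"]
        pos_words br_step alt_in_lists[of s S t] alt_in_lists[of t S s]
      by (simp add: alt_word_pos)
  next
    case (br_trans u v w)
    then show ?case using br_lists pres_cong.trans by metis
  qed
  then show "cl u = cl v" unfolding cl_def by (rule equiv_class_eq[OF equiv_pres_cong])
qed

sublocale A: group A
  unfolding artin_group_def by (rule group_presented_group)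

lemma cl_carrier [simp]: "u \<in> lists S \<Longrightarrow> cl u \<in> carrier A"
  using pos_words by (auto simp: artin_group_def presented_group_def cl_def intro: quotientI)

lemma cl_mult: "u \<in> lists S \<Longrightarrow> v \<in> lists S \<Longrightarrow> cl u \<cdot> cl v = cl (u @ v)"
  using presented_group_mult[OF pos_words pos_words] by (simp add: artin_group_def cl_def)

lemma cl_Nil: "cl [] = \<one>\<^bsub>A\<^esub>"
  by (simp add: artin_group_def presented_group_def cl_def)

lemma artin_gen_cl: "artin_gen S k s = cl [s]"
  by (simp add: artin_gen_def cl_def)

lemma artin_pos_cl: "artin_pos S k = cl ` lists S"
proof
  show "artin_pos S k \<subseteq> cl ` lists S"
  proof
    fix x assume "x \<in> artin_pos S k"
    then show "x \<in> cl ` lists S"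
    proof induction
      case one
      show ?case unfolding cl_Nil[symmetric] by (rule imageI) simp
    next
      case (gen s)
      then show ?case unfolding artin_gen_cl by (intro imageI) simp
    next
      case (mult x y)
      then obtain u v where uv: "u \<in> lists S" "v \<in> lists S" "x = cl u" "y = cl v" by blast
      then have "x \<cdot> y = cl (u @ v)" by (simp add: cl_mult)
      then show ?case using uv by (intro image_eqI[of _ _ "u @ v"]) simp_all
    qed
  qed
  have "cl u \<in> artin_pos S k" if "u \<in> lists S" for u
    using that
  proof (induction u rule: list.induct)
    case Nil
    show ?case unfolding cl_Nil by (rule artin_pos.one)
  next
    case (Cons s u)
    then have "cl (s # u) = artin_gen S k s \<cdot> cl u" unfolding artin_gen_cl by (simp add: cl_mult)
    then show ?case using Cons artin_pos.mult artin_pos.gen by fastforce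
  qed
  then show "cl ` lists S \<subseteq> artin_pos S k" by blast
qed

lemma divides_cl:
  assumes "u \<in> lists S" "v \<in> lists S"
  shows "cl u divides\<^bsub>artin_monoid S k\<^esub> cl v \<longleftrightarrow> dv u v"
proof -
  have "cl u divides\<^bsub>artin_monoid S k\<^esub> cl v \<longleftrightarrow> (\<exists>x\<in>lists S. cl v = cl u \<cdot> cl x)"
    by (simp add: factor_def artin_monoid_def artin_pos_cl)
  moreover have "cl v = cl u \<cdot> cl x \<longleftrightarrow> v \<simeq> u @ x" if "x \<in> lists S" for x
    using cl_eq_iff[of v "u @ x"] cl_mult[of u x] assms that by simp
  ultimately show ?thesis unfolding dv_def by blast
qed

text \<open>The first factor of the normal form has all letters as descents, hence the longest
  element as a prefix, hence equals it.\<close>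

lemma D_dv:
  assumes "e \<in> lists S" "\<And>s. s \<in> S \<Longrightarrow> dv [s] e"
  shows "dv (D S) e"
proof -
  obtain s where "s \<in> S" using S_nonempty by blast
  then obtain h K where nf: "nf e = h # K" using assms dv_letter by metis
  then have h: "h \<in> W" "K \<in> lists W" using nf_W[OF assms(1)] by auto
  have "le (r s) h" if "s \<in> S" for s
    using assms(2)[OF that] nf unfolding dv_letter[OF that assms(1)] by simp
  then have "le (longest S) h"
    using le_of_descents[OF order_refl h(1)] longest_max(1)[OF order_refl] by blast
  moreover have "len h \<le> len (longest S)"
    using longest_max(2)[OF order_refl] h(1) unfolding WS by blast
  ultimately have "h = longest S" using le_len_eq by metis
  then have "e \<simeq> D S @ wd K" using br_sym[OF wd_nf[OF assms(1)]] nf by (simp add: D_def)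
  then show ?thesis using wd_lists[OF h(2)] by (auto simp: dv_def)
qed

lemma dv_antisym:
  assumes "dv u v" "dv v u"
  shows "u \<simeq> v"
proof -
  obtain x y where xy: "v \<simeq> u @ x" "u \<simeq> v @ y" using assms by (auto simp: dv_def)
  then have "length y = 0" using br_length[OF xy(1)] br_length[OF xy(2)] by simp
  then show ?thesis using xy by simp
qed

lemma garside_cl: "garside S k = cl (D S)"
  unfolding garside_def
proof (rule the_equality)
  have D: "cl (D S) \<in> artin_pos S k" "D S \<in> lists S" using DS_lists artin_pos_cl by auto
  have div: "artin_gen S k s divides\<^bsub>artin_monoid S k\<^esub> cl u \<longleftrightarrow> dv [s] u"
    if "s \<in> S" "u \<in> lists S" for s u
    unfolding artin_gen_cl using divides_cl that by simp
  have letters: "dv [s] (D S)" if "s \<in> S" for s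
    using D_letter[OF order_refl that] br_sym unfolding dv_def by fastforce
  show *: "cl (D S) \<in> artin_pos S k \<and>
    (\<forall>s\<in>S. artin_gen S k s divides\<^bsub>artin_monoid S k\<^esub> cl (D S)) \<and>
    (\<forall>e\<in>artin_pos S k. (\<forall>s\<in>S. artin_gen S k s divides\<^bsub>artin_monoid S k\<^esub> e) \<longrightarrow>
       cl (D S) divides\<^bsub>artin_monoid S k\<^esub> e)"
    using D letters D_dv by (auto simp: div artin_pos_cl divides_cl simp del: in_lists_conv_set)
  fix d
  assume d: "d \<in> artin_pos S k \<and>
    (\<forall>s\<in>S. artin_gen S k s divides\<^bsub>artin_monoid S k\<^esub> d) \<and>
    (\<forall>e\<in>artin_pos S k. (\<forall>s\<in>S. artin_gen S k s divides\<^bsub>artin_monoid S k\<^esub> e) \<longrightarrow>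
       d divides\<^bsub>artin_monoid S k\<^esub> e)"
  then obtain u where u: "u \<in> lists S" "d = cl u" by (auto simp: artin_pos_cl)
  have "d divides\<^bsub>artin_monoid S k\<^esub> cl (D S)" "cl (D S) divides\<^bsub>artin_monoid S k\<^esub> d" using d * by blast+
  then have "u \<simeq> D S" using dv_antisym u D divides_cl by simp
  then show "d = cl (D S)" using u D cl_eq_iff by simp
qed

abbreviation \<Delta> where "\<Delta> \<equiv> cl (D S)"

lemma Delta_pow: "\<Delta> [^]\<^bsub>A\<^esub> n = cl (pw n (D S))"
proof (induction n)
  case (Suc n)
  have "pw (Suc n) (D S) = pw n (D S) @ D S" using pw_commute[of n "D S" 1] by simp
  then show ?case using Suc DS_lists by (simp add: cl_mult)
qed (simp add: cl_Nil)

lemma Delta_int_pow: "\<Delta> [^]\<^bsub>A\<^esub> (int n) = cl (pw n (D S))"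
  using Delta_pow by (simp add: int_pow_int)

section \<open>Infimum and supremum of positive elements\<close>

lemma D_nonempty: "D S \<noteq> []"
  using D_set[OF order_refl] S_nonempty by auto

lemma artin_inf_eq_0:
  assumes "u \<in> lists S" "\<not> dv (D S) u"
  shows "artin_inf S k (cl u) = 0"
  unfolding artin_inf_def garside_cl
proof (rule Greatest_equality)
  show "\<Delta> [^]\<^bsub>A\<^esub> (- 0 :: int) \<cdot> cl u \<in> artin_pos S k"
    using assms(1) DS_lists by (simp add: artin_pos_cl)
  fix j :: int
  assume "\<Delta> [^]\<^bsub>A\<^esub> (- j) \<cdot> cl u \<in> artin_pos S k"
  then obtain x where x: "x \<in> lists S" "\<Delta> [^]\<^bsub>A\<^esub> (- j) \<cdot> cl u = cl x" by (auto simp: artin_pos_cl)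
  show "j \<le> 0"
  proof (rule ccontr)
    assume "\<not> j \<le> 0"
    then obtain n where n: "j = int (Suc n)" using zero_less_imp_eq_int[of j] by (metis gr0_conv_Suc linorder_not_le)
    have "inv\<^bsub>A\<^esub> cl (pw (Suc n) (D S)) \<cdot> cl u = cl x"
      using x(2) DS_lists unfolding n by (simp only: A.int_pow_neg Delta_int_pow cl_carrier)
    then have "cl u = cl (pw (Suc n) (D S)) \<cdot> cl x"
      using A.inv_solve_left'[of "cl x" "cl (pw (Suc n) (D S))" "cl u"] x(1) assms(1) DS_lists by simp
    then have "cl u = cl (D S @ pw n (D S) @ x)" using x(1) DS_lists by (simp add: cl_mult)
    then have "u \<simeq> D S @ pw n (D S) @ x" using assms x(1) DS_lists cl_eq_iff by simp
    moreover have "pw n (D S) @ x \<in> lists S" using DS_lists x(1) by simp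
    ultimately show False using assms(2) unfolding dv_def by blast
  qed
qed

lemma artin_sup_eq:
  assumes "u \<in> lists S"
  shows "artin_sup S k (cl u) = int (nfl u)"
  unfolding artin_sup_def garside_cl
proof (rule Least_equality)
  obtain x where x: "x \<in> lists S" "u @ x \<simeq> pw (nfl u) (D S)" using dv_pw[OF order_refl assms order_refl] by blast
  have "cl u \<cdot> cl x = \<Delta> [^]\<^bsub>A\<^esub> int (nfl u)"
    using x assms DS_lists cl_eq_iff by (simp add: cl_mult Delta_int_pow)
  then have "inv\<^bsub>A\<^esub> cl u \<cdot> \<Delta> [^]\<^bsub>A\<^esub> int (nfl u) = cl x"
    using x(1) assms by (simp add: A.inv_solve_left' flip: \<open>cl u \<cdot> cl x = _\<close>)
  then show "inv\<^bsub>A\<^esub> cl u \<cdot> \<Delta> [^]\<^bsub>A\<^esub> int (nfl u) \<in> artin_pos S k"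
    using x(1) by (simp add: artin_pos_cl)
  fix j :: int
  assume "inv\<^bsub>A\<^esub> cl u \<cdot> \<Delta> [^]\<^bsub>A\<^esub> j \<in> artin_pos S k"
  then obtain y where y: "y \<in> lists S" "inv\<^bsub>A\<^esub> cl u \<cdot> \<Delta> [^]\<^bsub>A\<^esub> j = cl y" by (auto simp: artin_pos_cl)
  then have eq: "\<Delta> [^]\<^bsub>A\<^esub> j = cl (u @ y)"
    using A.inv_solve_left'[of "cl y" "cl u" "\<Delta> [^]\<^bsub>A\<^esub> j"] assms DS_lists by (simp add: cl_mult)
  show "int (nfl u) \<le> j"
  proof (cases "0 \<le> j")
    case True
    then obtain n where n: "j = int n" using nonneg_int_cases by blast
    have "cl (pw n (D S)) = cl (u @ y)" using eq unfolding n Delta_int_pow .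
    then have "u @ y \<simeq> pw n (D S)" using assms y(1) DS_lists cl_eq_iff br_sym by simp
    then show ?thesis using nfl_dv[OF order_refl assms y(1)] n by simp
  next
    \<comment> \<open>A negative exponent would make a positive word containing \<open>D S\<close>
      trivial.\<close>
    case False
    then obtain n where n: "j = - int (Suc n)" using not_le neg_int_cases by (metis Suc_pred)
    have "inv\<^bsub>A\<^esub> cl (pw (Suc n) (D S)) = cl (u @ y)"
      using eq DS_lists unfolding n by (simp only: A.int_pow_neg Delta_int_pow cl_carrier)
    then have "cl (pw (Suc n) (D S)) \<cdot> cl (u @ y) = cl []"
      using A.r_inv[OF cl_carrier[OF DS_lists(2)[of "Suc n"]]] by (simp only: cl_Nil)
    moreover have uy: "u @ y \<in> lists S" using assms y(1) by simp
    ultimately have "cl (pw (Suc n) (D S) @ u @ y) = cl []"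
      unfolding cl_mult[OF DS_lists(2) uy] by simp
    moreover have "pw (Suc n) (D S) @ u @ y \<in> lists S" using DS_lists(2)[of "Suc n"] uy by simp
    ultimately have "pw (Suc n) (D S) @ u @ y \<simeq> []" using cl_eq_iff[of _ "[]"] by blast
    then show ?thesis using D_nonempty by simp
  qed
qed

lemma D_dv_append: "u \<in> lists S \<Longrightarrow> v \<in> lists S \<Longrightarrow> dv (D S) u \<or> dv (D S) v \<Longrightarrow> dv (D S) (u @ v)"
proof (elim disjE)
  assume uv: "u \<in> lists S" "v \<in> lists S"
  show "dv (D S) (u @ v)" if "dv (D S) u"
  proof -
    obtain x where "x \<in> lists S" "u \<simeq> D S @ x" using \<open>dv (D S) u\<close> by (auto simp: dv_def)
    then show ?thesis using br_append_right[of u "D S @ x" v] uv unfolding dv_def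
      by (intro bexI[of _ "x @ v"]) auto
  qed
  show "dv (D S) (u @ v)" if "dv (D S) v"
  proof -
    obtain x where x: "x \<in> lists S" "v \<simeq> D S @ x" using \<open>dv (D S) v\<close> by (auto simp: dv_def)
    obtain u' where u': "u' \<in> lists S" "u @ D S \<simeq> D S @ u'" using D_move_right[OF order_refl uv(1)] by blast
    have "u @ v \<simeq> (u @ D S) @ x" using br_append_left[OF x(2)] by simp
    also have "\<dots> \<simeq> D S @ u' @ x" using br_append_right[OF u'(2), of x] by simp
    finally show ?thesis using x(1) u'(1) unfolding dv_def by (intro bexI[of _ "u' @ x"]) auto
  qed
qed

text \<open>As \<open>D S\<close> does not divide \<open>x @ y\<close>, it divides neither factor,
  and all three infima are 0. The missing inequality between the suprema is
  \<open>nfl_prefix\<close>.\<close>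

lemma absorbableI:
  assumes "x \<in> lists S" "y \<in> lists S" "\<not> dv (D S) (x @ y)" "nfl (x @ y) \<le> nfl x"
  shows "cl y \<in> X_abs S k"
proof -
  have xy: "x @ y \<in> lists S" using assms by simp
  have "\<not> dv (D S) x" "\<not> dv (D S) y" using D_dv_append assms by blast+
  then have "artin_inf S k (cl y) = 0" "artin_inf S k (cl x \<cdot> cl y) = artin_inf S k (cl x)"
    using assms xy by (simp_all add: artin_inf_eq_0 cl_mult)
  moreover have "artin_sup S k (cl x \<cdot> cl y) = artin_sup S k (cl x)"
    using nfl_prefix[OF assms(1,2)] assms xy by (simp only: artin_sup_eq cl_mult)
  ultimately show ?thesis using assms(1,2) cl_carrier unfolding X_abs_def absorbable_def by blast
qed

end

section \<open>Word norms\<close>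

definition norm_le :: "('a, 'b) monoid_scheme \<Rightarrow> 'a set \<Rightarrow> nat \<Rightarrow> 'a \<Rightarrow> bool" where
  "norm_le G X n g \<longleftrightarrow> (\<exists>ws. set ws \<subseteq> X \<union> m_inv G ` X \<and> length ws \<le> n \<and>
     foldr (\<otimes>\<^bsub>G\<^esub>) ws \<one>\<^bsub>G\<^esub> = g)"

context group
begin

lemma symmetrized_closed: "X \<subseteq> carrier G \<Longrightarrow> X \<union> m_inv G ` X \<subseteq> carrier G"
  by auto

lemma foldr_mult_closed: "set ws \<subseteq> carrier G \<Longrightarrow> foldr (\<otimes>) ws \<one> \<in> carrier G"
  by (induction ws) auto

lemma foldr_mult_append:
  "set vs \<subseteq> carrier G \<Longrightarrow> set ws \<subseteq> carrier G \<Longrightarrow>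
    foldr (\<otimes>) (vs @ ws) \<one> = foldr (\<otimes>) vs \<one> \<otimes> foldr (\<otimes>) ws \<one>"
proof (induction vs)
  case Nil
  then show ?case using foldr_mult_closed[of ws] by simp
next
  case (Cons v vs)
  then show ?case using foldr_mult_closed[of ws] foldr_mult_closed[of vs] by (simp add: m_assoc)
qed

lemma norm_le_one: "norm_le G X 0 \<one>"
  unfolding norm_le_def by (intro exI[of _ "[]"]) simp

lemma norm_le_base: "x \<in> X \<Longrightarrow> X \<subseteq> carrier G \<Longrightarrow> norm_le G X 1 x"
  unfolding norm_le_def by (intro exI[of _ "[x]"]) auto

lemma norm_le_mult:
  assumes "X \<subseteq> carrier G" "norm_le G X a g" "norm_le G X b h"
  shows "norm_le G X (a + b) (g \<otimes> h)"
proof -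
  obtain vs where vs: "set vs \<subseteq> X \<union> m_inv G ` X" "length vs \<le> a" "foldr (\<otimes>) vs \<one> = g"
    using assms(2) unfolding norm_le_def by blast
  obtain ws where ws: "set ws \<subseteq> X \<union> m_inv G ` X" "length ws \<le> b" "foldr (\<otimes>) ws \<one> = h"
    using assms(3) unfolding norm_le_def by blast
  have "foldr (\<otimes>) (vs @ ws) \<one> = g \<otimes> h"
    using foldr_mult_append[of vs ws] symmetrized_closed[OF assms(1)] vs ws by (metis order_trans)
  then show ?thesis unfolding norm_le_def using vs ws by (intro exI[of _ "vs @ ws"]) simp
qed

lemma norm_le_inv:
  assumes "X \<subseteq> carrier G" "norm_le G X a g"
  shows "norm_le G X a (inv g)"
proof -
  let ?Y = "X \<union> m_inv G ` X"
  obtain vs where vs: "set vs \<subseteq> ?Y" "length vs \<le> a" "foldr (\<otimes>) vs \<one> = g"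
    using assms(2) unfolding norm_le_def by blast
  have inv_Y: "inv y \<in> ?Y" if "y \<in> ?Y" for y
    using that assms(1) by auto
  have "foldr (\<otimes>) (map (m_inv G) (rev vs)) \<one> = inv (foldr (\<otimes>) vs \<one>)" if "set vs \<subseteq> ?Y" for vs
    using that
  proof (induction vs)
    case (Cons v vs)
    have c: "v \<in> carrier G" "set vs \<subseteq> carrier G" using Cons.prems symmetrized_closed[OF assms(1)] by auto
    then have c': "set (map (m_inv G) (rev vs)) \<subseteq> carrier G" by auto
    have "foldr (\<otimes>) (map (m_inv G) (rev (v # vs))) \<one> =
        foldr (\<otimes>) (map (m_inv G) (rev vs)) \<one> \<otimes> foldr (\<otimes>) [inv v] \<one>"
      using foldr_mult_append[OF c', of "[inv v]"] c(1) by simp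
    also have "\<dots> = inv (foldr (\<otimes>) (v # vs) \<one>)"
      using Cons c foldr_mult_closed[OF c(2)] by (simp add: inv_mult_group)
    finally show ?case .
  qed simp
  from this[OF vs(1)] have "foldr (\<otimes>) (map (m_inv G) (rev vs)) \<one> = inv g" using vs(3) by simp
  moreover have "set (map (m_inv G) (rev vs)) \<subseteq> ?Y" using vs(1) inv_Y by auto
  ultimately show ?thesis unfolding norm_le_def
    using vs(2) by (intro exI[of _ "map (m_inv G) (rev vs)"]) simp
qed

lemma gen_preceqI:
  assumes "X \<subseteq> carrier G" "\<And>y. y \<in> Y \<Longrightarrow> norm_le G X C y"
  shows "gen_preceq G X Y"
  unfolding gen_preceq_def
\<comment> \<open>\<open>Suc C\<close> instead of \<open>C\<close>: if no word over \<open>Y\<close>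
  exists, the distance on the right is \<open>\<infinity>\<close>, and its factor must not be
  0.\<close>
proof (intro exI[of _ "Suc C"] ballI)
  fix g h assume "g \<in> carrier G" "h \<in> carrier G"
  let ?L = "\<lambda>X. {enat (length ws) | ws. set ws \<subseteq> X \<union> m_inv G ` X \<and> foldr (\<otimes>) ws \<one> = inv g \<otimes> h}"
  show "word_dist G X g h \<le> enat (Suc C) * word_dist G Y g h"
  proof (cases "?L Y = {}")
    case True
    then have "word_dist G Y g h = \<infinity>" unfolding word_dist_def True by (simp add: Inf_enat_def)
    then show ?thesis by (simp add: zero_enat_def)
  next
    case False
    then have "word_dist G Y g h \<in> ?L Y"
      unfolding word_dist_def Inf_enat_def by (metis (mono_tags, lifting) LeastI ex_in_conv)
    then obtain ws where ws: "word_dist G Y g h = enat (length ws)"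
      "set ws \<subseteq> Y \<union> m_inv G ` Y" "foldr (\<otimes>) ws \<one> = inv g \<otimes> h" by blast
    have "norm_le G X C y" if "y \<in> Y \<union> m_inv G ` Y" for y
      using that assms norm_le_inv by blast
    then have "norm_le G X (C * length ws) (foldr (\<otimes>) ws \<one>)" using ws(2)
    proof (induction ws)
      case Nil
      then show ?case using norm_le_one by simp
    next
      case (Cons w ws)
      then have "norm_le G X (C + C * length ws) (w \<otimes> foldr (\<otimes>) ws \<one>)"
        using norm_le_mult[OF assms(1)] by simp
      then show ?case by simp
    qed
    then obtain vs where vs: "set vs \<subseteq> X \<union> m_inv G ` X" "length vs \<le> C * length ws"
      "foldr (\<otimes>) vs \<one> = inv g \<otimes> h" unfolding norm_le_def ws(3) by blast
    then have "word_dist G X g h \<le> enat (length vs)"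
      unfolding word_dist_def by (intro Inf_lower) blast
    also have "\<dots> \<le> enat (Suc C * length ws)" using vs(2) by simp
    finally show ?thesis unfolding ws(1) by simp
  qed
qed

lemma commute_inv:
  assumes "a \<in> carrier G" "b \<in> carrier G" "a \<otimes> b = b \<otimes> a"
  shows "a \<otimes> inv b = inv b \<otimes> a"
proof -
  have "inv b \<otimes> (a \<otimes> b) \<otimes> inv b = inv b \<otimes> a" using assms(1,2) by (simp add: m_assoc)
  moreover have "inv b \<otimes> (b \<otimes> a) \<otimes> inv b = a \<otimes> inv b" using assms(1,2) by (simp flip: m_assoc)
  ultimately show ?thesis using assms(3) by simp
qed

lemma normalizerD:
  assumes "P \<subseteq> carrier G" "g \<in> normalizer G P" "x \<in> P"
  shows "g \<in> carrier G" "g \<otimes> x \<otimes> inv g \<in> P"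
proof -
  have g: "g \<in> carrier G" "g <#\<^bsub>G\<^esub> P #> inv g = P"
    using assms(1,2) by (simp_all add: normalizer_def stabilizer_def)
  then show "g \<in> carrier G" by simp
  have "g \<otimes> x \<otimes> inv g \<in> g <#\<^bsub>G\<^esub> P #> inv g" using assms(3) by (auto simp: l_coset_def r_coset_def)
  then show "g \<otimes> x \<otimes> inv g \<in> P" using g by simp
qed

lemma normalizerI:
  assumes "P \<subseteq> carrier G" "g \<in> carrier G" "\<And>x. x \<in> P \<Longrightarrow> g \<otimes> x \<otimes> inv g \<in> P"
    "\<And>x. x \<in> P \<Longrightarrow> inv g \<otimes> x \<otimes> g \<in> P"
  shows "g \<in> normalizer G P"
proof -
  have "g <#\<^bsub>G\<^esub> P #> inv g = P"
  proof
    show "g <#\<^bsub>G\<^esub> P #> inv g \<subseteq> P" using assms(3) by (auto simp: l_coset_def r_coset_def)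
    show "P \<subseteq> g <#\<^bsub>G\<^esub> P #> inv g"
    proof
      fix x assume x: "x \<in> P"
      then have xc: "x \<in> carrier G" using assms(1) by blast
      have "g \<otimes> (inv g \<otimes> x \<otimes> g) \<otimes> inv g = x"
        using xc assms(2) by (simp add: m_assoc) (simp flip: m_assoc)
      then show "x \<in> g <#\<^bsub>G\<^esub> P #> inv g" using assms(4)[OF x] unfolding l_coset_def r_coset_def by force
    qed
  qed
  then show ?thesis using assms(1,2) by (simp add: normalizer_def stabilizer_def)
qed

end

section \<open>Bounded products of absorbable elements\<close>

context coxeter_system
begin

lemma dv_br: "u \<simeq> v \<Longrightarrow> dv x u \<Longrightarrow> dv x v"
  unfolding dv_def using br_sym br_trans by blast

lemma nfl_pw_append:
  assumes "u \<in> lists S"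
  shows "nfl (pw j (D S) @ u) \<le> j + nfl u"
proof (induction j)
  case (Suc j)
  have "nfl (D S @ pw j (D S) @ u) \<le> Suc (nfl (pw j (D S) @ u))"
    unfolding D_def using assms DS_lists(2)[of j, unfolded D_def] by (intro nfl_lift) auto
  then show ?case using Suc by simp
qed simp

lemma factor_letters:
  assumes "T \<subseteq> S" "g \<in> lists S"
  shows "\<exists>a\<in>lists T. \<exists>h\<in>lists S. g \<simeq> a @ h \<and> (\<forall>t\<in>T. \<not> dv [t] h)"
  using assms(2)
proof (induction "length g" arbitrary: g rule: less_induct)
  case less
  show ?case
  proof (cases "\<exists>t\<in>T. dv [t] g")
    case True
    then obtain t g1 where t: "t \<in> T" "g1 \<in> lists S" "g \<simeq> t # g1" by (auto simp: dv_def)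
    then have "length g1 < length g" using br_length[OF t(3)] by simp
    from less.hyps[OF this t(2)] obtain a h where a: "a \<in> lists T" "h \<in> lists S" "g1 \<simeq> a @ h"
      "\<forall>t\<in>T. \<not> dv [t] h" by blast
    have "g \<simeq> (t # a) @ h" using br_trans[OF t(3) br_Cons[OF a(3)]] by simp
    moreover have "t # a \<in> lists T" using t a by simp
    ultimately show ?thesis using a by blast
  next
    case False
    then show ?thesis using less.prems by (intro bexI[of _ "[]"] bexI[of _ g]) auto
  qed
qed

lemma factor_D:
  assumes "T \<subseteq> S" "T \<noteq> {}" "g \<in> lists T"
  shows "\<exists>j. \<exists>h\<in>lists T. g \<simeq> h @ pw j (D T) \<and> \<not> (\<exists>e\<in>lists T. h \<simeq> e @ D T)"
  using assms(3)
proof (induction "length g" arbitrary: g rule: less_induct)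
  case less
  show ?case
  proof (cases "\<exists>e\<in>lists T. g \<simeq> e @ D T")
    case True
    then obtain e where e: "e \<in> lists T" "g \<simeq> e @ D T" by blast
    have "D T \<noteq> []" using D_set[OF assms(1)] assms(2) by auto
    then have "length e < length g" using br_length[OF e(2)] by simp
    from less.hyps[OF this e(1)] obtain j h where h: "h \<in> lists T" "e \<simeq> h @ pw j (D T)"
      "\<not> (\<exists>e\<in>lists T. h \<simeq> e @ D T)" by blast
    have "g \<simeq> (h @ pw j (D T)) @ D T" using br_trans[OF e(2) br_append_right[OF h(2)]] .
    also have "\<dots> = h @ pw (Suc j) (D T)" using pw_commute[of j "D T" 1] by simp
    finally show ?thesis using h by blast
  next
    case False
    then show ?thesis using less.prems by (intro exI[of _ 0] bexI[of _ g]) auto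
  qed
qed

text \<open>Deduced from the factorization on the right: a factor \<open>D S\<close> of
  \<open>h'\<close> would move back across the power and divide \<open>h\<close> on the
  right.\<close>

lemma factor_D_left:
  assumes "S \<noteq> {}" "g \<in> lists S"
  shows "\<exists>j. \<exists>h\<in>lists S. g \<simeq> pw j (D S) @ h \<and> \<not> dv (D S) h"
proof -
  obtain j h where h: "h \<in> lists S" "g \<simeq> h @ pw j (D S)" "\<not> (\<exists>e\<in>lists S. h \<simeq> e @ D S)"
    using factor_D[OF order_refl assms] by blast
  obtain h' where h': "h' \<in> lists S" "h @ pw j (D S) \<simeq> pw j (D S) @ h'"
    using pw_move_right[OF order_refl h(1)] by blast
  have "\<not> dv (D S) h'"
  proof
    assume "dv (D S) h'"
    then obtain x where x: "x \<in> lists S" "h' \<simeq> D S @ x" by (auto simp: dv_def)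
    obtain x' where x': "x' \<in> lists S" "(D S @ pw j (D S)) @ x \<simeq> x' @ D S @ pw j (D S)"
      using pw_move_left[OF order_refl x(1), of "Suc j"] by auto
    have "h @ pw j (D S) \<simeq> pw j (D S) @ D S @ x" using br_trans[OF h'(2) br_append_left[OF x(2)]] .
    also have "\<dots> = (D S @ pw j (D S)) @ x" using pw_commute[of j "D S" 1] by (metis append.assoc append_Nil2 One_nat_def pw_simps)
    also have "\<dots> \<simeq> (x' @ D S) @ pw j (D S)" using x'(2) by simp
    finally have "h \<simeq> x' @ D S" using h(1) DS_lists by (elim br_right_cancel)
    then show False using h(3) x'(1) by blast
  qed
  then show ?thesis using br_trans[OF h(2) h'(2)] h'(1) by blast
qed

lemma replicate_lists: "s \<in> T \<Longrightarrow> replicate j s \<in> lists T"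
  by auto

lemma D_sq_pow_central: "u \<in> lists S \<Longrightarrow> u @ pw (2 * n) (D S) \<simeq> pw (2 * n) (D S) @ u"
proof (induction n)
  case (Suc n)
  have "u @ pw (2 * Suc n) (D S) = (u @ D S @ D S) @ pw (2 * n) (D S)" by simp
  also have "\<dots> \<simeq> (D S @ D S @ u) @ pw (2 * n) (D S)"
    using D_sq_central[OF Suc.prems] by (rule br_append_right)
  also have "\<dots> = (D S @ D S) @ u @ pw (2 * n) (D S)" by simp
  also have "\<dots> \<simeq> (D S @ D S) @ pw (2 * n) (D S) @ u" using Suc by (intro br_append_left) simp
  finally show ?case by simp
qed simp

end

locale artin_rank3 = artin S r m k
  for S :: "'s set" and r :: "'s \<Rightarrow> 'w::group_mult" and m k +
  assumes card_S: "3 \<le> card S"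
begin

lemma X_abs_carrier: "X_abs S k \<subseteq> carrier A"
  by (auto simp: X_abs_def absorbable_def)

abbreviation nl :: "nat \<Rightarrow> 's word set \<Rightarrow> bool" where
  "nl \<equiv> norm_le A (X_abs S k)"

lemmas nl_mult = A.norm_le_mult[OF X_abs_carrier]
lemmas nl_inv = A.norm_le_inv[OF X_abs_carrier]

lemma nl_base: "x \<in> X_abs S k \<Longrightarrow> nl 1 x"
  using A.norm_le_base X_abs_carrier by blast

lemma nl_append:
  "u \<in> lists S \<Longrightarrow> v \<in> lists S \<Longrightarrow> nl a (cl u) \<Longrightarrow> nl b (cl v) \<Longrightarrow> nl (a + b) (cl (u @ v))"
  using nl_mult by (simp flip: cl_mult)

lemma nl_br: "u \<in> lists S \<Longrightarrow> u \<simeq> v \<Longrightarrow> nl a (cl v) \<Longrightarrow> nl a (cl u)"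
  using cl_eq_iff[of u v] br_lists[of u v S] by simp

text \<open>In a proper parabolic submonoid, an element not divisible by the Garside element of the
  parabolic is absorbed by its complement in a power of that Garside element.\<close>

lemma abs_parabolic:
  assumes "T \<subset> S" "y \<in> lists T" "\<not> (\<exists>e\<in>lists T. y \<simeq> e @ D T)"
  shows "cl y \<in> X_abs S k"
proof -
  have TS: "T \<subseteq> S" using assms(1) by blast
  note inS = in_lists_mono[OF TS]
  let ?n = "nfl y"
  obtain x' where "x' \<in> lists T" "y @ x' \<simeq> pw ?n (D T)" using dv_pw[OF TS assms(2) order_refl] by blast
  then obtain x where x: "x \<in> lists T" "x @ y \<simeq> pw ?n (D T)"
    using pw_swap_left[OF TS assms(2)] by blast
  show ?thesis
  proof (rule absorbableI)
    show "x \<in> lists S" "y \<in> lists S" using x assms(2) inS by auto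
    \<comment> \<open>The support of \<open>x @ y\<close> lies in \<open>T\<close>, while that of
      \<open>D S\<close> is all of \<open>S\<close>.\<close>
    show "\<not> dv (D S) (x @ y)"
    proof
      assume "dv (D S) (x @ y)"
      then obtain z where "x @ y \<simeq> D S @ z" by (auto simp: dv_def)
      then have "S \<subseteq> set (x @ y)" using br_set D_set[OF order_refl] by fastforce
      then show False using x(1) assms(1,2) by auto
    qed
    have "nfl (x @ y) \<le> ?n" using nfl_br[OF x(2)] nfl_pw[OF TS] x assms(2) inS by simp
    \<comment> \<open>If \<open>x\<close> divided a smaller power of \<open>D T\<close>, cancelling
      \<open>x\<close> would leave \<open>D T\<close> at the end of \<open>y\<close>.\<close>
    moreover have "?n \<le> nfl x"
    proof (rule ccontr)
      assume "\<not> ?thesis"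
      then obtain j where j: "?n = Suc j" "nfl x \<le> j" by (cases ?n) auto
      obtain e where e: "e \<in> lists T" "x @ e \<simeq> pw j (D T)" using dv_pw[OF TS x(1) j(2)] by blast
      have "x @ e @ D T \<simeq> pw j (D T) @ D T" using br_append_right[OF e(2), of "D T"] by simp
      also have "\<dots> = pw ?n (D T)" using pw_commute[of j "D T" 1] j by simp
      also have "\<dots> \<simeq> x @ y" using br_sym[OF x(2)] .
      finally have "e @ D T \<simeq> y"
        using x(1) e(1) D_lists[OF TS] inS by (elim br_left_cancel) auto
      then show False using assms(3) e(1) br_sym by blast
    qed
    ultimately show "nfl (x @ y) \<le> nfl x" by simp
  qed
qed

section \<open>Powers of Garside elements\<close>

lemma small_pair:
  assumes "s \<in> S"
  obtains t where "t \<in> S" "t \<noteq> s" "{s, t} \<subset> S"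
proof -
  have "\<not> S \<subseteq> {s}" using card_mono[of "{s}" S] card_S by auto
  then obtain t where t: "t \<in> S" "t \<noteq> s" by blast
  have "card {s, t} \<le> 2" by (simp add: card_insert_if)
  then have "{s, t} \<noteq> S" using card_S by auto
  then show thesis using that t assms by blast
qed

lemma not_replicate_D:
  assumes "T \<subseteq> S" "t \<in> T" "t \<noteq> s"
  shows "\<not> replicate j s \<simeq> e @ D T"
proof
  assume "replicate j s \<simeq> e @ D T"
  from br_set[OF this] have "t \<in> set (replicate j s)" using D_set[OF assms(1)] assms(2) by auto
  then show False using assms(3) by auto
qed

lemma abs_replicate:
  assumes "s \<in> S"
  shows "cl (replicate j s) \<in> X_abs S k"
proof -
  obtain t where t: "t \<in> S" "t \<noteq> s" "{s, t} \<subset> S" using small_pair[OF assms] .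
  then show ?thesis
    using not_replicate_D[of "{s, t}" t s j] by (intro abs_parabolic[OF t(3)] replicate_lists) auto
qed

text \<open>The power is \<open>s\<^sup>j z\<close>. If \<open>z\<close> ended in
  \<open>D T\<close>, cancellation would make \<open>s\<^sup>j\<close> a divisor of the power with
  exponent j - 1, against its canonical length \<open>j\<close>. So both factors are
  absorbable.\<close>

lemma nl_pw_parabolic:
  assumes "T \<subset> S" "s \<in> T" "t \<in> T" "t \<noteq> s"
  shows "nl 2 (cl (pw j (D T)))"
proof -
  have TS: "T \<subseteq> S" and s: "s \<in> S" using assms(1,2) by auto
  note inS = in_lists_mono[OF TS]
  have rep: "replicate j s \<in> lists T" using replicate_lists assms(2) .
  have "nfl (replicate j s) \<le> j" using nfl_replicate[OF s] by simp
  then obtain z where z: "z \<in> lists T" "replicate j s @ z \<simeq> pw j (D T)" using dv_pw[OF TS rep] by blast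
  have "\<not> z \<simeq> e @ D T" if e: "e \<in> lists T" for e
  proof
    assume z_e: "z \<simeq> e @ D T"
    have 1: "replicate j s @ e @ D T \<simeq> pw j (D T)"
      using br_trans[OF br_append_left[OF br_sym[OF z_e]] z(2)] .
    show False
    proof (cases j)
      case 0
      then have "D T = []" using 1 by simp
      then show False using D_set[OF TS] assms(2) by auto
    next
      case (Suc i)
      have "pw j (D T) = pw i (D T) @ D T" using pw_commute[of i "D T" 1] Suc by simp
      then have "(replicate j s @ e) @ D T \<simeq> pw i (D T) @ D T" using 1 by simp
      then have "replicate j s @ e \<simeq> pw i (D T)"
        using rep e D_lists[OF TS] inS by (elim br_right_cancel) auto
      then have "j \<le> i" using nfl_dv[OF TS rep e] nfl_replicate[OF s] by simp
      then show False using Suc by simp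
    qed
  qed
  then have "nl 1 (cl z)" using abs_parabolic[OF assms(1) z(1)] nl_base by blast
  moreover have "nl 1 (cl (replicate j s))" using abs_replicate[OF s] nl_base by blast
  ultimately have "nl (1 + 1) (cl (replicate j s @ z))" using rep z(1) inS by (intro nl_append)
  then have "nl 2 (cl (replicate j s @ z))" by (simp add: numeral_2_eq_2)
  then show ?thesis using nl_br[OF pw_D_lists(2)[OF TS] br_sym[OF z(2)]] by blast
qed

text \<open>Let \<open>c s\<^sup>j\<close> be the power of \<open>D ?T\<close>. The product
  \<open>s\<^sup>j y\<close> is a right divisor of the power of \<open>D S\<close>, so its canonical
  length is at most \<open>j\<close>. If \<open>D S\<close> divided it, \<open>c\<close> would
  divide the power of \<open>D S\<close> with exponent j - 1, hence by \<open>dv_pw\<close> that of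
  \<open>D ?T\<close>, and \<open>s\<^sup>j\<close> would end in \<open>D ?T\<close>, which contains
  \<open>t\<close>.\<close>

lemma nl_pw_D: "nl 3 (cl (pw j (D S)))"
proof -
  obtain s where s: "s \<in> S" using S_nonempty by blast
  obtain t where t: "t \<in> S" "t \<noteq> s" "{s, t} \<subset> S" using small_pair[OF s] .
  let ?T = "{s, t}"
  let ?x = "replicate j s"
  have TS: "?T \<subseteq> S" using t by blast
  note inS = in_lists_mono[OF TS]
  have pS: "pw j (D ?T) \<in> lists S" using pw_D_lists(2)[OF TS] .
  obtain y where y: "y \<in> lists S" "pw j (D ?T) @ y \<simeq> pw j (D S)"
    using dv_pw[OF order_refl pS nfl_pw[OF TS]] by blast
  have x: "?x \<in> lists ?T" "?x \<in> lists S" "nfl ?x = j"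
    using replicate_lists[of s ?T] replicate_lists[OF s] nfl_replicate[OF s] by auto
  obtain c' where "c' \<in> lists ?T" "?x @ c' \<simeq> pw j (D ?T)" using dv_pw[OF TS x(1) eq_imp_le[OF x(3)]] by blast
  then obtain c where c: "c \<in> lists ?T" "c @ ?x \<simeq> pw j (D ?T)" using pw_swap_left[OF TS x(1)] by blast
  have cS: "c \<in> lists S" using inS c(1) .
  have cxy: "c @ ?x @ y \<simeq> pw j (D S)" using br_trans[OF br_append_right[OF c(2)] y(2)] by simp
  have "cl y \<in> X_abs S k"
  proof (rule absorbableI[OF x(2) y(1)])
    have "nfl (?x @ y) \<le> nfl (c @ ?x @ y)" using x y cS by (intro nfl_suffix) auto
    also have "\<dots> = nfl (pw j (D S))" using x y cS by (intro nfl_br[OF cxy]) auto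
    finally show "nfl (?x @ y) \<le> nfl ?x" using nfl_pw[OF order_refl, of j] x(3) by simp
    show "\<not> dv (D S) (?x @ y)"
    proof
      assume "dv (D S) (?x @ y)"
      then obtain z where z: "z \<in> lists S" "?x @ y \<simeq> D S @ z" by (auto simp: dv_def)
      obtain z' where z': "z' \<in> lists S" "D S @ z \<simeq> z' @ D S" using D_move_left[OF order_refl z(1)] by blast
      have 1: "(c @ z') @ D S \<simeq> pw j (D S)"
        using br_trans[OF br_append_left[OF br_sym[OF br_trans[OF z(2) z'(2)]]] cxy] by simp
      show False
      proof (cases j)
        case 0
        then show False using 1 D_nonempty by simp
      next
        case (Suc i)
        have "pw j (D S) = pw i (D S) @ D S" using pw_commute[of i "D S" 1] Suc by simp
        then have "(c @ z') @ D S \<simeq> pw i (D S) @ D S" using 1 by simp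
        then have "c @ z' \<simeq> pw i (D S)" using DS_lists(1) cS z'(1) by (elim br_right_cancel) simp_all
        then have "nfl c \<le> i" using nfl_dv[OF order_refl cS z'(1)] by blast
        then obtain e where e: "e \<in> lists ?T" "c @ e \<simeq> pw i (D ?T)" using dv_pw[OF TS c(1)] by blast
        have "c @ ?x \<simeq> pw i (D ?T) @ D ?T"
          using c(2) pw_commute[of i "D ?T" 1] Suc by simp
        also have "\<dots> \<simeq> c @ e @ D ?T" using br_append_right[OF br_sym[OF e(2)]] by simp
        finally have "?x \<simeq> e @ D ?T" using cS x(2) by (elim br_left_cancel)
        then show False using not_replicate_D[OF TS _ t(2)] by blast
      qed
    qed
  qed
  then have "nl 1 (cl y)" using nl_base by blast
  then have "nl (2 + 1) (cl (pw j (D ?T) @ y))"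
    using nl_pw_parabolic[OF t(3)] t(2) pS y(1) by (intro nl_append) auto
  then show ?thesis using nl_br[OF DS_lists(2) br_sym[OF y(2)]] by (simp add: numeral_3_eq_3)
qed

text \<open>\<open>T\<close> may be empty or a single letter, so it is enlarged to the complement of
  one letter, which has at least two elements. The bound is 1 for the part not ending in
  \<open>D ?T\<close> plus 2 for the power.\<close>

lemma nl_parabolic:
  assumes "T \<subset> S" "u \<in> lists T"
  shows "nl 3 (cl u)"
proof -
  obtain x where x: "x \<in> S" "x \<notin> T" using assms(1) by blast
  let ?T = "S - {x}"
  have T: "?T \<subset> S" "?T \<subseteq> S" "u \<in> lists ?T" using x assms by auto
  have "2 \<le> card ?T" using card_S x(1) finite_S by simp
  then have "\<not> card ?T \<le> Suc 0" by simp
  moreover have "finite ?T" using finite_S by simp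
  ultimately have "\<not> (\<forall>s\<in>?T. \<forall>t\<in>?T. s = t)" using card_le_Suc0_iff_eq[of ?T] by simp
  then obtain s t where st: "s \<in> ?T" "t \<in> ?T" "t \<noteq> s" by blast
  obtain j h where h: "h \<in> lists ?T" "u \<simeq> h @ pw j (D ?T)" "\<not> (\<exists>e\<in>lists ?T. h \<simeq> e @ D ?T)"
    using factor_D[OF T(2) _ T(3)] st(1) by blast
  have "nl 1 (cl h)" using abs_parabolic[OF T(1) h(1,3)] nl_base by blast
  then have "nl (1 + 2) (cl (h @ pw j (D ?T)))"
    using nl_pw_parabolic[OF T(1) st] in_lists_mono[OF T(2) h(1)] pw_D_lists(2)[OF T(2)] by (intro nl_append)
  then show ?thesis using nl_br[OF in_lists_mono[OF T(2,3)] h(2)] by (simp add: numeral_3_eq_3)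
qed

text \<open>Cancelling a first letter \<open>t\<close> preserves the ribbon equation, so all of them
  can be removed in turn.\<close>

lemma ribbon_factor:
  assumes "g \<in> lists S" "t \<in> S" "t' \<in> S" "t # g \<simeq> g @ [t']"
  shows "\<exists>j. \<exists>h\<in>lists S. g \<simeq> replicate j t @ h \<and> \<not> dv [t] h \<and> t # h \<simeq> h @ [t']"
  using assms(1,4)
proof (induction "length g" arbitrary: g rule: less_induct)
  case less
  show ?case
  proof (cases "dv [t] g")
    case True
    then obtain g1 where g1: "g1 \<in> lists S" "g \<simeq> t # g1" by (auto simp: dv_def)
    have "t # t # g1 \<simeq> t # g1 @ [t']"
      using br_trans[OF br_trans[OF br_Cons[OF br_sym[OF g1(2)]] less.prems(2)] br_append_right[OF g1(2)]] by simp
    then have "t # g1 \<simeq> g1 @ [t']" using br_left_cancel_letter assms(2) g1(1) by simp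
    moreover have "length g1 < length g" using br_length[OF g1(2)] by simp
    ultimately obtain j h where h: "h \<in> lists S" "g1 \<simeq> replicate j t @ h" "\<not> dv [t] h" "t # h \<simeq> h @ [t']"
      using less.hyps g1(1) by blast
    have "g \<simeq> replicate (Suc j) t @ h" using br_trans[OF g1(2) br_Cons[OF h(2)]] by simp
    then show ?thesis using h by blast
  next
    case False
    then show ?thesis using less.prems by (intro exI[of _ 0] bexI[of _ g]) auto
  qed
qed

lemma replicate_pass:
  assumes "t # w \<simeq> w @ [t2]"
  shows "replicate a t @ w \<simeq> w @ replicate a t2"
proof (induction a)
  case (Suc a)
  have "replicate (Suc a) t @ w \<simeq> (t # w) @ replicate a t2" using br_Cons[OF Suc] by simp
  also have "\<dots> \<simeq> (w @ [t2]) @ replicate a t2" using br_append_right[OF assms] .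
  finally show ?case by simp
qed simp

text \<open>The key step: with \<open>n\<close> the canonical length of a reduced ribbon \<open>h\<close>, multiplying \<open>h\<close> by
  \<open>t ^ n\<close> does not increase the canonical length. What remains after splitting off the power
  \<open>q\<close> of the Garside element, and then the powers of a letter, is absorbed by powers of that
  letter; comparing canonical lengths forces the exponent \<open>j\<close> to be \<open>n - j0\<close>.\<close>

lemma nl_ribbon:
  assumes "g \<in> lists S" "t \<in> S" "t' \<in> S" "t # g \<simeq> g @ [t']"
  shows "nl 6 (cl g)"
proof -
  obtain i h where h: "h \<in> lists S" "g \<simeq> replicate i t @ h" "\<not> dv [t] h" "t # h \<simeq> h @ [t']"
    using ribbon_factor[OF assms] by blast
  define n where "n = nfl h"
  have rep: "replicate a s \<in> lists S" if "s \<in> S" for a s using replicate_lists that .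
  have thS: "replicate n t @ h \<in> lists S" using rep[OF assms(2), of n] h(1) by simp
  have th: "nfl (replicate n t @ h) \<le> n"
    using ribbon_nfl[OF h(1) assms(2,3) h(4,3)] by (simp add: n_def)
  obtain j0 h' where h': "h' \<in> lists S" "replicate n t @ h \<simeq> pw j0 (D S) @ h'" "\<not> dv (D S) h'"
    using factor_D_left[OF S_nonempty thS] by blast
  define q where "q = pw j0 (D S)"
  have qS: "q \<in> lists S" using DS_lists by (simp add: q_def)
  obtain t2s where "t2s \<in> lists S" "[t] @ q \<simeq> q @ t2s"
    using pw_move_right[OF order_refl, of "[t]" j0] assms(2) by (auto simp: q_def)
  moreover from br_length[OF this(2)] obtain t2 where "t2s = [t2]" by (cases t2s) auto
  ultimately have t2: "t2 \<in> S" "t # q \<simeq> q @ [t2]" by auto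
  have h'q: "replicate n t @ h \<simeq> q @ h'" using h'(2) by (simp add: q_def)
  have "q @ (t2 # h') \<simeq> t # q @ h'" using br_append_right[OF br_sym[OF t2(2)], of h'] by simp
  also have "\<dots> \<simeq> t # replicate n t @ h" using br_Cons[OF br_sym[OF h'q]] .
  also have "\<dots> = replicate n t @ t # h" using replicate_append_same[of n t] by simp
  also have "\<dots> \<simeq> replicate n t @ h @ [t']" using br_append_left[OF h(4)] .
  also have "\<dots> \<simeq> q @ h' @ [t']" using br_append_right[OF h'q, of "[t']"] by simp
  finally have ribbon': "t2 # h' \<simeq> h' @ [t']" using qS t2(1) h'(1) by (elim br_left_cancel) auto
  \<comment> \<open>\<open>x\<close> completes the product to the \<open>n\<close>-th power of
    \<open>D S\<close>; cancelling \<open>q\<close> then bounds the canonical length of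
    \<open>h'\<close> by \<open>p = n - j0\<close>.\<close>
  obtain x where x: "x \<in> lists S" "(replicate n t @ h) @ x \<simeq> pw n (D S)"
    using dv_pw[OF order_refl thS th] by blast
  have qhx: "q @ h' @ x \<simeq> pw n (D S)" using br_trans[OF br_append_right[OF br_sym[OF h'q]] x(2)] by simp
  have "j0 * length (D S) + length (h' @ x) = n * length (D S)"
    using br_length[OF qhx] by (simp add: q_def)
  then have "j0 * length (D S) \<le> n * length (D S)" by linarith
  then have "j0 \<le> n" using D_nonempty by simp
  then obtain p where p: "n = j0 + p" using le_iff_add by blast
  have "q @ (h' @ x) \<simeq> q @ pw p (D S)" using qhx by (simp add: p pw_add q_def)
  then have "h' @ x \<simeq> pw p (D S)" using qS h'(1) x(1) by (elim br_left_cancel) simp_all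
  then have nfl_h': "nfl h' \<le> p" using nfl_dv[OF order_refl h'(1) x(1)] by blast
  obtain j h2 where h2: "h2 \<in> lists S" "h' \<simeq> replicate j t2 @ h2" "\<not> dv [t2] h2" "t2 # h2 \<simeq> h2 @ [t']"
    using ribbon_factor[OF h'(1) t2(1) assms(3) ribbon'] by blast
  have nfl_eq: "nfl h' = nfl (replicate j t2 @ h2)" using nfl_br[OF h2(2) h'(1)] .
  have "nfl h2 \<le> p" using nfl_suffix[OF rep[OF t2(1)] h2(1), of j] nfl_eq nfl_h' by simp
  then have abs_len: "nfl (replicate p t2 @ h2) \<le> p" using ribbon_nfl[OF h2(1) t2(1) assms(3) h2(4,3)] by blast
  have jp: "j \<le> p" using nfl_prefix[OF rep[OF t2(1)] h2(1), of j] nfl_eq nfl_h' nfl_replicate[OF t2(1), of j] by simp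
  \<comment> \<open>Cancelling \<open>t\<^sup>j\<close> leaves \<open>t\<^sup>l h = q h2\<close>.
    Canonical lengths after multiplication by \<open>t\<^sup>p\<close> give p + l \<le> n = j + l,
    which together with j \<le> p forces equality.\<close>
  define l where "l = n - j"
  have nl: "n = j + l" using jp p by (simp add: l_def)
  have "replicate j t @ replicate l t @ h \<simeq> q @ replicate j t2 @ h2"
    using br_trans[OF h'q br_append_left[OF h2(2)]] by (simp add: nl replicate_add)
  also have "\<dots> \<simeq> replicate j t @ q @ h2"
    using br_append_right[OF br_sym[OF replicate_pass[OF t2(2), of j]], of h2] by simp
  finally have lh: "replicate l t @ h \<simeq> q @ h2"
    using rep[OF assms(2)] h(1) by (elim br_left_cancel) auto
  have "replicate (p + l) t @ h \<simeq> replicate p t @ q @ h2"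
    using br_append_left[OF lh, of "replicate p t"] by (simp add: replicate_add)
  also have "\<dots> \<simeq> q @ replicate p t2 @ h2" using br_append_right[OF replicate_pass[OF t2(2), of p], of h2] by simp
  finally have eq: "replicate (p + l) t @ h \<simeq> q @ replicate p t2 @ h2" .
  have "p + l = nfl (replicate (p + l) t)" using nfl_replicate[OF assms(2)] by simp
  also have "\<dots> \<le> nfl (replicate (p + l) t @ h)" using nfl_prefix[OF rep[OF assms(2)] h(1)] .
  also have "\<dots> = nfl (q @ replicate p t2 @ h2)" using rep[OF assms(2), of "p + l"] h(1) by (intro nfl_br[OF eq]) simp
  also have "\<dots> \<le> j0 + nfl (replicate p t2 @ h2)"
    unfolding q_def using rep[OF t2(1), of p] h2(1) by (intro nfl_pw_append) simp
  also have "\<dots> \<le> n" using abs_len p by simp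
  finally have "j = p" using nl jp by simp
  have "cl h2 \<in> X_abs S k"
  proof (rule absorbableI[OF rep[OF t2(1), of p] h2(1)])
    show "\<not> dv (D S) (replicate p t2 @ h2)" using dv_br[OF br_sym[OF h2(2)]] h'(3) \<open>j = p\<close> by blast
    show "nfl (replicate p t2 @ h2) \<le> nfl (replicate p t2)" using abs_len nfl_replicate[OF t2(1)] by simp
  qed
  then have "nl (3 + 1) (cl (q @ h2))" using nl_pw_D nl_base qS h2(1) unfolding q_def by (intro nl_append) auto
  then have "nl (3 + 1) (cl (replicate l t @ h))"
    using rep[OF assms(2), of l] h(1) by (intro nl_br[OF _ lh]) auto
  moreover have rep1: "nl 1 (cl (replicate a t))" for a using abs_replicate[OF assms(2)] nl_base by blast
  \<comment> \<open>The cost of \<open>h\<close> is 1 for the inverse of \<open>t\<^sup>l\<close>, 3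
    for \<open>q\<close> and 1 for \<open>h2\<close>; the power \<open>t\<^sup>i\<close> split off
    at the start adds one more.\<close>
  ultimately have "nl (1 + (3 + 1)) (inv\<^bsub>A\<^esub> cl (replicate l t) \<cdot> cl (replicate l t @ h))"
    using nl_mult nl_inv by blast
  moreover have "inv\<^bsub>A\<^esub> cl (replicate l t) \<cdot> cl (replicate l t @ h) = cl h"
    using A.inv_solve_left'[of "cl h" "cl (replicate l t)"] rep[OF assms(2), of l] h(1) by (simp add: cl_mult)
  ultimately have "nl 5 (cl h)" by (simp add: eval_nat_numeral)
  then have "nl (1 + 5) (cl (replicate i t @ h))" using rep1 rep[OF assms(2)] h(1) by (intro nl_append)
  then show ?thesis using nl_br[OF assms(1) h(2)] by (simp add: eval_nat_numeral)
qed

subsection \<open>Normalizers of standard parabolic subgroups\<close>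

lemma gens_carrier: "T \<subseteq> S \<Longrightarrow> artin_gen S k ` T \<subseteq> carrier A"
  by (auto simp: artin_gen_cl)

lemma parabolic_subgroup: "T \<subseteq> S \<Longrightarrow> subgroup (std_parabolic S k T) A"
  unfolding std_parabolic_def using A.generate_is_subgroup[OF gens_carrier] .

lemma cl_parabolic: "T \<subseteq> S \<Longrightarrow> u \<in> lists T \<Longrightarrow> cl u \<in> std_parabolic S k T"
proof -
  assume T: "T \<subseteq> S" and u: "u \<in> lists T"
  show ?thesis using u
  proof (induction u rule: list.induct)
    case Nil
    show ?case unfolding cl_Nil std_parabolic_def by (rule generate.one)
  next
    case (Cons t u)
    then have tu: "t \<in> T" "u \<in> lists T" "cl u \<in> std_parabolic S k T" by auto
    have "cl [t] \<in> std_parabolic S k T"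
      unfolding std_parabolic_def using tu(1) artin_gen_cl by (metis generate.incl imageI)
    moreover have "cl (t # u) = cl [t] \<cdot> cl u" using tu T by (subst cl_mult) auto
    ultimately show ?case using tu(3) by (simp add: std_parabolic_def generate.eng)
  qed
qed

text \<open>Powers of \<open>D T\<close> suffice as denominators: \<open>D T\<close> is a left
  multiple of every letter of \<open>T\<close>, and its powers move past positive words over
  \<open>T\<close>.\<close>

lemma parabolic_fraction:
  assumes T: "T \<subseteq> S" and "x \<in> std_parabolic S k T"
  shows "\<exists>n. \<exists>u\<in>lists T. x = inv\<^bsub>A\<^esub> cl (pw n (D T)) \<cdot> cl u"
  using assms(2) unfolding std_parabolic_def
proof (induction rule: generate.induct)
  case one
  show ?case using A.inv_one by (intro exI[of _ 0] bexI[of _ "[]"]) (simp_all add: cl_Nil)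
next
  case (incl x)
  then obtain t where t: "t \<in> T" "x = cl [t]" by (auto simp: artin_gen_cl)
  then have "[t] \<in> lists T" "cl [t] \<in> carrier A" using T by auto
  then show ?case using t A.inv_one by (intro exI[of _ 0] bexI[of _ "[t]"]) (simp_all add: cl_Nil)
next
  case (inv x)
  then obtain t where t: "t \<in> T" "x = cl [t]" by (auto simp: artin_gen_cl)
  obtain v' where v': "v' \<in> lists T" "[t] @ v' \<simeq> pw 1 (D T)" using D_letter[OF T t(1)] by auto
  then obtain v where v: "v \<in> lists T" "v @ [t] \<simeq> pw 1 (D T)"
    using pw_swap_left[OF T _ v'(1,2)] t(1) by auto
  have S: "[t] \<in> lists S" "v \<in> lists S" "pw 1 (D T) \<in> lists S"
    using t(1) T in_lists_mono[OF T v(1)] pw_D_lists(2)[OF T, of 1] by (simp_all add: subsetD)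
  have "cl (pw 1 (D T)) = cl v \<cdot> cl [t]"
    using S v(2) by (metis cl_mult cl_eq_iff append_in_lists_conv)
  then have "inv\<^bsub>A\<^esub> x = inv\<^bsub>A\<^esub> cl (pw 1 (D T)) \<cdot> cl v"
    using S t(2) by (simp add: A.inv_mult_group A.m_assoc)
  then show ?case using v(1) by blast
next
  case (eng x y)
  obtain n u where x: "u \<in> lists T" "x = inv\<^bsub>A\<^esub> cl (pw n (D T)) \<cdot> cl u" using eng.IH(1) by blast
  obtain l v where y: "v \<in> lists T" "y = inv\<^bsub>A\<^esub> cl (pw l (D T)) \<cdot> cl v" using eng.IH(2) by blast
  \<comment> \<open>The denominator of \<open>y\<close> is moved to the left of \<open>u\<close>,
    which changes \<open>u\<close> to \<open>u'\<close>.\<close>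
  obtain u' where u': "u' \<in> lists T" "pw l (D T) @ u \<simeq> u' @ pw l (D T)" using pw_move_left[OF T x(1)] by blast
  note S = in_lists_mono[OF T x(1)] in_lists_mono[OF T y(1)] in_lists_mono[OF T u'(1)]
  note pS = pw_D_lists(2)[OF T]
  let ?n = "cl (pw n (D T))" and ?l = "cl (pw l (D T))"
  have c: "?n \<in> carrier A" "?l \<in> carrier A" "cl u \<in> carrier A" "cl v \<in> carrier A" "cl u' \<in> carrier A"
    using S pS by auto
  have swap: "?l \<cdot> cl u = cl u' \<cdot> ?l" using S pS u'(2) cl_eq_iff by (simp add: cl_mult)
  have "inv\<^bsub>A\<^esub> ?l \<cdot> cl u' = inv\<^bsub>A\<^esub> ?l \<cdot> (cl u' \<cdot> ?l) \<cdot> inv\<^bsub>A\<^esub> ?l"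
    using c by (simp add: A.m_assoc)
  also have "\<dots> = cl u \<cdot> inv\<^bsub>A\<^esub> ?l" unfolding swap[symmetric] using c by (simp flip: A.m_assoc)
  finally have "cl u \<cdot> inv\<^bsub>A\<^esub> ?l = inv\<^bsub>A\<^esub> ?l \<cdot> cl u'" by simp
  then have mid: "cl u \<cdot> (inv\<^bsub>A\<^esub> ?l \<cdot> z) = inv\<^bsub>A\<^esub> ?l \<cdot> (cl u' \<cdot> z)" if "z \<in> carrier A" for z
    using c that by (metis A.inv_closed A.m_assoc)
  have "x \<cdot> y = inv\<^bsub>A\<^esub> ?n \<cdot> (inv\<^bsub>A\<^esub> ?l \<cdot> (cl u' \<cdot> cl v))"
    unfolding x(2) y(2) using c by (simp add: A.m_assoc mid)
  also have "\<dots> = inv\<^bsub>A\<^esub> (?l \<cdot> ?n) \<cdot> (cl u' \<cdot> cl v)"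
    using c by (simp add: A.inv_mult_group A.m_assoc)
  also have "\<dots> = inv\<^bsub>A\<^esub> cl (pw (l + n) (D T)) \<cdot> cl (u' @ v)"
    using S pS by (simp add: cl_mult pw_add)
  finally show ?case using u'(1) y(1) by (intro exI[of _ "l + n"] bexI[of _ "u' @ v"]) simp_all
qed

lemma carrier_parabolic: "carrier A = std_parabolic S k S"
proof
  show "std_parabolic S k S \<subseteq> carrier A" using parabolic_subgroup[OF order_refl] by (rule subgroup.subset)
  show "carrier A \<subseteq> std_parabolic S k S"
  proof
    fix x assume "x \<in> carrier A"
    then have "x \<in> words S // cong" by (simp add: artin_group_def presented_group_def)
    then obtain w where w: "w \<in> words S" "x = cong `` {w}" by (rule quotientE)
    have "cong `` {w} \<in> std_parabolic S k S" using w(1)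
    proof (induction w rule: list.induct)
      case Nil
      have "cong `` {[]} = \<one>\<^bsub>A\<^esub>" by (simp add: artin_group_def presented_group_def)
      then show ?case by (simp add: std_parabolic_def generate.one)
    next
      case (Cons a w)
      obtain s b where a: "a = (s, b)" by (cases a)
      have s: "s \<in> S" "w \<in> words S" using Cons.prems a by auto
      have mult: "cong `` {(s, c) # v} = cong `` {[(s, c)]} \<cdot> cong `` {v}" if "v \<in> words S" for c v
        using presented_group_mult[of "[(s, c)]" S v] s that by (simp add: artin_group_def)
      have carr: "cong `` {[(s, c)]} \<in> carrier A" for c
        using s by (auto simp: artin_group_def presented_group_def intro!: quotientI)
      have pos: "cong `` {[(s, True)]} \<in> artin_gen S k ` S" using s by (auto simp: artin_gen_def)
      have "([(s, False), (s, True)], []) \<in> cong"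
        using pres_cong.cancel[of "[]" S "[]" s False] s by simp
      then have "cong `` {[(s, False), (s, True)]} = cong `` {[]}" by (rule equiv_class_eq[OF equiv_pres_cong])
      then have "cong `` {[(s, False)]} \<cdot> cong `` {[(s, True)]} = \<one>\<^bsub>A\<^esub>"
        using mult[of "[(s, True)]" False] s by (simp add: artin_group_def presented_group_def)
      then have neg: "cong `` {[(s, False)]} = inv\<^bsub>A\<^esub> (cong `` {[(s, True)]})"
        using A.inv_equality[OF _ carr carr] by metis
      have "cong `` {[(s, b)]} \<in> std_parabolic S k S"
        unfolding std_parabolic_def
        using generate.incl[OF pos, of A] generate.inv[OF pos, of A] neg by (cases b) simp_all
      moreover have "cong `` {w} \<in> std_parabolic S k S" using Cons s by blast
      ultimately show ?case unfolding a mult[OF s(2)] std_parabolic_def by (rule generate.eng)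
    qed
    then show "x \<in> std_parabolic S k S" using w by simp
  qed
qed

lemma Delta_even_central:
  assumes "x \<in> carrier A"
  shows "cl (pw (2 * n) (D S)) \<cdot> x = x \<cdot> cl (pw (2 * n) (D S))"
proof -
  obtain l u where u: "u \<in> lists S" "x = inv\<^bsub>A\<^esub> cl (pw l (D S)) \<cdot> cl u"
    using parabolic_fraction[OF order_refl] assms carrier_parabolic by blast
  let ?z = "cl (pw (2 * n) (D S))" and ?l = "cl (pw l (D S))"
  have c: "?z \<in> carrier A" "?l \<in> carrier A" "cl u \<in> carrier A" using DS_lists u(1) by auto
  have zu: "?z \<cdot> cl u = cl u \<cdot> ?z"
    using D_sq_pow_central[OF u(1), of n] cl_eq_iff DS_lists u(1) br_sym by (simp add: cl_mult)
  have "?z \<cdot> ?l = ?l \<cdot> ?z" using DS_lists pw_commute[of "2 * n" "D S" l] by (simp add: cl_mult)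
  then have zl: "?z \<cdot> inv\<^bsub>A\<^esub> ?l = inv\<^bsub>A\<^esub> ?l \<cdot> ?z" using A.commute_inv c by blast
  have "?z \<cdot> x = (?z \<cdot> inv\<^bsub>A\<^esub> ?l) \<cdot> cl u" using c u(2) by (simp add: A.m_assoc)
  also have "\<dots> = inv\<^bsub>A\<^esub> ?l \<cdot> (?z \<cdot> cl u)" using c by (simp add: zl A.m_assoc)
  also have "\<dots> = x \<cdot> ?z" using c u(2) by (simp add: zu A.m_assoc)
  finally show ?thesis .
qed

text \<open>A conjugate of a letter by such a \<open>g\<close> is positive, and has length 1 because the relations
  preserve length.\<close>

lemma reduced_normalizer_ribbon:
  assumes T: "T \<subseteq> S" and g: "g \<in> lists S" "\<And>t. t \<in> T \<Longrightarrow> \<not> dv [t] g" and "t \<in> T"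
    and conj: "cl g \<cdot> cl [t] \<cdot> inv\<^bsub>A\<^esub> cl g \<in> std_parabolic S k T"
  shows "\<exists>t'\<in>T. t' # g \<simeq> g @ [t]"
proof -
  obtain n w where w: "w \<in> lists T"
    "cl g \<cdot> cl [t] \<cdot> inv\<^bsub>A\<^esub> cl g = inv\<^bsub>A\<^esub> cl (pw n (D T)) \<cdot> cl w"
    using parabolic_fraction[OF T conj] by blast
  let ?v = "pw n (D T)"
  have S: "[t] \<in> lists S" "w \<in> lists S" "?v \<in> lists S" using assms(4) T w(1) pw_D_lists(2)[OF T] by auto
  have c: "cl [t] \<in> carrier A" "cl g \<in> carrier A" "cl w \<in> carrier A" "cl ?v \<in> carrier A" using S g(1) by auto
  have "cl g \<cdot> cl [t] = (cl g \<cdot> cl [t] \<cdot> inv\<^bsub>A\<^esub> cl g) \<cdot> cl g"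
    using c by (simp add: A.m_assoc)
  also have "\<dots> = inv\<^bsub>A\<^esub> cl ?v \<cdot> (cl w \<cdot> cl g)" unfolding w(2) using c by (simp add: A.m_assoc)
  finally have "cl ?v \<cdot> (cl g \<cdot> cl [t]) = cl w \<cdot> cl g"
    using c by (simp flip: A.m_assoc)
  then have "w @ g \<simeq> ?v @ g @ [t]" using S g(1) cl_eq_iff br_sym by (simp add: cl_mult)
  moreover have gt: "g @ [t] \<in> lists S" using S g(1) by simp
  ultimately have wg: "w @ g \<simeq> ?v @ g @ [t]" "dv ?v (w @ g)" unfolding dv_def by blast+
  \<comment> \<open>No letter of \<open>T\<close> divides \<open>g\<close>, so the denominator, a
    divisor of \<open>w @ g\<close>, already divides \<open>w\<close> and cancels.\<close>
  then obtain w' where w': "w' \<in> lists T" "w \<simeq> ?v @ w'"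
    using parabolic_divisor[OF T g w(1) pw_D_lists(1)[OF T]] by blast
  have "?v @ w' @ g \<simeq> ?v @ g @ [t]"
    using br_trans[OF br_append_right[OF br_sym[OF w'(2)]] wg(1)] by simp
  then have eq: "w' @ g \<simeq> g @ [t]" using S g(1) in_lists_mono[OF T w'(1)] by (elim br_left_cancel) auto
  then have "length w' = 1" using br_length by fastforce
  then obtain t' where "w' = [t']" by (cases w') auto
  then show ?thesis using w'(1) eq by auto
qed

text \<open>\<open>g\<close> is made positive by the even power \<open>?z\<close>, whose centrality
  leaves conjugation by \<open>g\<close> unchanged. The bound is 3 for the inverse of
  \<open>?z\<close>, 3 for the factor \<open>a\<close> and 6 for the ribbon
  \<open>g0\<close>.\<close>

lemma nl_normalizer:
  assumes "T \<subset> S" "T \<noteq> {}" "g \<in> normalizer A (std_parabolic S k T)"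
  shows "nl 12 g"
proof -
  let ?P = "std_parabolic S k T"
  have T: "T \<subseteq> S" using assms(1) by blast
  note sub = parabolic_subgroup[OF T]
  note PA = subgroup.subset[OF sub]
  obtain t where t: "t \<in> T" using assms(2) by blast
  then have tP: "cl [t] \<in> ?P" using cl_parabolic[OF T, of "[t]"] by simp
  have gA: "g \<in> carrier A" and gP: "g \<cdot> x \<cdot> inv\<^bsub>A\<^esub> g \<in> ?P" if "x \<in> ?P" for x
    using A.normalizerD[OF PA assms(3)] that tP by auto
  note gA = gA[OF tP]
  obtain n u where u: "u \<in> lists S" "g = inv\<^bsub>A\<^esub> cl (pw n (D S)) \<cdot> cl u"
    using parabolic_fraction[OF order_refl] gA carrier_parabolic by blast
  define p where "p = pw n (D S) @ u"
  let ?z = "cl (pw (2 * n) (D S))" and ?n = "cl (pw n (D S))"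
  have pS: "p \<in> lists S" using u(1) DS_lists by (simp add: p_def)
  obtain a g0 where a: "a \<in> lists T" "g0 \<in> lists S" "p \<simeq> a @ g0" "\<forall>t\<in>T. \<not> dv [t] g0"
    using factor_letters[OF T pS] by blast
  note aS = in_lists_mono[OF T a(1)]
  have c: "?z \<in> carrier A" "?n \<in> carrier A" "cl u \<in> carrier A" "cl p \<in> carrier A" "cl a \<in> carrier A"
    "cl g0 \<in> carrier A" "cl [t] \<in> carrier A"
    using DS_lists u(1) pS aS a(2) t T by auto
  have "2 * n = n + n" by simp
  then have "?z = ?n \<cdot> ?n" using DS_lists cl_mult pw_add by metis
  then have zg: "?z \<cdot> g = cl p"
    using c u DS_lists by (simp add: p_def A.m_assoc flip: cl_mult) (simp flip: A.m_assoc)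
  have p_ag: "cl p = cl a \<cdot> cl g0" using a(2,3) aS pS cl_eq_iff by (simp add: cl_mult)
  have g0: "cl g0 = inv\<^bsub>A\<^esub> cl a \<cdot> (?z \<cdot> g)"
    unfolding zg p_ag using c by (simp flip: A.m_assoc)
  have "cl g0 \<cdot> cl [t] \<cdot> inv\<^bsub>A\<^esub> cl g0 =
      inv\<^bsub>A\<^esub> cl a \<cdot> (?z \<cdot> (g \<cdot> cl [t] \<cdot> inv\<^bsub>A\<^esub> g) \<cdot> inv\<^bsub>A\<^esub> ?z) \<cdot> cl a"
    unfolding g0 using c gA by (simp add: A.inv_mult_group A.m_assoc)
  also have "?z \<cdot> (g \<cdot> cl [t] \<cdot> inv\<^bsub>A\<^esub> g) \<cdot> inv\<^bsub>A\<^esub> ?z = g \<cdot> cl [t] \<cdot> inv\<^bsub>A\<^esub> g"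
    using c gA Delta_even_central[of "g \<cdot> cl [t] \<cdot> inv\<^bsub>A\<^esub> g" n] by (simp add: A.m_assoc)
  finally have "cl g0 \<cdot> cl [t] \<cdot> inv\<^bsub>A\<^esub> cl g0 =
      inv\<^bsub>A\<^esub> cl a \<cdot> (g \<cdot> cl [t] \<cdot> inv\<^bsub>A\<^esub> g) \<cdot> cl a" .
  also have "\<dots> \<in> ?P"
    using gP[OF tP] cl_parabolic[OF T a(1)] subgroup.m_closed[OF sub] subgroup.m_inv_closed[OF sub] by blast
  finally obtain t' where t': "t' \<in> T" "t' # g0 \<simeq> g0 @ [t]"
    using reduced_normalizer_ribbon[OF T a(2) _ t] a(4) by blast
  have "nl 6 (cl g0)" using nl_ribbon[OF a(2) _ _ t'(2)] t t'(1) T by blast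
  moreover have "nl 3 (cl a)" using nl_parabolic[OF assms(1) a(1)] .
  moreover have "nl 3 (inv\<^bsub>A\<^esub> ?z)" using nl_pw_D nl_inv by blast
  ultimately have "nl (3 + (3 + 6)) (inv\<^bsub>A\<^esub> ?z \<cdot> (cl a \<cdot> cl g0))"
    using nl_mult by blast
  moreover have "inv\<^bsub>A\<^esub> ?z \<cdot> (cl a \<cdot> cl g0) = g"
    unfolding p_ag[symmetric] zg[symmetric] using c gA by (simp flip: A.m_assoc)
  ultimately show ?thesis by simp
qed

section \<open>The two comparisons\<close>

theorem X_abs_preceq_X_NP: "gen_preceq A (X_abs S k) (X_NP S k)"
proof (rule A.gen_preceqI[OF X_abs_carrier])
  fix y assume "y \<in> X_NP S k"
  then show "nl 12 y"
    using nl_normalizer by (auto simp: X_NP_def proper_irred_parabolics_def irreducible_type_def)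
qed

lemma parabolic_in_normalizer:
  assumes "T \<subseteq> S"
  shows "std_parabolic S k T \<subseteq> normalizer A (std_parabolic S k T)"
proof
  note sub = parabolic_subgroup[OF assms]
  fix g assume g: "g \<in> std_parabolic S k T"
  then show "g \<in> normalizer A (std_parabolic S k T)"
    using subgroup.subset[OF sub] subgroup.m_closed[OF sub] subgroup.m_inv_closed[OF sub]
    by (intro A.normalizerI) auto
qed

lemma center_normalizes:
  assumes "T \<subseteq> S" "z \<in> carrier A" "\<And>x. x \<in> carrier A \<Longrightarrow> z \<cdot> x = x \<cdot> z"
  shows "z \<in> normalizer A (std_parabolic S k T)"
proof (rule A.normalizerI)
  show PA: "std_parabolic S k T \<subseteq> carrier A" using subgroup.subset[OF parabolic_subgroup[OF assms(1)]] .
  show "z \<in> carrier A" by fact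
  fix x assume x: "x \<in> std_parabolic S k T"
  then have xc: "x \<in> carrier A" using PA by blast
  have "z \<cdot> x \<cdot> inv\<^bsub>A\<^esub> z = x" using assms(2,3) xc by (simp add: A.m_assoc)
  then show "z \<cdot> x \<cdot> inv\<^bsub>A\<^esub> z \<in> std_parabolic S k T" using x by simp
  have "inv\<^bsub>A\<^esub> z \<cdot> x \<cdot> z = inv\<^bsub>A\<^esub> z \<cdot> (z \<cdot> x)" using assms(2,3) xc by (simp add: A.m_assoc)
  then have "inv\<^bsub>A\<^esub> z \<cdot> x \<cdot> z = x" using assms(2) xc by (simp flip: A.m_assoc)
  then show "inv\<^bsub>A\<^esub> z \<cdot> x \<cdot> z \<in> std_parabolic S k T" using x by simp
qed

lemma generate_center:
  assumes "d \<in> carrier A" "\<And>x. x \<in> carrier A \<Longrightarrow> d \<cdot> x = x \<cdot> d"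
    "z \<in> generate A {d}"
  shows "z \<in> carrier A \<and> (\<forall>x\<in>carrier A. z \<cdot> x = x \<cdot> z)"
  using assms(3)
proof (induction rule: generate.induct)
  case (inv h)
  then show ?case using assms(1,2) A.commute_inv[of _ d] by auto
next
  case (eng y z)
  then show ?case by (metis A.m_assoc A.m_closed)
qed (use assms(1,2) in auto)

text \<open>A central element normalizes every parabolic subgroup; a single letter supplies one that
  is proper and irreducible.\<close>

lemma X_P_subset_X_NP: "X_P S k \<subseteq> X_NP S k"
proof
  fix y assume "y \<in> X_P S k"
  then consider P where "P \<in> proper_irred_parabolics S k" "y \<in> P"
    | "y \<in> generate A {garside S k [^]\<^bsub>A\<^esub> (2::nat)}" by (auto simp: X_P_def)
  then show "y \<in> X_NP S k"
  proof cases
    case 1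
    then show ?thesis using parabolic_in_normalizer unfolding X_NP_def proper_irred_parabolics_def by blast
  next
    case 2
    have D2: "garside S k [^]\<^bsub>A\<^esub> (2::nat) = cl (pw (2 * 1) (D S))" by (simp add: garside_cl Delta_pow)
    have "y \<in> carrier A \<and> (\<forall>x\<in>carrier A. y \<cdot> x = x \<cdot> y)"
      using 2 Delta_even_central[of _ 1] DS_lists unfolding D2 by (intro generate_center) auto
    moreover obtain s where s: "s \<in> S" using S_nonempty by blast
    moreover obtain t where "{s, t} \<subset> S" using small_pair[OF s] by blast
    then have "{s} \<subset> S" by blast
    moreover have "irreducible_type {s} k" by (simp add: irreducible_type_def)
    ultimately show ?thesis
      using center_normalizes[of "{s}" y] unfolding X_NP_def proper_irred_parabolics_def by blast
  qed
qed

theorem X_NP_preceq_X_P: "gen_preceq A (X_NP S k) (X_P S k)"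
proof -
  have "X_NP S k \<subseteq> carrier A" by (auto simp: X_NP_def normalizer_def stabilizer_def)
  then show ?thesis
    using A.gen_preceqI[of "X_NP S k" "X_P S k" 1] A.norm_le_base X_P_subset_X_NP by blast
qed

end

theorem proposition4p9:
  fixes S :: "'s set" and m :: "'s \<Rightarrow> 's \<Rightarrow> enat"
  assumes "finite S" and "coxeter_matrix S m"
    and "irreducible_type S m" and "spherical_type S m" and "card S \<ge> 3"
  shows "gen_preceq (artin_group S m) (X_abs S m) (X_NP S m) \<and>
         gen_preceq (artin_group S m) (X_NP S m) (X_P S m)"
proof -
  define M where "M s t = the_enat (m s t)" for s t
  have M: "m s t = enat (M s t)" if "s \<in> S" "t \<in> S" for s t
    using spherical_finite_entries[OF assms(1,2,4) that] by (auto simp: M_def)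
  interpret G: coxeter_geometry S M
  proof
    show "finite S" by fact
    fix s assume s: "s \<in> S"
    have "m s s = 1" using assms(2) s unfolding coxeter_matrix_def by blast
    then show "M s s = 1" by (simp add: M_def one_enat_def)
    fix t assume t: "t \<in> S"
    have "m s t = m t s" using assms(2) s t unfolding coxeter_matrix_def by blast
    then show "M s t = M t s" by (simp add: M_def)
    assume "s \<noteq> t"
    then have "2 \<le> m s t" using assms(2) s t unfolding coxeter_matrix_def by blast
    then show "2 \<le> M s t" using M[OF s t] by (simp add: numeral_eq_enat)
  qed
  let ?cong = "pres_cong S (braid_relations S m \<union> square_relations S)"
  have "finite G.W"
  proof (rule finite_surj)
    show "finite (carrier (coxeter_group S m))" using assms(4) by (simp add: spherical_type_def)
    \<comment> \<open>A class is sent to the value of an arbitrary representative;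
      \<open>pres_cong_ev\<close> makes this independent of the choice.\<close>
    show "G.W \<subseteq> (\<lambda>X. G.ev (map fst (SOME x. x \<in> X))) ` carrier (coxeter_group S m)"
    proof
      fix w assume "w \<in> G.W"
      then obtain u where u: "u \<in> lists S" "w = G.ev u" by (auto simp: G.W_def)
      let ?u = "map (\<lambda>s. (s, True)) u"
      have uw: "?u \<in> words S" using u by auto
      then have "?u \<in> ?cong `` {?u}" using pres_cong.refl by auto
      then have "(SOME x. x \<in> ?cong `` {?u}) \<in> ?cong `` {?u}" by (rule someI)
      then have "(?u, SOME x. x \<in> ?cong `` {?u}) \<in> ?cong" by simp
      then have "G.ev (map fst ?u) = G.ev (map fst (SOME x. x \<in> ?cong `` {?u}))"
        by (rule G.pres_cong_ev[rotated]) (simp add: M_def)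
      then have "w = G.ev (map fst (SOME x. x \<in> ?cong `` {?u}))" using u by (simp add: comp_def)
      moreover have "?cong `` {?u} \<in> carrier (coxeter_group S m)"
        using uw by (auto simp: coxeter_group_def presented_group_def intro: quotientI)
      ultimately show "w \<in> (\<lambda>X. G.ev (map fst (SOME x. x \<in> X))) ` carrier (coxeter_group S m)" by blast
    qed
  qed
  then interpret C: artin_rank3 S G.R M m
    using G.finite_S G.m_sym G.m_ge2 G.braid_relation G.len_alt G.left_exchange M assms(5)
    by unfold_locales auto
  show ?thesis using C.X_abs_preceq_X_NP C.X_NP_preceq_X_P by simp
qed

end
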